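(* Let $\boldsymbol{Q}\in\mathbb{R}^{dn\times dn}$ be a positive definite block-factorizable matrix defined by $\{\boldsymbol{U}_i\}_{i\in[n]}$ and $\{\boldsymbol{V}_i\}_{i\in[n]}$ in $\mathbb{R}^{d\times d}$, with associated matrices $\boldsymbol{\Lambda}_{[i\to j]}$, and let $\boldsymbol{a}\in\mathbb{R}^{dn}$, $\boldsymbol{c}\in\mathbb{R}^n$. The problem $$\min\ -\frac14\boldsymbol{a}^\top\boldsymbol{W}\boldsymbol{a}+\boldsymbol{c}^\top\boldsymbol{z}\quad\text{s.t. }(\boldsymbol{z},\boldsymbol{W})\in P^B_{\boldsymbol{Q}}:=\mathrm{conv}\left(\left\{\left(\boldsymbol{e}_S,\hat{\boldsymbol{Q}}_{[S]}^{-1}\right)\right\}_{S\subseteq[n]}\right)$$ can be solved in $\mathcal{O}(n^2\cdot\pi(d))$ time as a shortest path problem (from vertex $0$ to vertex $n+1$) on the directed acyclic graph $\mathcal{G}=(V,A)$ with $V=\{0,\dots,n+1\}$ and $A=\{(i,j):0\le i<j\le n+1\}$, with arc costs $$\ell_{ij}=\begin{cases}0,& i=0,\ 1\le j\le n+1\\ c_i-\frac14\boldsymbol{a}^\top\boldsymbol{\Lambda}_{[i\to j]}\boldsymbol{a},&1\le i<j\le n+1,\end{cases}$$ where $\pi(d)$ denotes the computational complexity of the multiplication of two $d\times d$ matrices and the inversion of a $d\times d$ matrix.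
   Context: $[n]=\{1,\dots,n\}$. Matrices in $\mathbb{R}^{dn\times dn}$ have $n^2$ blocks of size $d\times d$. $\boldsymbol{E}_i\in\mathbb{R}^{dn\times d}$ is the block column whose $i$-th $d\times d$ block is the identity and whose other blocks are zero. $\boldsymbol{e}_S\in\mathbb{R}^n$ is the $0/1$ indicator vector of $S\subseteq[n]$. $\hat{\boldsymbol{Q}}_{[S]}^{-1}\in\mathbb{R}^{dn\times dn}$ is obtained by taking the block principal submatrix $\boldsymbol{Q}_{[S]}$ (block rows and columns in $S$), inverting it, and placing the blocks of the inverse in block positions $S\times S$ of a $dn\times dn$ matrix with zeros elsewhere; $\hat{\boldsymbol{Q}}_{[\emptyset]}^{-1}$ is the zero matrix. A symmetric matrix $\boldsymbol{Q}\in\mathbb{R}^{dn\times dn}$ is block-factorizable, defined by $\{\boldsymbol{U}_i\}_{i\in[n]}$, $\{\boldsymbol{V}_i\}_{i\in[n]}\subset\mathbb{R}^{d\times d}$, if its $(i,j)$-th block is $\boldsymbol{U}_i\boldsymbol{V}_j^\top$ for all $i\le j$. When $\boldsymbol{Q}$ is positive definite, $\boldsymbol{U}_i\boldsymbol{V}_i^\top\succ\boldsymbol{0}$ for all $i$ (so $\boldsymbol{U}_i,\boldsymbol{V}_i$ are nonsingular) and $\boldsymbol{U}_i\boldsymbol{V}_i^\top-\boldsymbol{U}_i\boldsymbol{U}_j^{-1}\boldsymbol{V}_j\boldsymbol{U}_i^\top\succ\boldsymbol{0}$ for all $i<j$, so the following matrices are well defined: $$\boldsymbol{\Lambda}_{[i\to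 j]}:=\left(\boldsymbol{E}_i-\boldsymbol{E}_j\boldsymbol{U}_j^{-\top}\boldsymbol{U}_i^\top\right)\left(\boldsymbol{U}_i\boldsymbol{V}_i^\top-\boldsymbol{U}_i\boldsymbol{U}_j^{-1}\boldsymbol{V}_j\boldsymbol{U}_i^\top\right)^{-1}\left(\boldsymbol{E}_i-\boldsymbol{E}_j\boldsymbol{U}_j^{-\top}\boldsymbol{U}_i^\top\right)^\top,\quad 1\le i<j\le n,$$ $$\boldsymbol{\Lambda}_{[i\to n+1]}:=\boldsymbol{E}_i\left(\boldsymbol{U}_i\boldsymbol{V}_i^\top\right)^{-1}\boldsymbol{E}_i^\top,\quad 1\le i\le n.$$ The input data are the $\boldsymbol{U}_i$, $\boldsymbol{V}_i$, $\boldsymbol{a}$, $\boldsymbol{c}$, and time is counted in arithmetic operations. *)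

theory Defs
  imports
    "HOL-Library.Extended_Real"
    "Jordan_Normal_Form.Gauss_Jordan_Elimination"
    "Jordan_Normal_Form.DL_Submatrix"
    "Graph_Theory.Shortest_Path"
begin

text \<open>
  Conventions. The block indices range over \<open>{1..n}\<close>, while the entries of vectors and
  matrices are numbered from 0 as usual in \<open>Jordan_Normal_Form\<close>. Thus block \<open>i\<close> of a
  \<open>dn\<close>-dimensional object consists of the positions \<open>(i - 1) * d + r\<close> with \<open>r < d\<close>, and
  coordinate \<open>i \<in> {1..n}\<close> of a vector \<open>c\<close> is \<open>c $ (i - 1)\<close>.
\<close>

section \<open>Matrices\<close>

definition pos_def :: "real mat \<Rightarrow> bool" where
  "pos_def A \<longleftrightarrow> square_mat A \<and> transpose_mat A = A \<and>
     (\<forall>x \<in> carrier_vec (dim_row A). x \<noteq> 0\<^sub>v (dim_row A) \<longrightarrow> x \<bullet> (A *\<^sub>v x) > 0)"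

text \<open>Unspecified if the matrix is singular.\<close>

definition inv_mat :: "real mat \<Rightarrow> real mat" where
  "inv_mat A = the (mat_inverse A)"

definition block :: "nat \<Rightarrow> real mat \<Rightarrow> nat \<Rightarrow> nat \<Rightarrow> real mat" where
  "block d A i j = mat d d (\<lambda>(r, s). A $$ ((i - 1) * d + r, (j - 1) * d + s))"

definition block_column :: "nat \<Rightarrow> nat \<Rightarrow> nat \<Rightarrow> real mat" where
  "block_column d n i = mat (d * n) d (\<lambda>(r, s). if r = (i - 1) * d + s then 1 else 0)"

definition block_positions :: "nat \<Rightarrow> nat set \<Rightarrow> nat set" where
  "block_positions d S = {(i - 1) * d + r | i r. i \<in> S \<and> r < d}"

definition block_factorizable ::
    "nat \<Rightarrow> nat \<Rightarrow> (nat \<Rightarrow> real mat) \<Rightarrow> (nat \<Rightarrow> real mat) \<Rightarrow> real mat \<Rightarrow> bool" where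
  "block_factorizable d n U V Q \<longleftrightarrow>
     Q \<in> carrier_mat (d * n) (d * n) \<and> transpose_mat Q = Q \<and>
     (\<forall>i \<in> {1..n}. U i \<in> carrier_mat d d \<and> V i \<in> carrier_mat d d) \<and>
     (\<forall>i \<in> {1..n}. \<forall>j \<in> {1..n}. i \<le> j \<longrightarrow> block d Q i j = U i * transpose_mat (V j))"

definition indicator_vec :: "nat \<Rightarrow> nat set \<Rightarrow> real vec" where
  "indicator_vec n S = vec n (\<lambda>k. if k + 1 \<in> S then 1 else 0)"

text \<open>
  The inverse of the principal submatrix, padded with zeros. The position \<open>r \<in> I\<close> of the
  large matrix corresponds to position \<open>card {k \<in> I. k < r}\<close> of the submatrix.
\<close>

definition padded_inverse :: "nat \<Rightarrow> nat \<Rightarrow> real mat \<Rightarrow> nat set \<Rightarrow> real mat" where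
  "padded_inverse d n Q S =
     (let I = block_positions d S;
          B = inv_mat (submatrix Q I I)
      in mat (d * n) (d * n) (\<lambda>(r, s).
           if r \<in> I \<and> s \<in> I then B $$ (card {k \<in> I. k < r}, card {k \<in> I. k < s}) else 0))"

definition Lambda ::
    "nat \<Rightarrow> nat \<Rightarrow> (nat \<Rightarrow> real mat) \<Rightarrow> (nat \<Rightarrow> real mat) \<Rightarrow> nat \<Rightarrow> nat \<Rightarrow> real mat" where
  "Lambda d n U V i j =
     (if j = n + 1
      then block_column d n i * inv_mat (U i * transpose_mat (V i)) *
           transpose_mat (block_column d n i)
      else let F = block_column d n i -
                   block_column d n j * (transpose_mat (inv_mat (U j)) * transpose_mat (U i))
           in F * inv_mat (U i * transpose_mat (V i) -
                           U i * inv_mat (U j) * V j * transpose_mat (U i)) * transpose_mat F)"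

section \<open>The optimization problem\<close>

text \<open>
  The type of matrices with carriers is not a vector space, so \<open>convex hull\<close> is not applicable.
  The convex hull of the finite family of points is written out as the set of its convex
  combinations, with weights \<open>w\<close>.
\<close>

definition P_B :: "nat \<Rightarrow> nat \<Rightarrow> real mat \<Rightarrow> (real vec \<times> real mat) set" where
  "P_B d n Q = {(z, W). \<exists>w :: nat set \<Rightarrow> real.
     (\<forall>S \<in> Pow {1..n}. w S \<ge> 0) \<and> (\<Sum>S \<in> Pow {1..n}. w S) = 1 \<and>
     z = vec n (\<lambda>k. \<Sum>S \<in> Pow {1..n}. w S * indicator_vec n S $ k) \<and>
     W = mat (d * n) (d * n) (\<lambda>rs. \<Sum>S \<in> Pow {1..n}. w S * padded_inverse d n Q S $$ rs)}"

definition objective :: "real vec \<Rightarrow> real vec \<Rightarrow> real vec \<times> real mat \<Rightarrow> real" where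
  "objective a c = (\<lambda>(z, W). - (1/4) * (a \<bullet> (W *\<^sub>v a)) + c \<bullet> z)"

section \<open>The shortest path problem\<close>

definition dag :: "nat \<Rightarrow> (nat, nat \<times> nat) pre_digraph" where
  "dag n = \<lparr>verts = {0..n + 1}, arcs = {(i, j). i < j \<and> j \<le> n + 1}, tail = fst, head = snd\<rparr>"

lemma wf_digraph_dag: "wf_digraph (dag n)"
  by unfold_locales (auto simp: dag_def)

definition arc_cost ::
    "nat \<Rightarrow> nat \<Rightarrow> (nat \<Rightarrow> real mat) \<Rightarrow> (nat \<Rightarrow> real mat) \<Rightarrow> real vec \<Rightarrow> real vec \<Rightarrow> nat \<times> nat \<Rightarrow> real"
  where
  "arc_cost d n U V a c = (\<lambda>(i, j).
     if i = 0 then 0 else c $ (i - 1) - 1/4 * (a \<bullet> (Lambda d n U V i j *\<^sub>v a)))"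

definition path_length :: "(nat \<times> nat \<Rightarrow> real) \<Rightarrow> (nat \<times> nat) list \<Rightarrow> real" where
  "path_length l p = wf_digraph.awalk_cost l p"

definition shortest_path :: "nat \<Rightarrow> (nat \<times> nat \<Rightarrow> real) \<Rightarrow> (nat \<times> nat) list \<Rightarrow> bool" where
  "shortest_path n l p \<longleftrightarrow> pre_digraph.apath (dag n) 0 p (n + 1) \<and>
     ereal (path_length l p) = wf_digraph.\<mu> (dag n) l 0 (n + 1)"

definition inner_verts :: "nat \<Rightarrow> (nat \<times> nat) list \<Rightarrow> nat set" where
  "inner_verts n p = set (pre_digraph.awalk_verts (dag n) 0 p) - {0, n + 1}"

section \<open>Arithmetic complexity\<close>

text \<open>
  The model of computation is the algebraic computation tree over the reals. The state is the
  list of all values available so far, initially the input; it is only ever extended at the end.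
  Arithmetic operations and comparisons cost 1 each, loading a rational constant and selecting
  the output is free. A program fails (result \<^const>\<open>None\<close>) if it divides by 0 or accesses a value that
  is not there.
\<close>

datatype arith = Plus | Minus | Times | Divide

datatype program =
    Output "nat list"
  | Load rat program
  | Arith arith nat nat program
  | If_le nat nat program program

fun arith_val :: "arith \<Rightarrow> real \<Rightarrow> real \<Rightarrow> real option" where
  "arith_val Plus x y = Some (x + y)"
| "arith_val Minus x y = Some (x - y)"
| "arith_val Times x y = Some (x * y)"
| "arith_val Divide x y = (if y = 0 then None else Some (x / y))"

definition tick :: "(real list \<times> nat) option \<Rightarrow> (real list \<times> nat) option" where
  "tick = map_option (\<lambda>(ys, t). (ys, t + 1))"

fun exec :: "program \<Rightarrow> real list \<Rightarrow> (real list \<times> nat) option" where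
  "exec (Output ks) m =
     (if \<forall>k \<in> set ks. k < length m then Some (map (\<lambda>k. m ! k) ks, 0) else None)"
| "exec (Load q P) m = exec P (m @ [of_rat q])"
| "exec (Arith f i j P) m =
     (if i < length m \<and> j < length m
      then case arith_val f (m ! i) (m ! j) of
             None \<Rightarrow> None
           | Some x \<Rightarrow> tick (exec P (m @ [x]))
      else None)"
| "exec (If_le i j P P') m =
     (if i < length m \<and> j < length m
      then tick (if m ! i \<le> m ! j then exec P m else exec P' m)
      else None)"

definition computes_within :: "nat \<Rightarrow> program \<Rightarrow> real list \<Rightarrow> real list \<Rightarrow> bool" where
  "computes_within t P xs ys \<longleftrightarrow> (\<exists>s \<le> t. exec P xs = Some (ys, s))"

definition entries :: "real mat \<Rightarrow> real list" where
  "entries A = concat (mat_to_list A)"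

definition mult_complexity :: "nat \<Rightarrow> nat" where
  "mult_complexity d = (LEAST t. \<exists>P. \<forall>A \<in> carrier_mat d d. \<forall>B \<in> carrier_mat d d.
     computes_within t P (entries A @ entries B) (entries (A * B)))"

definition inv_complexity :: "nat \<Rightarrow> nat" where
  "inv_complexity d = (LEAST t. \<exists>P. \<forall>A \<in> carrier_mat d d. invertible_mat A \<longrightarrow>
     computes_within t P (entries A) (entries (inv_mat A)))"

definition mat_complexity :: "nat \<Rightarrow> nat" where
  "mat_complexity d = mult_complexity d + inv_complexity d"

definition problem_input ::
    "nat \<Rightarrow> (nat \<Rightarrow> real mat) \<Rightarrow> (nat \<Rightarrow> real mat) \<Rightarrow> real vec \<Rightarrow> real vec \<Rightarrow> real list" where
  "problem_input n U V a c =
     concat (map (\<lambda>i. entries (U i)) [1..<n + 1]) @ concat (map (\<lambda>i. entries (V i)) [1..<n + 1]) @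
     list_of_vec a @ list_of_vec c"

text \<open>The optimal value together with the optimal solution \<open>(z, W)\<close>.\<close>

definition problem_output :: "real \<Rightarrow> real vec \<times> real mat \<Rightarrow> real list" where
  "problem_output v = (\<lambda>(z, W). v # list_of_vec z @ entries W)"

end

theory Submission
  imports Defs "HOL-Library.Sublist" "Jordan_Normal_Form.Determinant"
begin

text \<open>
  If \<open>S = {i} \<union> S'\<close> with
  \<open>i < j = min S'\<close>, then block row \<open>i\<close> of \<open>Q\<close>, restricted to \<open>S'\<close>, is \<open>U\<^sub>i U\<^sub>j\<^sup>-\<^sup>1\<close>
  times block row \<open>j\<close>. Hence the Schur complement of the block \<open>i\<close> involves only \<open>j\<close>, and block
  elimination adds \<open>\<Lambda>\<^bsub>[i\<rightarrow>j]\<^esub>\<close> to the padded inverse for \<open>S'\<close>. So the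
  padded inverse for \<open>S\<close> is the sum of the \<open>\<Lambda>\<close>'s along the path \<open>0 \<rightarrow> S \<rightarrow> n + 1\<close>,
  the length of this path is the objective value of the vertex of \<open>P_B\<close> given by \<open>S\<close>, and a linear
  function is minimal at a vertex.

  For the running time, all arc costs are computed with \<open>O(n\<^sup>2)\<close> operations on \<open>d \<times> d\<close> matrices,
  followed by dynamic programming on the graph. A matrix addition costs \<open>d\<^sup>2\<close>, which is bounded by the
  cost of a multiplication because a multiplication program has to read all its \<open>2 d\<^sup>2\<close> inputs.
\<close>

section \<open>Programs in continuation-passing style\<close>

text \<open>The elimination is carried out as a telescoping identity. Write \<open>Lambda\<close> as
  F M^-1 F^T with M the Schur complement. Block row k of Q F is U_k U_i^-1 M for k <= i and 0 for k
  >= j, so block row k of Q times \<open>Lambda\<close> is U_k (U_i^-1 E_i^T - U_j^-1 E_j^T) or 0.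
  Summed along a path through k, only U_k U_k^-1 E_k^T = E_k^T survives. Rows strictly between i and
  j never matter, as they are not in S. The sink n + 1 behaves like a block index whose block is
  zero.

  On the complexity side, \<open>mult_complexity\<close> and \<open>inv_complexity\<close> are
  \<open>LEAST\<close> elements and say nothing unless some program exists, so programs for both are
  constructed. The final program may depend on n and d only, while the optimal path depends on the
  data. This is resolved by branching: the path is never stored in memory, and after each comparison
  every branch continues with its own program, in which the current paths are known. The tree may
  become huge, but only the executed branch is charged. Selecting output is free, so the zero blocks
  of W cost nothing.\<close>

text \<open>A computation is given the length of the memory and a continuation, which receives the result
  and the new length of the memory. A result is any value that is determined by the branches taken,
  such as an address or a path.\<close>

type_synonym 'a comp = "nat \<Rightarrow> ('a \<Rightarrow> nat \<Rightarrow> program) \<Rightarrow> program"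

text \<open>The final memory, the result and the cost are fixed before the continuation
  \<open>k\<close> is quantified, so a part costs the same whatever follows it. This is what makes
  time bounds add up in \<open>runs_bind\<close>.\<close>

definition runs :: "'a comp \<Rightarrow> real list \<Rightarrow> nat \<Rightarrow> (real list \<Rightarrow> 'a \<Rightarrow> bool) \<Rightarrow> bool" where
  "runs c m t \<Phi> \<longleftrightarrow> (\<exists>m' x s. prefix m m' \<and> s \<le> t \<and> \<Phi> m' x \<and>
     (\<forall>k. exec (c (length m) k) m =
        map_option (\<lambda>(ys, u). (ys, u + s)) (exec (k x (length m')) m')))"

definition ret :: "'a \<Rightarrow> 'a comp" where
  "ret x = (\<lambda>l k. k x l)"

definition bind :: "'a comp \<Rightarrow> ('a \<Rightarrow> 'b comp) \<Rightarrow> 'b comp" where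
  "bind c f = (\<lambda>l k. c l (\<lambda>x l'. f x l' k))"

definition load :: "rat \<Rightarrow> nat comp" where
  "load q = (\<lambda>l k. Load q (k l (Suc l)))"

definition arith :: "arith \<Rightarrow> nat \<Rightarrow> nat \<Rightarrow> nat comp" where
  "arith f i j = (\<lambda>l k. Arith f i j (k l (Suc l)))"

text \<open>The outcome of the comparison becomes a Boolean of the logic: the continuation is
  instantiated once per outcome, and the two instances may differ arbitrarily.\<close>

definition if_le :: "nat \<Rightarrow> nat \<Rightarrow> bool comp" where
  "if_le i j = (\<lambda>l k. If_le i j (k True l) (k False l))"

definition stored :: "real list \<Rightarrow> nat \<Rightarrow> real \<Rightarrow> bool" where
  "stored m i x \<longleftrightarrow> i < length m \<and> m ! i = x"

lemma stored_prefix: "stored m i x \<Longrightarrow> prefix m m' \<Longrightarrow> stored m' i x"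
  by (auto simp: stored_def prefix_def nth_append)

lemma tick_eq: "tick = map_option (\<lambda>(ys, u). (ys, u + 1))"
  by (simp add: tick_def)

lemma option_cost_id: "map_option (\<lambda>(ys, u). (ys, u + (0::nat))) r = r" "map_option id r = r"
  by (cases r; auto)+

lemma option_cost_add:
  "map_option (\<lambda>(ys, u). (ys, u + s)) (map_option (\<lambda>(ys, u). (ys, u + s')) r)
   = map_option (\<lambda>(ys, u). (ys, u + (s + s' :: nat))) r"
  by (cases r; auto)+

lemma runs_mono:
  assumes "runs c m t \<Phi>" "t \<le> t'" "\<And>m' x. prefix m m' \<Longrightarrow> \<Phi> m' x \<Longrightarrow> \<Psi> m' x"
  shows "runs c m t' \<Psi>"
  using assms unfolding runs_def by (meson order_trans)

lemma runs_ret: "\<Phi> m x \<Longrightarrow> runs (ret x) m t \<Phi>"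
  unfolding runs_def ret_def by (auto simp: option_cost_id intro!: exI[of _ m] exI[of _ x] exI[of _ 0])

lemma runs_bind:
  assumes c: "runs c m t1 \<Phi>"
    and f: "\<And>m' x. prefix m m' \<Longrightarrow> \<Phi> m' x \<Longrightarrow> runs (f x) m' t2 \<Psi>"
    and t: "t1 + t2 \<le> t"
  shows "runs (bind c f) m t \<Psi>"
proof -
  from c obtain m1 x s1 where 1: "prefix m m1" "s1 \<le> t1" "\<Phi> m1 x"
    "\<And>k. exec (c (length m) k) m = map_option (\<lambda>(ys, u). (ys, u + s1)) (exec (k x (length m1)) m1)"
    unfolding runs_def by blast
  from f[OF 1(1,3)] obtain m2 y s2 where 2: "prefix m1 m2" "s2 \<le> t2" "\<Psi> m2 y"
    "\<And>k. exec (f x (length m1) k) m1 = map_option (\<lambda>(ys, u). (ys, u + s2)) (exec (k y (length m2)) m2)"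
    unfolding runs_def by blast
  have "prefix m m2" using 1 2 by (meson prefix_order.trans)
  moreover have "s1 + s2 \<le> t" using 1 2 t by simp
  ultimately show ?thesis
    unfolding runs_def bind_def using 1(4) 2(3,4) option_cost_add by fastforce
qed

lemma runs_load: "runs (load q) m t (\<lambda>m' i. stored m' i (of_rat q))"
  unfolding runs_def load_def
  by (rule exI[of _ "m @ [of_rat q]"], rule exI[of _ "length m"], rule exI[of _ 0])
     (auto simp: stored_def option_cost_id)

lemma runs_arith:
  assumes "stored m i x" "stored m j y" "arith_val f x y = Some z" "1 \<le> t"
  shows "runs (arith f i j) m t (\<lambda>m' i. stored m' i z)"
  unfolding runs_def arith_def
  by (rule exI[of _ "m @ [z]"], rule exI[of _ "length m"], rule exI[of _ 1])
     (use assms in \<open>auto simp: stored_def tick_def\<close>)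

lemma runs_if_le:
  assumes "stored m i x" "stored m j y" "1 \<le> t"
  shows "runs (if_le i j) m t (\<lambda>m' b. b = (x \<le> y))"
  unfolding runs_def if_le_def
  by (rule exI[of _ m], rule exI[of _ "x \<le> y"], rule exI[of _ 1])
     (use assms in \<open>auto simp: stored_def tick_def\<close>)

text \<open>A given program expects its input at addresses 0, 1, ... and halts at
  \<open>Output\<close>. Here \<open>as\<close> translates its addresses into those of the
  surrounding memory, and \<open>Output\<close> hands the selected addresses to the continuation
  instead.\<close>

fun embed :: "program \<Rightarrow> nat list \<Rightarrow> nat list comp" where
  "embed (Output ks) as l k = k (map ((!) as) ks) l"
| "embed (Load q P) as l k = Load q (embed P (as @ [l]) (Suc l) k)"
| "embed (Arith f i j P) as l k = Arith f (as ! i) (as ! j) (embed P (as @ [l]) (Suc l) k)"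
| "embed (If_le i j P P') as l k = If_le (as ! i) (as ! j) (embed P as l k) (embed P' as l k)"

text \<open>The invariant is that the translated cells hold the values of the original memory. It
  survives every instruction because both memories grow by the same value and no cell is ever
  overwritten.\<close>

lemma runs_embed:
  assumes "exec P xs = Some (ys, s)" "list_all2 (stored m) as xs" "s \<le> t"
  shows "runs (embed P as) m t (\<lambda>m' bs. list_all2 (stored m') bs ys)"
  using assms
proof (induction P arbitrary: xs as m s t)
  case (Output ks)
  have len: "length as = length xs" using Output by (auto dest: list_all2_lengthD)
  from Output have "ys = map ((!) xs) ks" "\<forall>k\<in>set ks. k < length xs" by (auto split: if_splits)
  then have "list_all2 (stored m) (map ((!) as) ks) ys"
    using Output(2) len by (auto simp: list_all2_conv_all_nth)
  then show ?case unfolding runs_def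
    by (intro exI[of _ m] exI[of _ "map ((!) as) ks"] exI[of _ 0]) (auto simp: option_cost_id)
next
  case (Load q P)
  let ?m = "m @ [of_rat q]"
  have a: "list_all2 (stored ?m) (as @ [length m]) (xs @ [of_rat q])"
    using Load.prems(2) by (auto intro!: list_all2_appendI elim!: list_all2_mono simp: stored_def nth_append)
  from Load.IH[OF _ a Load.prems(3)] Load.prems(1)
  have "runs (embed P (as @ [length m])) ?m t (\<lambda>m' bs. list_all2 (stored m') bs ys)" by simp
  then show ?case unfolding runs_def
    by (elim exE conjE, intro exI conjI) (auto dest: append_prefixD)
next
  case (Arith f i j P)
  have len: "length as = length xs" using Arith by (auto dest: list_all2_lengthD)
  from Arith.prems obtain x s' where ij: "i < length xs" "j < length xs"
    and x: "arith_val f (xs ! i) (xs ! j) = Some x" and P: "exec P (xs @ [x]) = Some (ys, s')"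
    and s: "s = s' + 1"
    by (auto split: if_splits option.splits simp: tick_def)
  let ?m = "m @ [x]"
  have a: "list_all2 (stored ?m) (as @ [length m]) (xs @ [x])"
    using Arith.prems(2) by (auto intro!: list_all2_appendI elim!: list_all2_mono simp: stored_def nth_append)
  have st: "as ! i < length m" "m ! (as ! i) = xs ! i" "as ! j < length m" "m ! (as ! j) = xs ! j"
    using Arith.prems(2) ij len by (auto simp: list_all2_conv_all_nth stored_def)
  obtain m' bs u where r: "prefix ?m m'" "u \<le> s'" "list_all2 (stored m') bs ys"
    "\<And>k. exec (embed P (as @ [length m]) (length ?m) k) ?m =
       map_option (\<lambda>(ys, v). (ys, v + u)) (exec (k bs (length m')) m')"
    using Arith.IH[OF P a order_refl] unfolding runs_def by blast
  have "exec (embed (Arith f i j P) as (length m) k) m =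
      map_option (\<lambda>(ys, v). (ys, v + (1 + u))) (exec (k bs (length m')) m')" for k
    using r(4)[of k] st x by (simp add: tick_eq option_cost_add[of 1, simplified])
  moreover have "prefix m m'" using r(1) by (auto dest: append_prefixD)
  moreover have "1 + u \<le> t" using r(2) s Arith.prems(3) by simp
  ultimately show ?case unfolding runs_def using r(3) by blast
next
  case (If_le i j P P')
  have len: "length as = length xs" using If_le by (auto dest: list_all2_lengthD)
  from If_le.prems obtain s' where ij: "i < length xs" "j < length xs"
    and P: "exec (if xs ! i \<le> xs ! j then P else P') xs = Some (ys, s')" and s: "s = s' + 1"
    by (auto split: if_splits option.splits simp: tick_def)
  have st: "as ! i < length m" "m ! (as ! i) = xs ! i" "as ! j < length m" "m ! (as ! j) = xs ! j"
    using If_le.prems(2) ij len by (auto simp: list_all2_conv_all_nth stored_def)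
  have "runs (embed (if xs ! i \<le> xs ! j then P else P') as) m s'
      (\<lambda>m' bs. list_all2 (stored m') bs ys)"
    using If_le.IH[OF _ If_le.prems(2)] P by (auto split: if_splits)
  then obtain m' bs u where r: "prefix m m'" "u \<le> s'" "list_all2 (stored m') bs ys"
    "\<And>k. exec (embed (if xs ! i \<le> xs ! j then P else P') as (length m) k) m =
       map_option (\<lambda>(ys, v). (ys, v + u)) (exec (k bs (length m')) m')"
    unfolding runs_def by blast
  have "exec (embed (If_le i j P P') as (length m) k) m =
      map_option (\<lambda>(ys, v). (ys, v + (1 + u))) (exec (k bs (length m')) m')" for k
    using r(4)[of k] st by (cases "xs ! i \<le> xs ! j") (simp_all add: tick_eq option_cost_add[of 1, simplified])
  moreover have "1 + u \<le> t" using r(2) s If_le.prems(3) by simp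
  ultimately show ?case unfolding runs_def using r(1,3) by blast
qed

text \<open>A loop that is unrolled while the program is built; the table itself lives in the logic
  and only the values its results refer to are in memory. Outside the list it is arbitrary.\<close>

fun tab :: "('i \<Rightarrow> 'a comp) \<Rightarrow> 'i list \<Rightarrow> ('i \<Rightarrow> 'a) comp" where
  "tab f [] = ret (\<lambda>_. undefined)"
| "tab f (i # is) = bind (f i) (\<lambda>x. bind (tab f is) (\<lambda>g. ret (g(i := x))))"

text \<open>\<open>R\<close> has to be stable under extension of the memory, because the result for
  the first index must remain valid while the rest of the table is computed.\<close>

lemma runs_tab:
  assumes f: "\<And>m' i. prefix m m' \<Longrightarrow> i \<in> set is \<Longrightarrow> runs (f i) m' t (R i)"
    and R: "\<And>i m1 m2 x. i \<in> set is \<Longrightarrow> R i m1 x \<Longrightarrow> prefix m1 m2 \<Longrightarrow> R i m2 x"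
    and T: "t * length is \<le> T"
  shows "runs (tab f is) m T (\<lambda>m' g. \<forall>i \<in> set is. R i m' (g i))"
  using assms
proof (induction "is" arbitrary: m T)
  case Nil
  show ?case by (auto intro: runs_ret)
next
  case (Cons i "is")
  show ?case unfolding tab.simps
  proof (rule runs_bind[where \<Phi> = "R i" and ?t1.0 = t and ?t2.0 = "t * length is"])
    show "runs (f i) m t (R i)" using Cons.prems(1) by simp
    fix m1 x assume 1: "prefix m m1" "R i m1 x"
    show "runs (bind (tab f is) (\<lambda>g. ret (g(i := x)))) m1 (t * length is)
      (\<lambda>m' g. \<forall>i\<in>set (i # is). R i m' (g i))"
    proof (rule runs_bind[where ?t2.0 = 0])
      show "runs (tab f is) m1 (t * length is) (\<lambda>m' g. \<forall>i\<in>set is. R i m' (g i))"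
      proof (rule Cons.IH)
        show "\<And>m' i. prefix m1 m' \<Longrightarrow> i \<in> set is \<Longrightarrow> runs (f i) m' t (R i)"
          using Cons.prems(1) 1(1) by (meson list.set_intros(2) prefix_order.trans)
        show "\<And>i m1 m2 x. i \<in> set is \<Longrightarrow> R i m1 x \<Longrightarrow> prefix m1 m2 \<Longrightarrow> R i m2 x"
          using Cons.prems(2) by (meson list.set_intros(2))
      qed simp
      fix m2 g assume 2: "prefix m1 m2" "\<forall>i\<in>set is. R i m2 (g i)"
      have "R i m2 x" by (rule Cons.prems(2)[OF _ 1(2) 2(1)]) simp
      with 2(2) show "runs (ret (g(i := x))) m2 0 (\<lambda>m' g. \<forall>i\<in>set (i # is). R i m' (g i))"
        by (intro runs_ret) auto
    qed simp
  qed (use Cons.prems(3) in simp)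
qed

text \<open>The results are still in the final memory, so \<open>Output\<close> selects them for
  free. The resulting program depends on the input only through its length.\<close>

lemma runs_imp_computes_within:
  assumes "runs c xs t (\<lambda>m as. list_all2 (stored m) as ys)"
  shows "computes_within t (c (length xs) (\<lambda>as l. Output as)) xs ys"
proof -
  from assms obtain m as s where s: "s \<le> t" and a: "list_all2 (stored m) as ys"
    and e: "exec (c (length xs) (\<lambda>as l. Output as)) xs =
      map_option (\<lambda>(ys, u). (ys, u + s)) (exec (Output as) m)"
    unfolding runs_def by blast
  have "exec (Output as) m = Some (ys, 0)"
    using a by (auto simp: list_all2_conv_all_nth stored_def in_set_conv_nth intro: nth_equalityI)
  with e s show ?thesis unfolding computes_within_def by auto
qed

section \<open>Complexity of multiplication and inversion\<close>

lemma nth_concat_uniform: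
  assumes "\<forall>xs \<in> set xss. length xs = k" "i < length xss" "r < k"
  shows "concat xss ! (i * k + r) = xss ! i ! r"
  using assms
proof (induction xss arbitrary: i)
  case (Cons xs xss)
  then show ?case by (cases i) (auto simp: nth_append)
qed simp

lemma length_concat_uniform:
  "\<forall>xs \<in> set xss. length xs = k \<Longrightarrow> length (concat xss) = length xss * k"
  by (induction xss) auto

lemma length_concat_mat_to_list: "length (concat (mat_to_list A)) = dim_row A * dim_col A"
  by (subst length_concat_uniform[of _ "dim_col A"]) (auto simp: mat_to_list_def)

lemma nth_concat_mat_to_list:
  assumes "i < dim_row A" "j < dim_col A"
  shows "concat (mat_to_list A) ! (i * dim_col A + j) = A $$ (i, j)"
  by (subst nth_concat_uniform) (use assms in \<open>auto simp: mat_to_list_def\<close>)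

lemma index_less_mult: "i < a \<Longrightarrow> j < b \<Longrightarrow> i * b + j < a * (b::nat)"
proof -
  assume "i < a" "j < b"
  then have "i * b + j < Suc i * b" by simp
  also have "\<dots> \<le> a * b" using \<open>i < a\<close> by (intro mult_le_mono) auto
  finally show ?thesis .
qed

text \<open>A stored matrix is represented by the matrix of its addresses, so transposing, sharing
  one cell between entries and assembling blocks are rearrangements of addresses and cost no
  operation.\<close>

definition mat_stored :: "real list \<Rightarrow> nat mat \<Rightarrow> real mat \<Rightarrow> bool" where
  "mat_stored m A X \<longleftrightarrow> dim_row A = dim_row X \<and> dim_col A = dim_col X \<and>
     (\<forall>i < dim_row X. \<forall>j < dim_col X. stored m (A $$ (i, j)) (X $$ (i, j)))"

lemma mat_stored_prefix: "mat_stored m A X \<Longrightarrow> prefix m m' \<Longrightarrow> mat_stored m' A X"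
  by (auto simp: mat_stored_def intro: stored_prefix)

lemma mat_stored_transpose: "mat_stored m A X \<Longrightarrow> mat_stored m (transpose_mat A) (transpose_mat X)"
  by (auto simp: mat_stored_def)

lemma mat_stored_entries:
  assumes "mat_stored m A X"
  shows "list_all2 (stored m) (concat (mat_to_list A)) (entries X)"
  unfolding list_all2_conv_all_nth
proof (intro conjI allI impI)
  show "length (concat (mat_to_list A)) = length (entries X)"
    using assms by (simp add: entries_def length_concat_mat_to_list mat_stored_def)
  fix p assume "p < length (concat (mat_to_list A))"
  then have p: "p < dim_row X * dim_col X"
    using assms by (simp add: length_concat_mat_to_list mat_stored_def)
  then have d: "0 < dim_col X" by (cases "dim_col X") auto
  have i: "p div dim_col X < dim_row X" using p by (simp add: less_mult_imp_div_less)
  have j: "p mod dim_col X < dim_col X" using d by simp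
  show "stored m (concat (mat_to_list A) ! p) (entries X ! p)"
    using nth_concat_mat_to_list[of "p div dim_col X" A "p mod dim_col X"]
      nth_concat_mat_to_list[of "p div dim_col X" X "p mod dim_col X"] assms i j
    by (simp add: mat_stored_def entries_def)
qed

definition of_entries :: "nat \<Rightarrow> 'a list \<Rightarrow> 'a mat" where
  "of_entries d xs = mat d d (\<lambda>(i, j). xs ! (i * d + j))"

lemma length_entries: "(X :: real mat) \<in> carrier_mat d e \<Longrightarrow> length (entries X) = d * e"
  by (simp add: entries_def length_concat_mat_to_list)

lemma nth_entries: "(X :: real mat) \<in> carrier_mat d e \<Longrightarrow> i < d \<Longrightarrow> j < e \<Longrightarrow> entries X ! (i * e + j) = X $$ (i, j)"
  using nth_concat_mat_to_list[of i X j] by (simp add: entries_def)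

lemma mat_stored_of_entries:
  assumes "list_all2 (stored m) as (entries X)" "X \<in> carrier_mat d d"
  shows "mat_stored m (of_entries d as) X"
proof -
  have "stored m (as ! (i * d + j)) (X $$ (i, j))" if "i < d" "j < d" for i j
    using assms(1) nth_entries[OF assms(2) that] index_less_mult[OF that] length_entries[OF assms(2)]
    by (auto simp: list_all2_conv_all_nth)
  then show ?thesis using assms(2) by (auto simp: mat_stored_def of_entries_def)
qed

section \<open>Inverses and determinants\<close>

lemma inv_mat:
  assumes A: "A \<in> carrier_mat d d" and det: "det A \<noteq> 0"
  shows "inv_mat A \<in> carrier_mat d d" "A * inv_mat A = 1\<^sub>m d" "inv_mat A * A = 1\<^sub>m d"
proof -
  from mat_inverse(1)[OF A, of "()"] det_non_zero_imp_unit[OF A det, of "()"]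
  obtain B where "mat_inverse A = Some B"
    by (cases "mat_inverse A") auto
  with mat_inverse(2)[OF A this]
  show "inv_mat A \<in> carrier_mat d d" "A * inv_mat A = 1\<^sub>m d" "inv_mat A * A = 1\<^sub>m d"
    by (simp_all add: inv_mat_def)
qed

text \<open>Multiplicativity of the determinant turns a right inverse into a nonzero determinant;
  then \<open>inv_mat A\<close> is a left inverse of \<open>A\<close> and can be cancelled against
  it.\<close>

lemma inv_mat_unique:
  assumes A: "A \<in> carrier_mat d d" and B: "B \<in> carrier_mat d d" and AB: "A * B = 1\<^sub>m d"
  shows "inv_mat A = B" "det A \<noteq> 0"
proof -
  have "det A * det B = 1" using det_mult[OF A B] AB by simp
  then show det: "det A \<noteq> 0" by auto
  note i = inv_mat[OF A det]
  have "inv_mat A = inv_mat A * (A * B)" using i AB by simp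
  also have "\<dots> = inv_mat A * A * B" using i A B by (metis assoc_mult_mat)
  also have "\<dots> = B" using i B by simp
  finally show "inv_mat A = B" .
qed

lemma det_nonzero_invertible:
  assumes A: "A \<in> carrier_mat d d" and det: "det (A :: real mat) \<noteq> 0"
  shows "invertible_mat A"
  using inv_mat[OF A det] A unfolding invertible_mat_def inverts_mat_def by auto

lemma invertible_det_nonzero:
  assumes A: "A \<in> carrier_mat d d" and inv: "invertible_mat (A :: real mat)"
  shows "det A \<noteq> 0"
proof -
  from inv A obtain B where AB: "A * B = 1\<^sub>m d" and BA: "B * A = 1\<^sub>m (dim_row B)"
    unfolding invertible_mat_def inverts_mat_def by auto
  have "dim_col B = d" using arg_cong[OF AB, of dim_col] by simp
  moreover have "dim_row B = d" using arg_cong[OF BA, of dim_col] A by simp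
  ultimately have "B \<in> carrier_mat d d" by auto
  from inv_mat_unique(2)[OF A this AB] show ?thesis .
qed

section \<open>Existence of programs for multiplication and inversion\<close>

definition expressible :: "(real list \<Rightarrow> real) \<Rightarrow> real list set \<Rightarrow> bool" where
  "expressible f D \<longleftrightarrow> (\<exists>c t. \<forall>xs \<in> D. \<forall>m. prefix xs m \<longrightarrow> runs c m t (\<lambda>m' i. stored m' i (f xs)))"

lemma expressible_input: "\<forall>xs \<in> D. k < length xs \<Longrightarrow> expressible (\<lambda>xs. xs ! k) D"
  unfolding expressible_def
  by (rule exI[of _ "ret k"], rule exI[of _ 0])
     (auto intro!: runs_ret simp: stored_def prefix_def nth_append)

lemma expressible_of_rat: "expressible (\<lambda>xs. of_rat q) D"
  unfolding expressible_def by (rule exI[of _ "load q"], rule exI[of _ 0]) (auto intro: runs_load)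

lemma expressible_arith:
  assumes f: "expressible f D" and g: "expressible g D"
    and h: "\<And>xs. xs \<in> D \<Longrightarrow> arith_val op (f xs) (g xs) = Some (h xs)"
  shows "expressible h D"
proof -
  from f obtain c t where f: "\<And>xs m. xs \<in> D \<Longrightarrow> prefix xs m \<Longrightarrow> runs c m t (\<lambda>m' i. stored m' i (f xs))"
    unfolding expressible_def by blast
  from g obtain c' t' where g: "\<And>xs m. xs \<in> D \<Longrightarrow> prefix xs m \<Longrightarrow> runs c' m t' (\<lambda>m' i. stored m' i (g xs))"
    unfolding expressible_def by blast
  have "runs (bind c (\<lambda>i. bind c' (\<lambda>j. arith op i j))) m (t + (t' + 1)) (\<lambda>m' i. stored m' i (h xs))"
    if xs: "xs \<in> D" and m: "prefix xs m" for xs m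
  proof (rule runs_bind[OF f[OF xs m] _ order_refl])
    fix m1 i assume 1: "prefix m m1" "stored m1 i (f xs)"
    have "prefix xs m1" using m 1(1) by (rule prefix_order.trans)
    then show "runs (bind c' (\<lambda>j. arith op i j)) m1 (t' + 1) (\<lambda>m' i. stored m' i (h xs))"
      using 1(2) h[OF xs]
      by (intro runs_bind[OF g[OF xs] _ order_refl]) (auto intro: runs_arith stored_prefix)
  qed
  then show ?thesis unfolding expressible_def by blast
qed

lemma expressible_plus: "expressible f D \<Longrightarrow> expressible g D \<Longrightarrow> expressible (\<lambda>xs. f xs + g xs) D"
  by (rule expressible_arith[of f D g Plus]) auto

lemma expressible_times: "expressible f D \<Longrightarrow> expressible g D \<Longrightarrow> expressible (\<lambda>xs. f xs * g xs) D"
  by (rule expressible_arith[of f D g Times]) auto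

lemma expressible_divide:
  "expressible f D \<Longrightarrow> expressible g D \<Longrightarrow> (\<And>xs. xs \<in> D \<Longrightarrow> g xs \<noteq> 0) \<Longrightarrow> expressible (\<lambda>xs. f xs / g xs) D"
  by (rule expressible_arith[of f D g Divide]) auto

lemma expressible_sum:
  assumes "\<And>a. a \<in> S \<Longrightarrow> expressible (f a) D"
  shows "expressible (\<lambda>xs. \<Sum>a\<in>S. f a xs) D"
  using assms
  by (induction S rule: infinite_finite_induct)
     (use expressible_of_rat[of 0 D] in \<open>auto intro: expressible_plus\<close>)

lemma expressible_prod:
  assumes "\<And>a. a \<in> S \<Longrightarrow> expressible (f a) D"
  shows "expressible (\<lambda>xs. \<Prod>a\<in>S. f a xs) D"
  using assms
  by (induction S rule: infinite_finite_induct)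
     (use expressible_of_rat[of 1 D] in \<open>auto intro: expressible_times\<close>)

lemma expressible_cong:
  "expressible f D \<Longrightarrow> (\<And>xs. xs \<in> D \<Longrightarrow> f xs = g xs) \<Longrightarrow> expressible g D"
  unfolding expressible_def by metis

lemma expressible_det:
  assumes M: "\<And>xs. xs \<in> D \<Longrightarrow> M xs \<in> carrier_mat k k"
    and e: "\<And>i j. i < k \<Longrightarrow> j < k \<Longrightarrow> expressible (\<lambda>xs. M xs $$ (i, j)) D"
  shows "expressible (\<lambda>xs. det (M xs)) D"
proof (rule expressible_cong)
  \<comment> \<open>The Leibniz formula needs neither division nor branching; the signs are loaded
    as rational constants.\<close>
  show "expressible (\<lambda>xs. \<Sum>p | p permutes {0..<k}. of_rat (of_int (sign p)) * (\<Prod>i = 0..<k. M xs $$ (i, p i))) D"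
    by (intro expressible_sum expressible_times expressible_of_rat expressible_prod e)
       (auto simp: permutes_in_image)
  show "(\<Sum>p | p permutes {0..<k}. of_rat (of_int (sign p)) * (\<Prod>i = 0..<k. M xs $$ (i, p i))) = det (M xs)"
    if "xs \<in> D" for xs
    unfolding det_def'[OF M[OF that]] by (auto simp: sign_def intro!: sum.cong)
qed

lemma expressible_imp_program:
  assumes f: "\<And>i. i < k \<Longrightarrow> expressible (f i) D" and N: "\<And>xs. xs \<in> D \<Longrightarrow> length xs = N"
  shows "\<exists>t P. \<forall>xs \<in> D. computes_within t P xs (map (\<lambda>i. f i xs) [0..<k])"
proof -
  have "\<exists>c t. \<forall>i<k. \<forall>xs\<in>D. \<forall>m. prefix xs m \<longrightarrow> runs (c i) m (t i) (\<lambda>m' j. stored m' j (f i xs))"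
    using f unfolding expressible_def by metis
  then obtain c t where c: "\<And>i xs m. i < k \<Longrightarrow> xs \<in> D \<Longrightarrow> prefix xs m \<Longrightarrow>
      runs (c i) m (t i) (\<lambda>m' j. stored m' j (f i xs))" by metis
  \<comment> \<open>\<open>runs_tab\<close> takes one bound for all entries; the sum dominates each
    of the separate bounds.\<close>
  define T where "T = (\<Sum>i<k. t i)"
  have T: "t i \<le> T" if "i < k" for i unfolding T_def using that by (intro member_le_sum) auto
  have "runs (bind (tab c [0..<k]) (\<lambda>g. ret (map g [0..<k]))) xs (T * k)
     (\<lambda>m as. list_all2 (stored m) as (map (\<lambda>i. f i xs) [0..<k]))" if xs: "xs \<in> D" for xs
  proof (rule runs_bind)
    show "runs (tab c [0..<k]) xs (T * k) (\<lambda>m g. \<forall>i\<in>set [0..<k]. stored m (g i) (f i xs))"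
    proof (rule runs_tab[where t = T])
      fix m i assume m: "prefix xs m" and "i \<in> set [0..<k]"
      then have i: "i < k" by simp
      show "runs (c i) m T (\<lambda>m' j. stored m' j (f i xs))"
        by (rule runs_mono[OF c[OF i xs m] T[OF i]])
    qed (auto intro: stored_prefix)
    show "runs (ret (map g [0..<k])) m 0 (\<lambda>m as. list_all2 (stored m) as (map (\<lambda>i. f i xs) [0..<k]))"
      if "\<forall>i\<in>set [0..<k]. stored m (g i) (f i xs)" for m g
      using that by (intro runs_ret) (auto simp: list_all2_conv_all_nth)
  qed simp
  from runs_imp_computes_within[OF this] N
  have "\<forall>xs\<in>D. computes_within (T * k)
      (bind (tab c [0..<k]) (\<lambda>g. ret (map g [0..<k])) N (\<lambda>as l. Output as)) xs (map (\<lambda>i. f i xs) [0..<k])"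
    by simp
  then show ?thesis by blast
qed

lemma entries_eq_map:
  assumes "X \<in> carrier_mat d d"
  shows "entries X = map (\<lambda>p. X $$ (p div d, p mod d)) [0..<d * d]"
proof (rule nth_equalityI)
  show "length (entries X) = length (map (\<lambda>p. X $$ (p div d, p mod d)) [0..<d * d])"
    using assms by (simp add: length_entries)
  fix p assume "p < length (entries X)"
  then have p: "p < d * d" using assms by (simp add: length_entries)
  then have "0 < d" by (cases d) auto
  with p nth_entries[OF assms, of "p div d" "p mod d"]
  show "entries X ! p = map (\<lambda>p. X $$ (p div d, p mod d)) [0..<d * d] ! p"
    by (simp add: less_mult_imp_div_less)
qed

text \<open>\<open>LEAST\<close> in \<open>mult_complexity\<close> is uninformative on an empty set.
  This lemma and \<open>inv_program_exists\<close> rule that out; any finite bound that is uniform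
  in the input will do, so schoolbook multiplication is enough.\<close>

lemma mult_program_exists:
  "\<exists>t P. \<forall>A \<in> carrier_mat d d. \<forall>B \<in> carrier_mat d d.
     computes_within t P (entries A @ entries B) (entries (A * B))"
proof -
  define f where "f p xs = (\<Sum>k<d. xs ! (p div d * d + k) * xs ! (d * d + (k * d + p mod d)) :: real)" for p xs
  define D :: "real list set" where "D = {xs. length xs = d * d + d * d}"
  have "\<exists>t P. \<forall>xs \<in> D. computes_within t P xs (map (\<lambda>i. f i xs) [0..<d * d])"
  proof (rule expressible_imp_program)
    fix p assume p: "p < d * d"
    then have "0 < d" by (cases d) auto
    with p have "p div d < d" "p mod d < d" by (auto simp: less_mult_imp_div_less)
    then show "expressible (f p) D" unfolding f_def
      by (intro expressible_sum expressible_times expressible_input)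
         (auto simp: D_def index_less_mult intro: trans_less_add1)
  qed (simp add: D_def)
  then obtain t P where P: "\<And>xs. xs \<in> D \<Longrightarrow> computes_within t P xs (map (\<lambda>i. f i xs) [0..<d * d])" by blast
  have "computes_within t P (entries A @ entries B) (entries (A * B))"
    if A: "A \<in> carrier_mat d d" and B: "B \<in> carrier_mat d d" for A B
  proof -
    have "f p (entries A @ entries B) = (A * B) $$ (p div d, p mod d)" if p: "p < d * d" for p
    proof -
      from p have "0 < d" by (cases d) auto
      with p have pd: "p div d < d" "p mod d < d" by (auto simp: less_mult_imp_div_less)
      have "f p (entries A @ entries B) = (\<Sum>k<d. A $$ (p div d, k) * B $$ (k, p mod d))"
        unfolding f_def
      proof (intro sum.cong refl)
        fix k assume "k \<in> {..<d}"
        then have k: "k < d" by simp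
        show "(entries A @ entries B) ! (p div d * d + k) *
              (entries A @ entries B) ! (d * d + (k * d + p mod d)) = A $$ (p div d, k) * B $$ (k, p mod d)"
          using nth_entries[OF A pd(1) k] nth_entries[OF B k pd(2)] length_entries[OF A]
            index_less_mult[OF pd(1) k] by (simp add: nth_append)
      qed
      also have "\<dots> = (A * B) $$ (p div d, p mod d)"
        using A B pd by (auto simp: scalar_prod_def atLeast0LessThan intro!: sum.cong)
      finally show ?thesis .
    qed
    then have "map (\<lambda>i. f i (entries A @ entries B)) [0..<d * d] = entries (A * B)"
      using entries_eq_map[OF mult_carrier_mat[OF A B]] by simp
    with P[of "entries A @ entries B"] A B show ?thesis by (simp add: D_def length_entries)
  qed
  then show ?thesis by blast
qed

text \<open>Cramer's rule. The only division is by the determinant, so a program without pivot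
  search fails on no invertible input.\<close>

lemma inv_mat_eq_cofactor:
  assumes A: "A \<in> carrier_mat d d" and det: "det A \<noteq> 0" and ij: "i < d" "j < d"
  shows "inv_mat A $$ (i, j) = (-1) ^ (j + i) * det (mat_delete A j i) / det A"
proof -
  let ?B = "(1 / det A) \<cdot>\<^sub>m adj_mat A"
  have B: "?B \<in> carrier_mat d d" using adj_mat(1)[OF A] by simp
  have "A * ?B = (1 / det A) \<cdot>\<^sub>m (A * adj_mat A)"
    by (rule mult_smult_distrib[OF A adj_mat(1)[OF A]])
  also have "\<dots> = 1\<^sub>m d"
    unfolding adj_mat(2)[OF A] using det by (intro eq_matI) auto
  finally have "inv_mat A = ?B" by (rule inv_mat_unique(1)[OF A B])
  then show ?thesis using A ij by (simp add: adj_mat_def cofactor_def)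
qed

lemma inv_program_exists:
  "\<exists>t P. \<forall>A \<in> carrier_mat d d. invertible_mat A \<longrightarrow>
     computes_within t P (entries A) (entries (inv_mat A))"
proof -
  define D where "D = {entries A | A. A \<in> carrier_mat d d \<and> invertible_mat A}"
  \<comment> \<open>Entry \<open>p\<close> of the inverse stands in row \<open>p div d\<close> and
    column \<open>p mod d\<close>; its minor deletes the transposed position.\<close>
  define f where "f p xs = (of_rat ((-1) ^ (p mod d + p div d)) *
      det (mat_delete (of_entries d xs) (p mod d) (p div d)) / det (of_entries d xs) :: real)" for p xs
  have oe: "of_entries d (entries A) = A" if "A \<in> carrier_mat d d" for A
    by (rule eq_matI) (use that in \<open>auto simp: of_entries_def nth_entries\<close>)
  have c: "of_entries d xs \<in> carrier_mat d d" for xs :: "real list" by (simp add: of_entries_def)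
  have len: "length xs = d * d" if "xs \<in> D" for xs using that by (auto simp: D_def length_entries)
  have e: "expressible (\<lambda>xs. of_entries d xs $$ (i, j)) D" if "i < d" "j < d" for i j
    using that by (auto simp: of_entries_def len index_less_mult intro!: expressible_input)
  have "\<exists>t P. \<forall>xs \<in> D. computes_within t P xs (map (\<lambda>i. f i xs) [0..<d * d])"
  proof (rule expressible_imp_program)
    fix p assume p: "p < d * d"
    then have "0 < d" by (cases d) auto
    with p have pd: "p div d < d" "p mod d < d" by (auto simp: less_mult_imp_div_less)
    show "expressible (f p) D" unfolding f_def
    proof (intro expressible_divide expressible_times expressible_of_rat)
      show "expressible (\<lambda>xs. det (of_entries d xs)) D"
        by (rule expressible_det[where k = d]) (use e in \<open>auto simp: of_entries_def\<close>)
      show "expressible (\<lambda>xs. det (mat_delete (of_entries d xs) (p mod d) (p div d))) D"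
      proof (rule expressible_det[where k = "d - 1"])
        show "mat_delete (of_entries d xs) (p mod d) (p div d) \<in> carrier_mat (d - 1) (d - 1)" for xs :: "real list"
          using mat_delete_carrier[OF c] by simp
        fix i j assume ij: "i < d - 1" "j < d - 1"
        \<comment> \<open>Deleting a row or column shifts the indices from that place on by
          one.\<close>
        define i' j' where "i' = (if i < p mod d then i else Suc i)" and "j' = (if j < p div d then j else Suc j)"
        have "mat_delete (of_entries d xs) (p mod d) (p div d) $$ (i, j) = of_entries d xs $$ (i', j')"
          for xs :: "real list"
          using ij by (simp add: mat_delete_def of_entries_def i'_def j'_def)
        moreover have "i' < d" "j' < d" using ij by (auto simp: i'_def j'_def)
        ultimately show "expressible (\<lambda>xs. mat_delete (of_entries d xs) (p mod d) (p div d) $$ (i, j)) D"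
          using e[of i' j'] by simp
      qed
      show "det (of_entries d xs) \<noteq> 0" if "xs \<in> D" for xs
        using that invertible_det_nonzero by (auto simp: D_def oe)
    qed
  qed (rule len)
  then obtain t P where P: "\<And>xs. xs \<in> D \<Longrightarrow> computes_within t P xs (map (\<lambda>i. f i xs) [0..<d * d])" by blast
  have "computes_within t P (entries A) (entries (inv_mat A))"
    if A: "A \<in> carrier_mat d d" and inv: "invertible_mat A" for A
  proof -
    have det: "det A \<noteq> 0" using invertible_det_nonzero[OF A inv] .
    have "f p (entries A) = inv_mat A $$ (p div d, p mod d)" if p: "p < d * d" for p
    proof -
      from p have "0 < d" by (cases d) auto
      with p have pd: "p div d < d" "p mod d < d" by (auto simp: less_mult_imp_div_less)
      show ?thesis unfolding f_def oe[OF A] inv_mat_eq_cofactor[OF A det pd]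
        by (simp add: of_rat_power of_rat_minus)
    qed
    then have "map (\<lambda>i. f i (entries A)) [0..<d * d] = entries (inv_mat A)"
      using entries_eq_map[OF inv_mat(1)[OF A det]] by simp
    with P[of "entries A"] A inv show ?thesis by (auto simp: D_def)
  qed
  then show ?thesis by blast
qed

lemma mult_program:
  obtains P where "\<And>A B. A \<in> carrier_mat d d \<Longrightarrow> B \<in> carrier_mat d d \<Longrightarrow>
    computes_within (mult_complexity d) P (entries A @ entries B) (entries (A * B))"
proof -
  have "\<exists>P. \<forall>A \<in> carrier_mat d d. \<forall>B \<in> carrier_mat d d.
     computes_within (mult_complexity d) P (entries A @ entries B) (entries (A * B))"
    unfolding mult_complexity_def by (rule LeastI_ex) (rule mult_program_exists)
  with that show ?thesis by blast
qed

lemma inv_program: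
  obtains P where "\<And>A. A \<in> carrier_mat d d \<Longrightarrow> det A \<noteq> 0 \<Longrightarrow>
    computes_within (inv_complexity d) P (entries A) (entries (inv_mat A))"
proof -
  have "\<exists>P. \<forall>A \<in> carrier_mat d d. invertible_mat A \<longrightarrow>
     computes_within (inv_complexity d) P (entries A) (entries (inv_mat A))"
    unfolding inv_complexity_def by (rule LeastI_ex) (rule inv_program_exists)
  then obtain P where "\<forall>A \<in> carrier_mat d d. invertible_mat A \<longrightarrow>
     computes_within (inv_complexity d) P (entries A) (entries (inv_mat A))" ..
  then show ?thesis by (intro that[of P]) (simp add: det_nonzero_invertible)
qed

section \<open>Every input of a multiplication program is read\<close>

text \<open>An execution of cost \<open>s\<close> reads at most \<open>2 * s\<close> memory cells.\<close>

lemma exec_untouched: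
  assumes "exec P m = Some (ys, s)"
  shows "\<exists>T ks e. finite T \<and> card T \<le> 2 * s \<and> ys = map ((!) (m @ e)) ks \<and>
    (\<forall>k x. k < length m \<longrightarrow> k \<notin> T \<longrightarrow> k \<notin> set ks \<longrightarrow> exec P (m[k := x]) = Some (ys, s))"
  using assms
proof (induction P arbitrary: m s)
  \<comment> \<open>Selecting the output is free, so the selected cells are kept apart in
    \<open>ks\<close> and do not count towards \<open>T\<close>.\<close>
  case (Output ks)
  then show ?case
    by (intro exI[of _ "{}"] exI[of _ ks] exI[of _ "[]"]) (auto split: if_splits intro!: nth_list_update_neq)
next
  case (Load q P)
  then have "exec P (m @ [of_rat q]) = Some (ys, s)" by simp
  from Load.IH[OF this] obtain T ks e where *: "finite T" "card T \<le> 2 * s"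
    "ys = map ((!) ((m @ [of_rat q]) @ e)) ks"
    "\<And>k x. k < length (m @ [of_rat q]) \<Longrightarrow> k \<notin> T \<Longrightarrow> k \<notin> set ks \<Longrightarrow>
       exec P ((m @ [of_rat q])[k := x]) = Some (ys, s)" by blast
  show ?case
    by (rule exI[of _ T], rule exI[of _ ks], rule exI[of _ "of_rat q # e"])
       (use *(1-3) *(4)[unfolded length_append_singleton, OF less_SucI] in \<open>auto simp: list_update_append1\<close>)
next
  case (Arith f i j P)
  from Arith.prems obtain x s' where ij: "i < length m" "j < length m"
    and x: "arith_val f (m ! i) (m ! j) = Some x" and P: "exec P (m @ [x]) = Some (ys, s')"
    and s: "s = s' + 1"
    by (auto split: if_splits option.splits simp: tick_def)
  from Arith.IH[OF P] obtain T ks e where *: "finite T" "card T \<le> 2 * s'"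
    "ys = map ((!) ((m @ [x]) @ e)) ks"
    "\<And>k y. k < length (m @ [x]) \<Longrightarrow> k \<notin> T \<Longrightarrow> k \<notin> set ks \<Longrightarrow>
       exec P ((m @ [x])[k := y]) = Some (ys, s')" by blast
  \<comment> \<open>One operation reads at most two new cells, hence the factor 2.\<close>
  have "card (insert i (insert j T)) \<le> Suc (Suc (card T))"
    using *(1) by (simp add: card_insert_if)
  then have "card (insert i (insert j T)) \<le> 2 * s" using *(2) s by simp
  moreover have "exec (Arith f i j P) (m[k := y]) = Some (ys, s)"
    if "k < length m" "k \<notin> insert i (insert j T)" "k \<notin> set ks" for k y
    using *(4)[of k y] that ij x s by (auto simp: list_update_append1 less_SucI tick_def)
  ultimately show ?case using *(1,3)
    by (intro exI[of _ "insert i (insert j T)"] exI[of _ ks] exI[of _ "x # e"]) auto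
next
  case (If_le i j P P')
  let ?P = "if m ! i \<le> m ! j then P else P'"
  from If_le.prems obtain s' where ij: "i < length m" "j < length m"
    and P: "exec ?P m = Some (ys, s')" and s: "s = s' + 1"
    by (auto split: if_splits option.splits simp: tick_def)
  have "\<exists>T ks e. finite T \<and> card T \<le> 2 * s' \<and> ys = map ((!) (m @ e)) ks \<and>
    (\<forall>k x. k < length m \<longrightarrow> k \<notin> T \<longrightarrow> k \<notin> set ks \<longrightarrow> exec ?P (m[k := x]) = Some (ys, s'))"
    using If_le.IH P by (cases "m ! i \<le> m ! j") auto
  then obtain T ks e where *: "finite T" "card T \<le> 2 * s'" "ys = map ((!) (m @ e)) ks"
    "\<And>k y. k < length m \<Longrightarrow> k \<notin> T \<Longrightarrow> k \<notin> set ks \<Longrightarrow> exec ?P (m[k := y]) = Some (ys, s')" by blast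
  have "card (insert i (insert j T)) \<le> Suc (Suc (card T))"
    using *(1) by (simp add: card_insert_if)
  then have "card (insert i (insert j T)) \<le> 2 * s" using *(2) s by simp
  moreover have "exec (If_le i j P P') (m[k := y]) = Some (ys, s)"
    if "k < length m" "k \<notin> insert i (insert j T)" "k \<notin> set ks" for k y
    using *(4)[of k y] that ij s by (auto simp: tick_def split: if_splits)
  ultimately show ?case using *(1,3)
    by (intro exI[of _ "insert i (insert j T)"] exI[of _ ks] exI[of _ e]) auto
qed

lemma entries_update:
  assumes X: "X \<in> carrier_mat d d" and i: "i < d" and j: "j < d"
  shows "entries (mat d d (\<lambda>(r, s). if r = i \<and> s = j then x else X $$ (r, s))) = (entries X)[i * d + j := x]"
    (is "entries ?Y = _")
proof (rule nth_equalityI)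
  have Y: "?Y \<in> carrier_mat d d" by simp
  show "length (entries ?Y) = length ((entries X)[i * d + j := x])"
    using X Y by (simp add: length_entries)
  fix p assume "p < length (entries ?Y)"
  then have p: "p < d * d" using Y by (simp add: length_entries)
  have d: "0 < d" using i by simp
  have pd: "p div d < d" "p mod d < d" using p d by (auto simp: less_mult_imp_div_less)
  have "p = i * d + j \<longleftrightarrow> p div d = i \<and> p mod d = j"
  proof
    assume "p = i * d + j"
    then show "p div d = i \<and> p mod d = j" using j by simp
  next
    assume "p div d = i \<and> p mod d = j"
    then show "p = i * d + j" by (metis div_mult_mod_eq)
  qed
  then show "entries ?Y ! p = (entries X)[i * d + j := x] ! p"
    using nth_entries[OF Y pd] nth_entries[OF X pd] p pd length_entries[OF X]
    by (auto simp: nth_list_update)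
qed

text \<open>If all entries of two matrices are 2, then all entries of their product are at least 4, so no
  input is a valid output; and every input influences the output. Hence all \<open>2 * d * d\<close> inputs are
  read.\<close>

lemma square_le_mult_complexity: "d * d \<le> mult_complexity d"
proof -
  obtain P where P: "\<And>A B. A \<in> carrier_mat d d \<Longrightarrow> B \<in> carrier_mat d d \<Longrightarrow>
    computes_within (mult_complexity d) P (entries A @ entries B) (entries (A * B))"
    using mult_program by blast
  let ?A = "mat d d (\<lambda>_. 2 :: real)"
  have A: "?A \<in> carrier_mat d d" by simp
  let ?m = "entries ?A @ entries ?A"
  have lenA: "length (entries ?A) = d * d" using length_entries[OF A] .
  have AA: "(?A * ?A) $$ (i, j) = 4 * d" if "i < d" "j < d" for i j
    using that by (simp add: scalar_prod_def)
  from P[OF A A] obtain s where s: "s \<le> mult_complexity d" "exec P ?m = Some (entries (?A * ?A), s)"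
    unfolding computes_within_def by blast
  from exec_untouched[OF s(2)] obtain T ks e where *: "finite T" "card T \<le> 2 * s"
    "entries (?A * ?A) = map ((!) (?m @ e)) ks"
    "\<And>k x. k < length ?m \<Longrightarrow> k \<notin> T \<Longrightarrow> k \<notin> set ks \<Longrightarrow> exec P (?m[k := x]) = Some (entries (?A * ?A), s)"
    by blast
  have m: "?m ! k = 2" if "k < length ?m" for k
  proof -
    from that have d: "0 < d" by (cases d) (auto simp: lenA length_entries[of _ 0 0])
    have "entries ?A ! p = 2" if "p < d * d" for p
      unfolding entries_eq_map[OF A] using that d by (simp add: less_mult_imp_div_less)
    with that show ?thesis by (simp add: lenA nth_append)
  qed
  have "k \<in> T" if k: "k < length ?m" for k
  proof (rule ccontr)
    assume kT: "k \<notin> T"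
    have dpos: "0 < d" using k lenA by (cases d) auto
    have "k \<notin> set ks"
    proof
      assume "k \<in> set ks"
      then obtain q where q: "q < length ks" "ks ! q = k" by (auto simp: in_set_conv_nth)
      have qd: "q < d * d" using q(1) *(3) length_entries[of "?A * ?A" d d] by (metis length_map mult_carrier_mat A)
      have "entries (?A * ?A) ! q = (?m @ e) ! k" unfolding *(3) nth_map[OF q(1)] q(2) ..
      also have "\<dots> = ?m ! k" using k by (simp only: nth_append if_True)
      also have "\<dots> = 2" using m k by simp
      finally have "entries (?A * ?A) ! q = 2" .
      moreover have "entries (?A * ?A) ! q = 4 * d"
        unfolding entries_eq_map[OF mult_carrier_mat[OF A A]] using qd AA[of "q div d" "q mod d"] dpos
        by (simp add: less_mult_imp_div_less)
      ultimately have "real (2 * d) = 1" by simp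
      then show False using dpos by linarith
    qed
    \<comment> \<open>As \<open>k\<close> is neither read nor output, replacing its value 2 by 3
      leaves the run unchanged. The two cases below exhibit an entry of the product in which this
      raises exactly one summand from 4 to 6.\<close>
    then have e1: "exec P (?m[k := 3]) = Some (entries (?A * ?A), s)" using *(4) k kT by blast
    define X where "X i j = mat d d (\<lambda>(r, s). if r = i \<and> s = j then 3 else ?A $$ (r, s))" for i j
    have X: "X i j \<in> carrier_mat d d" for i j by (simp add: X_def)
    have upd: "entries (X i j) = (entries ?A)[i * d + j := 3]" if "i < d" "j < d" for i j
      unfolding X_def by (rule entries_update[OF A that])
    have "\<exists>B C. B \<in> carrier_mat d d \<and> C \<in> carrier_mat d d \<and> ?m[k := 3] = entries B @ entries C \<and>
      (\<exists>i<d. \<exists>j<d. (B * C) $$ (i, j) \<noteq> 4 * d)"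
    proof (cases "k < d * d")
      case True
      have kd: "k div d < d" "k mod d < d" using True dpos by (auto simp: less_mult_imp_div_less)
      have "(X (k div d) (k mod d) * ?A) $$ (k div d, 0) = (\<Sum>r<d. (if r = k mod d then 6 else 4))"
        using kd dpos by (auto simp: X_def scalar_prod_def atLeast0LessThan intro!: sum.cong)
      also have "\<dots> = (\<Sum>r<d. 4 + (if r = k mod d then 2 else 0))" by (intro sum.cong) auto
      also have "\<dots> \<noteq> real (4 * d)" unfolding sum.distrib using kd by simp
      finally have "(X (k div d) (k mod d) * ?A) $$ (k div d, 0) \<noteq> 4 * d" .
      moreover have "?m[k := 3] = entries (X (k div d) (k mod d)) @ entries ?A"
        using upd[OF kd] True by (simp add: list_update_append lenA)
      ultimately show ?thesis using X A kd dpos by blast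
    next
      case False
      define q where "q = k - d * d"
      have q: "q < d * d" using k False by (auto simp: q_def lenA)
      have kd: "q div d < d" "q mod d < d" using q dpos by (auto simp: less_mult_imp_div_less)
      have "(?A * X (q div d) (q mod d)) $$ (0, q mod d) = (\<Sum>r<d. (if r = q div d then 6 else 4))"
        using kd dpos by (auto simp: X_def scalar_prod_def atLeast0LessThan intro!: sum.cong)
      also have "\<dots> = (\<Sum>r<d. 4 + (if r = q div d then 2 else 0))" by (intro sum.cong) auto
      also have "\<dots> \<noteq> real (4 * d)" unfolding sum.distrib using kd by simp
      finally have "(?A * X (q div d) (q mod d)) $$ (0, q mod d) \<noteq> 4 * d" .
      moreover have "?m[k := 3] = entries ?A @ entries (X (q div d) (q mod d))"
        using upd[OF kd] False by (simp add: list_update_append lenA q_def)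
      ultimately show ?thesis using X A kd dpos by blast
    qed
    then obtain B C i j where BC: "B \<in> carrier_mat d d" "C \<in> carrier_mat d d"
      "?m[k := 3] = entries B @ entries C" "i < d" "j < d" "(B * C) $$ (i, j) \<noteq> 4 * d" by blast
    from P[OF BC(1,2)] e1 have "entries (B * C) = entries (?A * ?A)"
      by (auto simp: BC(3)[symmetric] computes_within_def)
    then have "(B * C) $$ (i, j) = (?A * ?A) $$ (i, j)"
      using nth_entries[OF mult_carrier_mat[OF BC(1,2)] BC(4,5)]
        nth_entries[OF mult_carrier_mat[OF A A] BC(4,5)] by simp
    with BC(4-6) AA show False by simp
  qed
  \<comment> \<open>There are \<open>2 * d * d\<close> input cells and \<open>T\<close> has at most
    \<open>2 * s\<close> elements, so the factors 2 cancel.\<close>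
  then have "card {..<length ?m} \<le> card T" using *(1) by (intro card_mono) auto
  then show ?thesis using *(2) s(1) by (simp add: lenA)
qed

section \<open>The block structure of the inverse\<close>

lemma assoc_mult_mat_dim:
  "dim_col A = dim_row B \<Longrightarrow> dim_col B = dim_row C \<Longrightarrow> A * B * C = A * (B * (C :: real mat))"
  by (rule assoc_mult_mat[of _ "dim_row A" "dim_col A" _ "dim_col B" _ "dim_col C"]) auto

lemma mult_minus_distrib_mat_dim:
  "dim_col A = dim_row B \<Longrightarrow> dim_row C = dim_row B \<Longrightarrow> dim_col C = dim_col B \<Longrightarrow>
   A * (B - C) = A * B - A * (C :: real mat)"
  by (rule mult_minus_distrib_mat[of _ "dim_row A" "dim_col A" _ "dim_col B"]) auto

lemma minus_mult_distrib_mat_dim: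
  "dim_row B = dim_row A \<Longrightarrow> dim_col B = dim_col A \<Longrightarrow> dim_col A = dim_row C \<Longrightarrow>
   (A - B) * C = A * C - B * (C :: real mat)"
  by (rule minus_mult_distrib_mat[of _ "dim_row A" "dim_col A" _ _ "dim_col C"]) auto

lemma mult_add_distrib_mat_dim:
  "dim_col A = dim_row B \<Longrightarrow> dim_row C = dim_row B \<Longrightarrow> dim_col C = dim_col B \<Longrightarrow>
   A * (B + C) = A * B + A * (C :: real mat)"
  by (rule mult_add_distrib_mat[of _ "dim_row A" "dim_col A" _ "dim_col B"]) auto

lemma add_mult_distrib_mat_dim:
  "dim_row B = dim_row A \<Longrightarrow> dim_col B = dim_col A \<Longrightarrow> dim_col A = dim_row C \<Longrightarrow>
   (A + B) * C = A * C + B * (C :: real mat)"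
  by (rule add_mult_distrib_mat[of _ "dim_row A" "dim_col A" _ _ "dim_col C"]) auto

lemma transpose_mult_dim:
  "dim_col A = dim_row B \<Longrightarrow> transpose_mat (A * B) = transpose_mat B * transpose_mat (A :: real mat)"
  by (rule transpose_mult[of _ "dim_row A" "dim_col A" _ "dim_col B"]) auto

lemma transpose_minus_dim:
  "dim_row B = dim_row A \<Longrightarrow> dim_col B = dim_col A \<Longrightarrow>
   transpose_mat (A - B) = transpose_mat A - transpose_mat (B :: real mat)"
  by (rule transpose_minus[of _ "dim_row A" "dim_col A"]) auto

text \<open>The normal form consists of right-nested products with sums multiplied out. The side
  conditions are equations between dimensions, which the simplifier can solve; the carrier versions
  would leave it dimensions to guess.\<close>

lemmas mat_simps = assoc_mult_mat_dim mult_minus_distrib_mat_dim minus_mult_distrib_mat_dim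
  mult_add_distrib_mat_dim transpose_mult_dim transpose_minus_dim

lemma minus_add_cancel_mat:
  "dim_row B = dim_row A \<Longrightarrow> dim_col B = dim_col A \<Longrightarrow> A - B + B = (A :: real mat)"
  by (rule eq_matI) auto

section \<open>Blocks and block columns\<close>

lemma block_index_less: "i \<in> {1..n} \<Longrightarrow> r < d \<Longrightarrow> (i - 1) * d + r < d * (n::nat)"
  using index_less_mult[of "i - 1" n r d] by (auto simp: mult.commute)

lemma block_index_eq_iff:
  assumes "i \<ge> 1" "j \<ge> 1" "r < d" "s < (d::nat)"
  shows "(i - 1) * d + r = (j - 1) * d + s \<longleftrightarrow> i = j \<and> r = s"
proof
  assume e: "(i - 1) * d + r = (j - 1) * d + s"
  from arg_cong[OF e, of "\<lambda>x. x div d"] arg_cong[OF e, of "\<lambda>x. x mod d"] assms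
  show "i = j \<and> r = s" by auto
qed auto

lemma index_block_ex:
  assumes "p < d * (n::nat)"
  obtains i r where "i \<in> {1..n}" "r < d" "p = (i - 1) * d + r"
proof
  have d: "d > 0" using assms by (cases d) auto
  show "p div d + 1 \<in> {1..n}" using assms by (auto simp: less_mult_imp_div_less mult.commute Suc_leI)
  show "p mod d < d" "p = (p div d + 1 - 1) * d + p mod d" using d by auto
qed

lemma block_positions_subset: "S \<subseteq> {1..n} \<Longrightarrow> block_positions d S \<subseteq> {..<d * n}"
  using block_index_less[of _ n _ d] by (auto simp: block_positions_def)

lemma block_column_carrier: "block_column d n i \<in> carrier_mat (d * n) d"
  by (simp add: block_column_def)

text \<open>Block \<open>n + 1\<close> would start below the last row. This lets the sink pass
  through the same formulas as a genuine block index.\<close>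

lemma block_column_Suc_n: "block_column d n (n + 1) = 0\<^sub>m (d * n) d"
  by (rule eq_matI) (auto simp: block_column_def mult.commute)

lemma transpose_block_column_mult:
  assumes A: "A \<in> carrier_mat (d * n) m" and i: "i \<in> {1..n}"
  shows "transpose_mat (block_column d n i) * A = mat d m (\<lambda>(r, c). A $$ ((i - 1) * d + r, c))"
proof (rule eq_matI)
  fix r c assume "r < dim_row (mat d m (\<lambda>(r, c). A $$ ((i - 1) * d + r, c)))"
    "c < dim_col (mat d m (\<lambda>(r, c). A $$ ((i - 1) * d + r, c)))"
  then have r: "r < d" and c: "c < m" by auto
  have "(transpose_mat (block_column d n i) * A) $$ (r, c)
      = (\<Sum>p<d * n. (if p = (i - 1) * d + r then 1 else 0) * A $$ (p, c))"
    using A r c by (auto simp: scalar_prod_def block_column_def atLeast0LessThan intro!: sum.cong)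
  also have "\<dots> = (\<Sum>p<d * n. if p = (i - 1) * d + r then A $$ (p, c) else 0)"
    by (intro sum.cong) auto
  also have "\<dots> = A $$ ((i - 1) * d + r, c)"
    using block_index_less[OF i r] by simp
  finally show "(transpose_mat (block_column d n i) * A) $$ (r, c) =
      mat d m (\<lambda>(r, c). A $$ ((i - 1) * d + r, c)) $$ (r, c)" using r c by simp
qed (use A in \<open>auto simp: block_column_def\<close>)

lemma mult_block_column:
  assumes A: "A \<in> carrier_mat m (d * n)" and i: "i \<in> {1..n}"
  shows "A * block_column d n i = mat m d (\<lambda>(r, c). A $$ (r, (i - 1) * d + c))"
proof -
  have "A * block_column d n i = transpose_mat (transpose_mat (block_column d n i) * transpose_mat A)"
    using A block_column_carrier[of d n i] by (simp add: mat_simps)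
  also have "transpose_mat (block_column d n i) * transpose_mat A
      = mat d m (\<lambda>(r, c). transpose_mat A $$ ((i - 1) * d + r, c))"
    using A i by (intro transpose_block_column_mult) auto
  also have "transpose_mat \<dots> = mat m d (\<lambda>(r, c). A $$ (r, (i - 1) * d + c))"
    using A block_index_less[OF i] by (auto intro!: eq_matI)
  finally show ?thesis .
qed

lemma block_eq:
  assumes A: "A \<in> carrier_mat (d * n) (d * n)" and ij: "i \<in> {1..n}" "j \<in> {1..n}"
  shows "block d A i j = transpose_mat (block_column d n i) * A * block_column d n j"
proof -
  have "transpose_mat (block_column d n i) * A * block_column d n j
    = mat d (d * n) (\<lambda>(r, c). A $$ ((i - 1) * d + r, c)) * block_column d n j"
    by (simp only: transpose_block_column_mult[OF A ij(1)])
  also have "\<dots> = block d A i j"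
    unfolding block_def using block_index_less[OF ij(2)]
    by (subst mult_block_column) (use ij in \<open>auto intro!: eq_matI\<close>)
  finally show ?thesis ..
qed

lemma transpose_block_column_mult_block_column:
  assumes "i \<in> {1..n}" "j \<in> {1..n}"
  shows "transpose_mat (block_column d n i) * block_column d n j = (if i = j then 1\<^sub>m d else 0\<^sub>m d d)"
  unfolding transpose_block_column_mult[OF block_column_carrier assms(1)]
  using assms block_index_eq_iff[of i j] block_index_less[OF assms(1)]
  by (intro eq_matI) (auto simp: block_column_def)

text \<open>If the congruent matrix kills \<open>v\<close>, the quadratic form of \<open>Q\<close>
  vanishes at \<open>F v\<close>, so \<open>F v = 0\<close> by definiteness, and the left inverse
  \<open>B\<close> gives \<open>v = 0\<close>. It is applied to the diagonal blocks of
  \<open>Q\<close> and to the Schur complements.\<close>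

lemma det_congruence_nonzero:
  assumes pd: "pos_def Q" and Q: "Q \<in> carrier_mat N N"
    and F: "F \<in> carrier_mat N d" and B: "B \<in> carrier_mat d N" and BF: "B * F = 1\<^sub>m d"
  shows "det (transpose_mat F * Q * F) \<noteq> 0"
proof
  let ?M = "transpose_mat F * Q * F"
  have M: "?M \<in> carrier_mat d d" using Q F by auto
  assume "det ?M = 0"
  then obtain v where v: "v \<in> carrier_vec d" "v \<noteq> 0\<^sub>v d" "?M *\<^sub>v v = 0\<^sub>v d"
    using det_0_iff_vec_prod_zero[OF M] by auto
  let ?w = "F *\<^sub>v v"
  have w: "?w \<in> carrier_vec N" using F v by auto
  have "?M *\<^sub>v v = transpose_mat F *\<^sub>v (Q *\<^sub>v ?w)"
    using F Q v(1) by (simp add: assoc_mult_mat_vec[of _ d N _ d] assoc_mult_mat_vec[of _ d N _ N]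
      assoc_mult_mat_vec[of "transpose_mat F * Q" d N F d v])
  then have "transpose_mat F *\<^sub>v (Q *\<^sub>v ?w) = 0\<^sub>v d" using v(3) by simp
  then have "v \<bullet> (transpose_mat F *\<^sub>v (Q *\<^sub>v ?w)) = 0" using v(1) by (simp only: scalar_prod_right_zero)
  moreover have "v \<bullet> (transpose_mat F *\<^sub>v (Q *\<^sub>v ?w)) = ?w \<bullet> (Q *\<^sub>v ?w)"
    using transpose_vec_mult_scalar[OF F v(1), of "Q *\<^sub>v ?w"] Q w F v
    by (metis comm_scalar_prod mult_mat_vec_carrier transpose_carrier_mat)
  ultimately have "?w = 0\<^sub>v N" using pd Q w unfolding pos_def_def by force
  then have "B *\<^sub>v ?w = 0\<^sub>v d" using B by auto
  moreover have "B *\<^sub>v ?w = v" using assoc_mult_mat_vec[OF B F v(1)] BF v(1) by simp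
  ultimately show False using v(2) by simp
qed

text \<open>As \<open>X\<close> vanishes outside the rows and columns of \<open>S\<close>, the part
  of \<open>Q * X\<close> in these positions is the product of the two submatrices. Nothing is
  claimed about \<open>Q * X\<close> elsewhere, where it need not agree with the identity.\<close>

lemma padded_inverse_eqI:
  assumes Q: "Q \<in> carrier_mat (d * n) (d * n)" and X: "X \<in> carrier_mat (d * n) (d * n)"
    and S: "S \<subseteq> {1..n}"
    and supp: "\<And>r s. r < d * n \<Longrightarrow> s < d * n \<Longrightarrow> r \<notin> block_positions d S \<or> s \<notin> block_positions d S \<Longrightarrow> X $$ (r, s) = 0"
    and inv: "\<And>r s. r \<in> block_positions d S \<Longrightarrow> s \<in> block_positions d S \<Longrightarrow>
       (Q * X) $$ (r, s) = (if r = s then 1 else 0)"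
  shows "padded_inverse d n Q S = X"
proof -
  let ?I = "block_positions d S"
  have sub: "?I \<subseteq> {..<d * n}" using block_positions_subset[OF S] .
  then have fin: "finite ?I" by (rule finite_subset) simp
  have eq: "{i. i < d * n \<and> i \<in> ?I} = ?I" using sub by auto
  define k where "k = card ?I"
  have QI: "submatrix Q ?I ?I \<in> carrier_mat k k" and XI: "submatrix X ?I ?I \<in> carrier_mat k k"
    by (intro carrier_matI; simp only: dim_submatrix carrier_matD[OF Q] carrier_matD[OF X] eq k_def)+
  have idx: "submatrix A ?I ?I $$ (r, s) = A $$ (pick ?I r, pick ?I s)"
    if "r < k" "s < k" "A \<in> carrier_mat (d * n) (d * n)" for A :: "real mat" and r s
    using that(1,2) by (intro submatrix_index; simp only: carrier_matD[OF that(3)] eq k_def)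
  have pick: "pick ?I r \<in> ?I" if "r < k" for r
    using pick_in_set_le[of r ?I] that by (simp add: k_def)
  have bij: "bij_betw (pick ?I) {..<k} ?I"
  proof -
    have inj: "inj_on (pick ?I) {..<k}"
      by (rule inj_onI) (metis card_pick_le k_def lessThan_iff)
    moreover have "pick ?I ` {..<k} = ?I"
      by (rule card_subset_eq[OF fin]) (use pick inj in \<open>auto simp: card_image k_def\<close>)
    ultimately show ?thesis by (auto simp: bij_betw_def)
  qed
  have "submatrix Q ?I ?I * submatrix X ?I ?I = 1\<^sub>m k"
  proof (rule eq_matI)
    fix r s assume "r < dim_row (1\<^sub>m k :: real mat)" "s < dim_col (1\<^sub>m k :: real mat)"
    then have rs: "r < k" "s < k" by auto
    have lt: "pick ?I r < d * n" "pick ?I s < d * n" using pick rs sub by auto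
    have "(submatrix Q ?I ?I * submatrix X ?I ?I) $$ (r, s)
        = (\<Sum>p<k. Q $$ (pick ?I r, pick ?I p) * X $$ (pick ?I p, pick ?I s))"
      using QI XI rs by (auto simp: scalar_prod_def atLeast0LessThan idx[OF _ _ Q] idx[OF _ _ X] intro!: sum.cong)
    also have "\<dots> = (\<Sum>p\<in>?I. Q $$ (pick ?I r, p) * X $$ (p, pick ?I s))"
      by (rule sum.reindex_bij_betw[OF bij])
    also have "\<dots> = (\<Sum>p<d * n. Q $$ (pick ?I r, p) * X $$ (p, pick ?I s))"
      by (rule sum.mono_neutral_left) (use sub supp lt in auto)
    also have "\<dots> = (Q * X) $$ (pick ?I r, pick ?I s)"
      using Q X lt by (auto simp: scalar_prod_def atLeast0LessThan intro!: sum.cong)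
    also have "\<dots> = (if r = s then 1 else 0)"
      using inv[OF pick[OF rs(1)] pick[OF rs(2)]] bij rs by (auto simp: bij_betw_def inj_on_def)
    finally show "(submatrix Q ?I ?I * submatrix X ?I ?I) $$ (r, s) = 1\<^sub>m k $$ (r, s)" using rs by simp
  qed (use QI XI in auto)
  from inv_mat_unique(1)[OF QI XI this] have "inv_mat (submatrix Q ?I ?I) = submatrix X ?I ?I" .
  then show ?thesis
    unfolding padded_inverse_def Let_def
    by (intro eq_matI) (use X supp sub submatrix_index_card[of _ X _ ?I ?I] in auto)
qed

definition next_vertex :: "nat \<Rightarrow> nat list \<Rightarrow> nat" where
  "next_vertex n q = (case q of [] \<Rightarrow> n + 1 | j # _ \<Rightarrow> j)"

text \<open>\<open>q\<close> lists the inner vertices of a path from \<open>i\<close> to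
  \<open>n + 1\<close>, both ends excluded. For \<open>i = 0\<close> these lists correspond to the
  subsets of \<open>{1..n}\<close>; other values of \<open>i\<close> serve the inductions and the
  dynamic program.\<close>

definition ascending :: "nat \<Rightarrow> nat \<Rightarrow> nat list \<Rightarrow> bool" where
  "ascending n i q \<longleftrightarrow> sorted_wrt (<) (i # q) \<and> (\<forall>j \<in> set q. j \<le> n)"

lemma ascending_Nil: "ascending n i []"
  by (simp add: ascending_def)

lemma ascending_Cons: "ascending n i (j # q) \<longleftrightarrow> i < j \<and> j \<le> n \<and> ascending n j q"
  by (auto simp: ascending_def)

section \<open>The block rows of Q times Lambda\<close>

locale pd_factorizable =
  fixes d n :: nat and U V :: "nat \<Rightarrow> real mat" and Q :: "real mat"
  assumes factorizable: "block_factorizable d n U V Q" and pd: "pos_def Q"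
begin

text \<open>Extending \<open>U\<^sub>j\<^sup>-\<^sup>1\<close> and \<open>V\<^sub>j\<close> by zero to \<open>j = n + 1\<close> makes the formula for
  \<open>j \<le> n\<close> in the definition of \<^const>\<open>Lambda\<close> valid for \<open>j = n + 1\<close>.\<close>

abbreviation E :: "nat \<Rightarrow> real mat" where
  "E \<equiv> block_column d n"

definition Uinv :: "nat \<Rightarrow> real mat" where
  "Uinv j = (if j = n + 1 then 0\<^sub>m d d else inv_mat (U j))"

definition V0 :: "nat \<Rightarrow> real mat" where
  "V0 j = (if j = n + 1 then 0\<^sub>m d d else V j)"

text \<open>The elimination multiplier: for \<open>i < j \<le> n\<close>, block row \<open>i\<close>
  of \<open>Q\<close> is \<open>G i j\<close> times block row \<open>j\<close> in all block columns
  from \<open>j\<close> on.\<close>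

definition G :: "nat \<Rightarrow> nat \<Rightarrow> real mat" where
  "G i j = U i * Uinv j"

text \<open>The Schur complement. For \<open>i < j\<close> it equals F^T Q F with \<open>F\<close>
  as below, which is how \<open>det_M_nonzero\<close> obtains its invertibility.\<close>

definition M :: "nat \<Rightarrow> nat \<Rightarrow> real mat" where
  "M i j = U i * transpose_mat (V i) - G i j * V0 j * transpose_mat (U i)"

definition F :: "nat \<Rightarrow> nat \<Rightarrow> real mat" where
  "F i j = E i - E j * transpose_mat (G i j)"

lemma Q: "Q \<in> carrier_mat (d * n) (d * n)" and Q_sym: "transpose_mat Q = Q"
  using factorizable by (auto simp: block_factorizable_def)

lemma UV: "i \<in> {1..n} \<Longrightarrow> U i \<in> carrier_mat d d" "i \<in> {1..n} \<Longrightarrow> V i \<in> carrier_mat d d"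
  using factorizable by (auto simp: block_factorizable_def)

lemma dims [simp]:
  "dim_row Q = d * n" "dim_col Q = d * n"
  "dim_row (E i) = d * n" "dim_col (E i) = d"
  "i \<in> {1..n} \<Longrightarrow> dim_row (U i) = d" "i \<in> {1..n} \<Longrightarrow> dim_col (U i) = d"
  "i \<in> {1..n} \<Longrightarrow> dim_row (V i) = d" "i \<in> {1..n} \<Longrightarrow> dim_col (V i) = d"
  using Q UV block_column_carrier[of d n i] by auto

lemma upper_block:
  assumes "i \<in> {1..n}" "j \<in> {1..n}" "i \<le> j"
  shows "transpose_mat (E i) * (Q * E j) = U i * transpose_mat (V j)"
  using factorizable assms block_eq[OF Q, of i j] by (simp add: block_factorizable_def mat_simps)

lemma lower_block:
  assumes "i \<in> {1..n}" "j \<in> {1..n}" "j \<le> i"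
  shows "transpose_mat (E i) * (Q * E j) = V i * transpose_mat (U j)"
  using arg_cong[OF upper_block[OF assms(2,1,3)], of transpose_mat] assms
  by (simp add: mat_simps Q_sym)

text \<open>The diagonal block U_i V_i^T is E_i^T Q E_i, and E_i has the left inverse E_i^T.\<close>

lemma det_U_nonzero:
  assumes i: "i \<in> {1..n}"
  shows "det (U i) \<noteq> 0"
proof -
  have "det (transpose_mat (E i) * Q * E i) \<noteq> 0"
    using transpose_block_column_mult_block_column[OF i i, of d]
    by (intro det_congruence_nonzero[OF pd Q, of _ d "transpose_mat (E i)"]) (auto intro: carrier_matI)
  then have "det (U i * transpose_mat (V i)) \<noteq> 0"
    using upper_block[OF i i] by (simp add: mat_simps)
  then show ?thesis using UV[OF i] by (simp add: det_mult[of _ d])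
qed

lemma Uinv_carrier: "j \<in> {1..n + 1} \<Longrightarrow> Uinv j \<in> carrier_mat d d"
  using inv_mat(1)[OF UV(1) det_U_nonzero] by (auto simp: Uinv_def)

lemma U_Uinv: "i \<in> {1..n} \<Longrightarrow> U i * Uinv i = 1\<^sub>m d" "i \<in> {1..n} \<Longrightarrow> Uinv i * U i = 1\<^sub>m d"
  using inv_mat(2,3)[OF UV(1) det_U_nonzero] by (auto simp: Uinv_def)

lemma dims' [simp]:
  "j \<in> {1..n + 1} \<Longrightarrow> dim_row (Uinv j) = d" "j \<in> {1..n + 1} \<Longrightarrow> dim_col (Uinv j) = d"
  "j \<in> {1..n + 1} \<Longrightarrow> dim_row (V0 j) = d" "j \<in> {1..n + 1} \<Longrightarrow> dim_col (V0 j) = d"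
  "i \<in> {1..n} \<Longrightarrow> dim_row (G i j) = d" "j \<in> {1..n + 1} \<Longrightarrow> dim_col (G i j) = d"
  "i \<in> {1..n} \<Longrightarrow> dim_row (M i j) = d" "i \<in> {1..n} \<Longrightarrow> dim_col (M i j) = d"
  "dim_row (F i j) = d * n" "i \<in> {1..n} \<Longrightarrow> dim_col (F i j) = d"
  using Uinv_carrier[of j] by (auto simp: V0_def G_def M_def F_def)

text \<open>Cancellation inside right-nested products, the shape that \<open>mat_simps\<close>
  produces.\<close>

lemma U_Uinv_mult:
  assumes "i \<in> {1..n}" "dim_row A = d"
  shows "U i * (Uinv i * A) = A" "Uinv i * (U i * A) = A"
  using assms U_Uinv[OF assms(1)] left_mult_one_mat[of A d "dim_col A"]
  by (auto simp: assoc_mult_mat_dim[symmetric])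

lemma Uinv_U_transpose_mult:
  assumes "i \<in> {1..n}" "dim_row A = d"
  shows "transpose_mat (U i) * (transpose_mat (Uinv i) * A) = A"
    "transpose_mat (Uinv i) * (transpose_mat (U i) * A) = A"
proof -
  have i: "i \<in> {1..n + 1}" using assms by auto
  have "transpose_mat (U i) * transpose_mat (Uinv i) = transpose_mat (Uinv i * U i)"
    "transpose_mat (Uinv i) * transpose_mat (U i) = transpose_mat (U i * Uinv i)"
    using assms i by (simp_all add: transpose_mult_dim)
  then have "transpose_mat (U i) * transpose_mat (Uinv i) = 1\<^sub>m d"
    "transpose_mat (Uinv i) * transpose_mat (U i) = 1\<^sub>m d"
    using U_Uinv[OF assms(1)] by simp_all
  then show "transpose_mat (U i) * (transpose_mat (Uinv i) * A) = A"
    "transpose_mat (Uinv i) * (transpose_mat (U i) * A) = A"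
    using assms i left_mult_one_mat[of A d "dim_col A"]
    by (auto simp: assoc_mult_mat_dim[symmetric])
qed

text \<open>Restates the symmetry of the diagonal block \<open>U\<^sub>j V\<^sub>j\<^sup>T\<close>.\<close>

lemma Uinv_V0:
  assumes j: "j \<in> {1..n + 1}"
  shows "Uinv j * V0 j = transpose_mat (V0 j) * transpose_mat (Uinv j)"
proof (cases "j = n + 1")
  case True
  have "transpose_mat (0\<^sub>m d d) = (0\<^sub>m d d :: real mat)" by (rule eq_matI) auto
  with True show ?thesis by (simp add: Uinv_def V0_def)
next
  case False
  then have j: "j \<in> {1..n}" using j by auto
  have "Uinv j * (V j * (transpose_mat (U j) * transpose_mat (Uinv j)))
      = Uinv j * (U j * (transpose_mat (V j) * transpose_mat (Uinv j)))"
    using upper_block[OF j j] lower_block[OF j j] j by (simp add: assoc_mult_mat_dim[symmetric])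
  moreover have "transpose_mat (U j) * transpose_mat (Uinv j) = 1\<^sub>m d"
    using U_Uinv(2)[OF j] transpose_mult_dim[of "Uinv j" "U j"] j by simp
  ultimately show ?thesis using False j by (simp add: U_Uinv_mult V0_def)
qed

lemma upper_block_extended:
  assumes "i \<in> {1..n}" "j \<in> {1..n + 1}" "i \<le> j"
  shows "transpose_mat (E i) * (Q * E j) = U i * transpose_mat (V0 j)"
proof (cases "j = n + 1")
  case True
  show ?thesis unfolding True block_column_Suc_n V0_def using assms
    right_mult_zero_mat[of "transpose_mat (E i) * Q" d "d * n" d] right_mult_zero_mat[OF Q, of d]
    by (auto simp: mat_simps)
next
  case False
  then show ?thesis using assms upper_block[of i j] by (auto simp: V0_def)
qed

text \<open>For \<open>k \<le> i < j\<close> the blocks of \<open>Q\<close> involved lie on or above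
  the diagonal, where row \<open>k\<close> has the left factor \<open>U k\<close>. The other factor
  does not depend on \<open>k\<close>, which is what makes the sums telescope.\<close>

lemma block_row_F_upper:
  assumes k: "k \<in> {1..n}" and i: "i \<in> {1..n}" and j: "j \<in> {1..n + 1}" and "k \<le> i" "i < j"
  shows "transpose_mat (E k) * (Q * F i j) = U k * (Uinv i * M i j)"
proof -
  have i': "i \<in> {1..n + 1}" using i by auto
  have "transpose_mat (E k) * (Q * F i j) =
      U k * transpose_mat (V i) - U k * (transpose_mat (V0 j) * (transpose_mat (Uinv j) * transpose_mat (U i)))"
  proof -
    have "transpose_mat (E k) * (Q * F i j) = transpose_mat (E k) * (Q * E i) -
        transpose_mat (E k) * (Q * E j) * transpose_mat (G i j)"
      using k i j by (simp add: F_def mat_simps)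
    then show ?thesis
      using upper_block[OF k i] upper_block_extended[OF k j] assms by (simp add: G_def mat_simps)
  qed
  \<comment> \<open>Symmetry of the diagonal block \<open>j\<close> produces the form that occurs in
    \<open>M\<close>.\<close>
  also have "transpose_mat (V0 j) * (transpose_mat (Uinv j) * transpose_mat (U i))
      = Uinv j * (V0 j * transpose_mat (U i))"
    using Uinv_V0[OF j] i j by (simp add: assoc_mult_mat_dim[symmetric])
  also have "U k * transpose_mat (V i) - U k * (Uinv j * (V0 j * transpose_mat (U i)))
      = U k * (Uinv i * M i j)"
    using i i' j k by (simp add: M_def G_def mat_simps U_Uinv_mult)
  finally show ?thesis .
qed

text \<open>For \<open>k \<ge> j > i\<close> the blocks lie on or below the diagonal and have the
  left factor \<open>V k\<close>; the coefficient of E_j in \<open>F\<close> is the one that makes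
  the two terms cancel.\<close>

lemma block_row_F_lower:
  assumes k: "k \<in> {1..n}" and i: "i \<in> {1..n}" and j: "j \<in> {1..n}" and "j \<le> k" "i < j"
  shows "transpose_mat (E k) * (Q * F i j) = 0\<^sub>m d d"
proof -
  have j': "j \<in> {1..n + 1}" using j by auto
  have "transpose_mat (E k) * (Q * F i j) = transpose_mat (E k) * (Q * E i) -
      transpose_mat (E k) * (Q * E j) * transpose_mat (G i j)"
    using k i j' by (simp add: F_def mat_simps)
  also have "\<dots> = V k * transpose_mat (U i) - V k * transpose_mat (U i)"
    using lower_block[OF k i] lower_block[OF k j] assms j' by (simp add: G_def mat_simps Uinv_U_transpose_mult)
  also have "\<dots> = 0\<^sub>m d d" using k i by (intro eq_matI) auto
  finally show ?thesis .
qed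

lemma block_row_of_F:
  assumes b: "b \<in> {1..n}" and i: "i \<in> {1..n}" and j: "j \<in> {1..n + 1}" and "i < j"
  shows "transpose_mat (E b) * F i j =
    (if b = i then 1\<^sub>m d else if b = j then 0\<^sub>m d d - transpose_mat (G i j) else 0\<^sub>m d d)"
proof -
  have "transpose_mat (E b) * F i j = transpose_mat (E b) * E i - transpose_mat (E b) * E j * transpose_mat (G i j)"
    using i j by (simp add: F_def mat_simps)
  moreover have "transpose_mat (E b) * E j = (if b = j then 1\<^sub>m d else 0\<^sub>m d d)"
  proof (cases "j = n + 1")
    case True
    show ?thesis unfolding True block_column_Suc_n
      using b right_mult_zero_mat[of "transpose_mat (E b)" d "d * n" d] by auto
  next
    case False
    then show ?thesis using transpose_block_column_mult_block_column[OF b, of j] j by auto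
  qed
  moreover have "0\<^sub>m d d - 0\<^sub>m d d = (0\<^sub>m d d :: real mat)" "1\<^sub>m d - 0\<^sub>m d d = (1\<^sub>m d :: real mat)"
    by (auto intro!: eq_matI)
  moreover have "0\<^sub>m d d * transpose_mat (G i j) = 0\<^sub>m d d" "1\<^sub>m d * transpose_mat (G i j) = transpose_mat (G i j)"
    using i j by (auto intro!: left_mult_zero_mat left_mult_one_mat carrier_matI)
  ultimately show ?thesis
    using transpose_block_column_mult_block_column[OF b i, of d] assms by simp
qed

text \<open>F^T Q F = M, because block row \<open>j\<close> of Q F vanishes and only row
  \<open>i\<close> contributes. Block \<open>i\<close> of \<open>F\<close> is the identity, so E_i^T
  is a left inverse of \<open>F\<close>.\<close>

lemma det_M_nonzero:
  assumes i: "i \<in> {1..n}" and j: "j \<in> {1..n + 1}" and ij: "i < j"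
  shows "det (M i j) \<noteq> 0"
proof -
  have i': "i \<in> {1..n + 1}" using i by auto
  have "transpose_mat (E j) * (Q * F i j) = 0\<^sub>m d d"
  proof (cases "j = n + 1")
    case True
    have "transpose_mat (0\<^sub>m (d * n) d) = (0\<^sub>m d (d * n) :: real mat)" by auto
    moreover have "0\<^sub>m d (d * n) * (Q * F i j) = 0\<^sub>m d d"
      using i by (intro left_mult_zero_mat carrier_matI) auto
    ultimately show ?thesis unfolding True block_column_Suc_n by simp
  next
    case False
    then show ?thesis using block_row_F_lower[OF _ i, of j j] j ij by auto
  qed
  moreover have "transpose_mat (F i j) * (Q * F i j)
      = transpose_mat (E i) * (Q * F i j) - G i j * (transpose_mat (E j) * (Q * F i j))"
    unfolding F_def[of i j, THEN arg_cong, of transpose_mat] using i j by (simp add: mat_simps)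
  moreover have "transpose_mat (E i) * (Q * F i j) = M i j"
    using block_row_F_upper[OF i i j order_refl ij] i by (simp add: U_Uinv_mult)
  moreover have "G i j * 0\<^sub>m d d = 0\<^sub>m d d" using i j by (intro right_mult_zero_mat carrier_matI) auto
  moreover have "M i j - 0\<^sub>m d d = M i j" using i by (intro eq_matI) auto
  ultimately have "transpose_mat (F i j) * Q * F i j = M i j" using i by (simp add: mat_simps)
  moreover have "transpose_mat (E i) * F i j = 1\<^sub>m d" using block_row_of_F[OF i i j ij] by simp
  then have "det (transpose_mat (F i j) * Q * F i j) \<noteq> 0" using i
    by (intro det_congruence_nonzero[OF pd Q, of _ d "transpose_mat (E i)"]) (auto intro!: carrier_matI)
  ultimately show ?thesis by simp
qed

lemma inv_M:
  assumes i: "i \<in> {1..n}" and j: "j \<in> {1..n + 1}" and ij: "i < j"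
  shows "inv_mat (M i j) \<in> carrier_mat d d" "M i j * inv_mat (M i j) = 1\<^sub>m d"
proof -
  have "M i j \<in> carrier_mat d d" using i by (intro carrier_matI) auto
  from inv_mat[OF this det_M_nonzero[OF assms]]
  show "inv_mat (M i j) \<in> carrier_mat d d" "M i j * inv_mat (M i j) = 1\<^sub>m d" by auto
qed

text \<open>At \<open>j = n + 1\<close> the zero extensions make \<open>G\<close> vanish, which
  leaves F = E_i and M = U_i V_i^T; so both cases of \<open>Lambda\<close> obey one formula.\<close>

lemma Lambda_eq:
  assumes i: "i \<in> {1..n}" and j: "j \<in> {1..n + 1}" and ij: "i < j"
  shows "Lambda d n U V i j = F i j * inv_mat (M i j) * transpose_mat (F i j)"
proof (cases "j = n + 1")
  case True
  have G: "G i j = 0\<^sub>m d d" unfolding G_def Uinv_def True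
    using i by (auto intro!: right_mult_zero_mat carrier_matI)
  have "F i j = E i - 0\<^sub>m (d * n) d"
    unfolding F_def G unfolding True block_column_Suc_n
    by (simp add: left_mult_zero_mat[of _ d d])
  also have "\<dots> = E i" by (intro eq_matI) auto
  finally have F: "F i j = E i" .
  have "V0 j \<in> carrier_mat d d" "transpose_mat (U i) \<in> carrier_mat d d"
    using i j by (auto intro!: carrier_matI)
  then have "M i j = U i * transpose_mat (V i) - 0\<^sub>m d d"
    unfolding M_def G by (simp only: left_mult_zero_mat)
  also have "\<dots> = U i * transpose_mat (V i)" using i by (intro eq_matI) auto
  finally show ?thesis using True F by (simp add: Lambda_def)
next
  case False
  then have "j \<in> {1..n}" using j by auto
  then have "F i j = E i - E j * (transpose_mat (Uinv j) * transpose_mat (U i))"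
    "M i j = U i * transpose_mat (V i) - U i * Uinv j * V j * transpose_mat (U i)"
    using i False by (auto simp: F_def G_def M_def V0_def transpose_mult_dim)
  moreover have "Uinv j = inv_mat (U j)" using False by (simp add: Uinv_def)
  ultimately show ?thesis using False by (simp add: Lambda_def Let_def)
qed

text \<open>The arc leaving 0 carries no \<open>Lambda\<close>, so each listed vertex contributes
  just its outgoing arc.\<close>

fun Lambda_sum :: "nat list \<Rightarrow> real mat" where
  "Lambda_sum [] = 0\<^sub>m (d * n) (d * n)"
| "Lambda_sum (i # q) = Lambda d n U V i (next_vertex n q) + Lambda_sum q"

lemma Lambda_carrier: "Lambda d n U V i j \<in> carrier_mat (d * n) (d * n)"
  by (intro carrier_matI) (auto simp: Lambda_def Let_def)

lemma Lambda_dims [simp]: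
  "dim_row (Lambda d n U V i j) = d * n" "dim_col (Lambda d n U V i j) = d * n"
  using Lambda_carrier[of i j] by auto

lemma Lambda_sum_dims [simp]: "dim_row (Lambda_sum q) = d * n" "dim_col (Lambda_sum q) = d * n"
  by (induction q) auto

lemma ascending_next_vertex_mem:
  "ascending n i q \<Longrightarrow> i \<in> {1..n} \<Longrightarrow> next_vertex n q \<in> {1..n + 1} \<and> i < next_vertex n q"
  by (cases q) (auto simp: ascending_def next_vertex_def)

text \<open>\<open>M\<close> cancels against its inverse, and U_i^-1 \<open>G i j\<close> = U_j^-1
  leaves the difference of one expression taken at \<open>i\<close> and at \<open>j\<close>.\<close>

lemma block_row_Lambda_upper:
  assumes k: "k \<in> {1..n}" and i: "i \<in> {1..n}" and j: "j \<in> {1..n + 1}" and ki: "k \<le> i" and ij: "i < j"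
  shows "transpose_mat (E k) * (Q * Lambda d n U V i j) =
    U k * (Uinv i * transpose_mat (E i)) - U k * (Uinv j * transpose_mat (E j))"
proof -
  have i': "i \<in> {1..n + 1}" using i by auto
  note I = inv_M[OF i j ij]
  have [simp]: "dim_row (inv_mat (M i j)) = d" "dim_col (inv_mat (M i j)) = d" using I(1) by auto
  have "transpose_mat (E k) * (Q * Lambda d n U V i j)
      = transpose_mat (E k) * (Q * F i j) * (inv_mat (M i j) * transpose_mat (F i j))"
    unfolding Lambda_eq[OF i j ij] using i by (simp add: mat_simps)
  also have "\<dots> = U k * (Uinv i * (M i j * inv_mat (M i j) * transpose_mat (F i j)))"
    unfolding block_row_F_upper[OF k i j ki ij] using i i' k by (simp add: mat_simps)
  also have "\<dots> = U k * (Uinv i * transpose_mat (F i j))"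
    using I(2) i left_mult_one_mat[of "transpose_mat (F i j)" d "d * n"] by (simp add: carrier_matI)
  also have "\<dots> = U k * (Uinv i * transpose_mat (E i)) - U k * (Uinv j * transpose_mat (E j))"
    unfolding F_def G_def using i i' j k by (simp add: mat_simps U_Uinv_mult)
  finally show ?thesis .
qed

lemma block_row_Lambda_lower:
  assumes k: "k \<in> {1..n}" and i: "i \<in> {1..n}" and j: "j \<in> {1..n}" and jk: "j \<le> k" and ij: "i < j"
  shows "transpose_mat (E k) * (Q * Lambda d n U V i j) = 0\<^sub>m d (d * n)"
proof -
  have j': "j \<in> {1..n + 1}" using j by auto
  note I = inv_M[OF i j' ij]
  have [simp]: "dim_row (inv_mat (M i j)) = d" "dim_col (inv_mat (M i j)) = d" using I(1) by auto
  have "transpose_mat (E k) * (Q * Lambda d n U V i j)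
      = transpose_mat (E k) * (Q * F i j) * (inv_mat (M i j) * transpose_mat (F i j))"
    unfolding Lambda_eq[OF i j' ij] using i by (simp add: mat_simps)
  also have "\<dots> = 0\<^sub>m d (d * n)"
    unfolding block_row_F_lower[OF k i j jk ij] using i
    by (intro left_mult_zero_mat carrier_matI) auto
  finally show ?thesis .
qed

text \<open>The differences telescope along the path. The term of the sink is zero, so only that of
  the first vertex remains.\<close>

lemma block_row_Lambda_sum_first:
  assumes "ascending n i q" "k \<in> {1..n}" "\<forall>j \<in> set q. k \<le> j"
  shows "transpose_mat (E k) * (Q * Lambda_sum q) =
    U k * (Uinv (next_vertex n q) * transpose_mat (E (next_vertex n q)))"
  using assms
proof (induction q arbitrary: i)
  case Nil
  have "transpose_mat (E k) * (Q * 0\<^sub>m (d * n) (d * n)) = 0\<^sub>m d (d * n)"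
    using right_mult_zero_mat[OF Q] right_mult_zero_mat[of "transpose_mat (E k)" d "d * n" "d * n"]
    by (simp add: carrier_matI)
  moreover have "0\<^sub>m d d * transpose_mat (E (n + 1)) = (0\<^sub>m d (d * n) :: real mat)"
    by (intro left_mult_zero_mat carrier_matI) auto
  moreover have "U k * 0\<^sub>m d (d * n) = 0\<^sub>m d (d * n)"
    using Nil.prems(2) UV(1) by (intro right_mult_zero_mat) auto
  ultimately show ?case by (simp add: next_vertex_def Uinv_def)
next
  case (Cons j q)
  define j' where "j' = next_vertex n q"
  have q: "ascending n j q" and j: "j \<in> {1..n}" and kj: "k \<le> j"
    using Cons.prems by (auto simp: ascending_Cons)
  then have kq: "\<forall>i \<in> set q. k \<le> i" by (auto simp: ascending_def)
  have j': "j' \<in> {1..n + 1}" "j < j'" using ascending_next_vertex_mem[OF q j] by (auto simp: j'_def)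
  have j1: "j \<in> {1..n + 1}" using j by auto
  have "transpose_mat (E k) * (Q * Lambda_sum (j # q)) =
     transpose_mat (E k) * (Q * Lambda d n U V j j') + transpose_mat (E k) * (Q * Lambda_sum q)"
    using Lambda_carrier by (simp add: j'_def[symmetric] mat_simps)
  also have "\<dots> = U k * (Uinv j * transpose_mat (E j))"
    unfolding block_row_Lambda_upper[OF Cons.prems(2) j j'(1) kj j'(2)]
      Cons.IH[OF q Cons.prems(2) kq] j'_def[symmetric]
    using Cons.prems(2) j' j1 by (intro minus_add_cancel_mat) auto
  finally show ?case by (simp add: next_vertex_def)
qed

text \<open>Arcs that end at or before \<open>k\<close> contribute nothing to row \<open>k\<close>.
  The arcs from \<open>k\<close> on telescope to U_k U_k^-1 E_k^T, the block row of the
  identity.\<close>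

lemma block_row_Lambda_sum:
  assumes "ascending n i q" "k \<in> set q"
  shows "transpose_mat (E k) * (Q * Lambda_sum q) = transpose_mat (E k)"
  using assms
proof (induction q arbitrary: i)
  case (Cons j q)
  have q: "ascending n j q" and j: "j \<in> {1..n}"
    using Cons.prems by (auto simp: ascending_Cons)
  show ?case
  proof (cases "k = j")
    case True
    have "\<forall>i \<in> set (j # q). j \<le> i" using q by (auto simp: ascending_def)
    from block_row_Lambda_sum_first[OF Cons.prems(1) j this] True j show ?thesis
      by (simp add: next_vertex_def U_Uinv_mult)
  next
    case False
    then have kq: "k \<in> set q" using Cons.prems(2) by simp
    define j' where "j' = next_vertex n q"
    \<comment> \<open>As \<open>k\<close> is still ahead, the next vertex is at most
      \<open>k\<close>; in particular it is not the sink, so the lower case applies.\<close>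
    have j': "j' \<in> {1..n}" "j < j'" "j' \<le> k"
      using q kq j by (cases q; force simp: j'_def next_vertex_def ascending_def)+
    have k: "k \<in> {1..n}" using q kq j by (auto simp: ascending_def)
    have "transpose_mat (E k) * (Q * Lambda_sum (j # q)) =
       transpose_mat (E k) * (Q * Lambda d n U V j j') + transpose_mat (E k) * (Q * Lambda_sum q)"
      using Lambda_carrier j' by (simp add: j'_def[symmetric] mat_simps)
    also have "\<dots> = transpose_mat (E k)"
      unfolding block_row_Lambda_lower[OF k j j'(1,3,2)] using Cons.IH[OF q kq] j
      by (simp add: left_add_zero_mat[of _ d "d * n"] carrier_matI)
    finally show ?thesis .
  qed
qed simp

lemma F_index_zero:
  assumes i: "i \<in> {1..n}" and j: "j \<in> {1..n + 1}" and ij: "i < j"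
    and b: "b \<in> {1..n}" "b \<noteq> i" "b \<noteq> j" and r: "r < d" and c: "c < d"
  shows "F i j $$ ((b - 1) * d + r, c) = 0"
proof -
  have Fc: "F i j \<in> carrier_mat (d * n) d" using i by (intro carrier_matI) auto
  have "mat d d (\<lambda>(r, c). F i j $$ ((b - 1) * d + r, c)) = 0\<^sub>m d d"
    using block_row_of_F[OF b(1) i j ij] b(2,3) transpose_block_column_mult[OF Fc b(1)] by simp
  then have "mat d d (\<lambda>(r, c). F i j $$ ((b - 1) * d + r, c)) $$ (r, c) = 0" using r c by simp
  then show ?thesis using r c by simp
qed

text \<open>All block rows of \<open>F i j\<close> other than \<open>i\<close> and \<open>j\<close>
  vanish, and \<open>F i j\<close> stands on both sides of the product.\<close>

lemma Lambda_support:
  assumes i: "i \<in> {1..n}" and j: "j \<in> {1..n + 1}" and ij: "i < j"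
    and rs: "r < d * n" "s < d * n"
    and out: "r \<notin> block_positions d {i, j} \<or> s \<notin> block_positions d {i, j}"
  shows "Lambda d n U V i j $$ (r, s) = 0"
proof -
  note I = inv_M(1)[OF i j ij]
  have zero: "F i j $$ (p, c) = 0" if p: "p < d * n" "p \<notin> block_positions d {i, j}" and c: "c < d" for p c
  proof -
    from p(1) obtain b t where b: "b \<in> {1..n}" "t < d" "p = (b - 1) * d + t" by (rule index_block_ex)
    with p(2) have "b \<noteq> i" "b \<noteq> j" by (auto simp: block_positions_def)
    with F_index_zero[OF i j ij b(1) _ _ b(2) c] b(3) show ?thesis by simp
  qed
  let ?A = "F i j * inv_mat (M i j)"
  have A: "?A $$ (r, c) = 0" if "c < d" "r \<notin> block_positions d {i, j}" for c
    using that zero[OF rs(1)] I i rs by (auto simp: scalar_prod_def)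
  have "Lambda d n U V i j $$ (r, s) = (\<Sum>c<d. ?A $$ (r, c) * F i j $$ (s, c))"
    unfolding Lambda_eq[OF i j ij] using I i rs
    by (auto simp: scalar_prod_def atLeast0LessThan intro!: sum.cong)
  also have "\<dots> = 0"
    using out A zero[OF rs(2)] by (intro sum.neutral) auto
  finally show ?thesis .
qed

lemma Lambda_sum_support:
  assumes "ascending n i q" "r < d * n" "s < d * n"
    and "r \<notin> block_positions d (set q) \<or> s \<notin> block_positions d (set q)"
  shows "Lambda_sum q $$ (r, s) = 0"
  using assms
proof (induction q arbitrary: i)
  case (Cons j q)
  have q: "ascending n j q" and j: "j \<in> {1..n}"
    using Cons.prems by (auto simp: ascending_Cons)
  define j' where "j' = next_vertex n q"
  have j': "j' \<in> {1..n + 1}" "j < j'" using ascending_next_vertex_mem[OF q j] by (auto simp: j'_def)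
  have sub: "p \<notin> block_positions d {j, j'} \<and> p \<notin> block_positions d (set q)"
    if p: "p < d * n" "p \<notin> block_positions d (set (j # q))" for p
  proof -
    \<comment> \<open>At the end of the path \<open>j'\<close> is the sink, whose block positions
      lie outside the matrix.\<close>
    have "p \<notin> block_positions d {n + 1}" using p(1) by (auto simp: block_positions_def mult.commute)
    moreover have "{j, j'} \<subseteq> set (j # q) \<union> {n + 1}"
      by (cases q) (auto simp: j'_def next_vertex_def)
    ultimately show ?thesis using p(2) by (fastforce simp: block_positions_def)
  qed
  have "r \<notin> block_positions d {j, j'} \<or> s \<notin> block_positions d {j, j'}"
    and out: "r \<notin> block_positions d (set q) \<or> s \<notin> block_positions d (set q)"
    using sub[of r] sub[of s] Cons.prems(2-4) by blast+
  from Lambda_support[OF j j' Cons.prems(2,3) this(1)] Cons.IH[OF q Cons.prems(2,3) out] j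
    Lambda_carrier Cons.prems(2,3)
  show ?case by (simp add: j'_def)
qed simp

theorem padded_inverse_eq_Lambda_sum:
  assumes q: "ascending n 0 q"
  shows "padded_inverse d n Q (set q) = Lambda_sum q"
proof (rule padded_inverse_eqI[OF Q])
  show S: "set q \<subseteq> {1..n}" using q by (auto simp: ascending_def Suc_le_eq)
  show "Lambda_sum q \<in> carrier_mat (d * n) (d * n)" by (simp add: carrier_matI)
  show "Lambda_sum q $$ (r, s) = 0"
    if "r < d * n" "s < d * n" "r \<notin> block_positions d (set q) \<or> s \<notin> block_positions d (set q)" for r s
    using Lambda_sum_support[OF q that] .
  show "(Q * Lambda_sum q) $$ (r, s) = (if r = s then 1 else 0)"
    if "r \<in> block_positions d (set q)" "s \<in> block_positions d (set q)" for r s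
  proof -
    from that S obtain k t where k: "k \<in> set q" "k \<in> {1..n}" "t < d" and r: "r = (k - 1) * d + t"
      by (auto simp: block_positions_def)
    have s: "s < d * n" using that(2) block_positions_subset[OF S] by auto
    have "Q * Lambda_sum q \<in> carrier_mat (d * n) (d * n)" by (intro carrier_matI) auto
    from transpose_block_column_mult[OF this k(2)]
    have "mat d (d * n) (\<lambda>(r, c). (Q * Lambda_sum q) $$ ((k - 1) * d + r, c)) = transpose_mat (E k)"
      using block_row_Lambda_sum[OF q k(1)] by simp
    then have "mat d (d * n) (\<lambda>(r, c). (Q * Lambda_sum q) $$ ((k - 1) * d + r, c)) $$ (t, s)
        = transpose_mat (E k) $$ (t, s)" by simp
    then show ?thesis using k(3) s by (simp add: r block_column_def)
  qed
qed

end

section \<open>Paths and the objective function\<close>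

fun path_arcs :: "nat \<Rightarrow> nat \<Rightarrow> nat list \<Rightarrow> (nat \<times> nat) list" where
  "path_arcs n i [] = [(i, n + 1)]"
| "path_arcs n i (j # q) = (i, j) # path_arcs n j q"

fun path_cost :: "nat \<Rightarrow> (nat \<times> nat \<Rightarrow> real) \<Rightarrow> nat \<Rightarrow> nat list \<Rightarrow> real" where
  "path_cost n l i [] = l (i, n + 1)"
| "path_cost n l i (j # q) = l (i, j) + path_cost n l j q"

lemma dag_simps:
  "verts (dag n) = {0..n + 1}" "arcs (dag n) = {(i, j). i < j \<and> j \<le> n + 1}"
  "tail (dag n) = fst" "head (dag n) = snd"
  by (simp_all add: dag_def)

lemma path_length_path_arcs: "path_length l (path_arcs n i q) = path_cost n l i q"
proof -
  interpret wf_digraph "dag n" by (rule wf_digraph_dag)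
  show ?thesis by (induction q arbitrary: i) (simp_all add: path_length_def)
qed

lemma awalk_path_arcs:
  assumes "i \<le> n" "ascending n i q"
  shows "pre_digraph.awalk (dag n) i (path_arcs n i q) (n + 1)"
proof -
  interpret wf_digraph "dag n" by (rule wf_digraph_dag)
  show ?thesis using assms
    by (induction q arbitrary: i)
       (auto simp: awalk_Cons_iff awalk_Nil_iff dag_simps ascending_Cons)
qed

lemma awalk_imp_path_arcs:
  assumes "pre_digraph.awalk (dag n) i p (n + 1)" "i \<le> n"
  shows "\<exists>q. ascending n i q \<and> p = path_arcs n i q"
proof -
  interpret wf_digraph "dag n" by (rule wf_digraph_dag)
  show ?thesis using assms
  proof (induction p arbitrary: i)
    case Nil
    then show ?case by (auto simp: awalk_Nil_iff)
  next
    case (Cons e p)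
    obtain j where e: "e = (i, j)" and ij: "i < j" "j \<le> n + 1" and p: "awalk j p (n + 1)"
      using Cons.prems(1) by (cases e) (auto simp: awalk_Cons_iff dag_simps)
    show ?case
    proof (cases "j = n + 1")
      case True
      \<comment> \<open>No arc leaves the sink.\<close>
      have "p = []" using p True by (cases p) (auto simp: awalk_Cons_iff dag_simps)
      then show ?thesis using True e by (intro exI[of _ "[]"]) (simp add: ascending_Nil)
    next
      case False
      then have j: "j \<le> n" using ij by simp
      from Cons.IH[OF p j] obtain q where "ascending n j q" "p = path_arcs n j q" by blast
      then show ?thesis using e ij j by (intro exI[of _ "j # q"]) (simp add: ascending_Cons)
    qed
  qed
qed

lemma awalk_verts_path_arcs:
  "pre_digraph.awalk_verts (dag n) i (path_arcs n i q) = i # q @ [n + 1]"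
  by (induction q arbitrary: i) (auto simp: pre_digraph.awalk_verts.simps dag_simps)

lemma apath_path_arcs:
  assumes "i \<le> n" "ascending n i q"
  shows "pre_digraph.apath (dag n) i (path_arcs n i q) (n + 1)"
proof -
  have "distinct (i # q @ [n + 1])"
    using assms by (auto simp: ascending_def strict_sorted_iff)
  then show ?thesis
    using awalk_path_arcs[OF assms] by (simp add: pre_digraph.apath_def awalk_verts_path_arcs)
qed

lemma inner_verts_path_arcs: "ascending n 0 q \<Longrightarrow> inner_verts n (path_arcs n 0 q) = set q"
  by (auto simp: inner_verts_def awalk_verts_path_arcs ascending_def)

text \<open>\<open>\<mu>\<close> is an infimum over all walks in the extended reals. In this graph
  every walk from 0 to \<open>n + 1\<close> comes from an ascending list, so attaining the infimum
  amounts to comparing real path costs.\<close>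

lemma shortest_path_iff:
  "shortest_path n l p \<longleftrightarrow> (\<exists>q. ascending n 0 q \<and> p = path_arcs n 0 q \<and>
     (\<forall>q'. ascending n 0 q' \<longrightarrow> path_cost n l 0 q \<le> path_cost n l 0 q'))"
proof -
  interpret wf_digraph "dag n" by (rule wf_digraph_dag)
  have walks: "{p. awalk 0 p (n + 1)} = path_arcs n 0 ` {q. ascending n 0 q}"
    using awalk_path_arcs[of 0 n] awalk_imp_path_arcs[of n 0] by auto
  have mu: "\<mu> l 0 (n + 1) = (INF q \<in> {q. ascending n 0 q}. ereal (path_cost n l 0 q))"
    unfolding \<mu>_def walks by (simp add: image_image path_length_path_arcs[unfolded path_length_def])
  show ?thesis
  proof
    assume p: "shortest_path n l p"
    then have "awalk 0 p (n + 1)" by (simp add: shortest_path_def apath_def)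
    with awalk_imp_path_arcs obtain q where q: "ascending n 0 q" "p = path_arcs n 0 q" by blast
    have "path_cost n l 0 q \<le> path_cost n l 0 q'" if "ascending n 0 q'" for q'
    proof -
      have "ereal (path_cost n l 0 q) = \<mu> l 0 (n + 1)"
        using p q by (simp add: shortest_path_def path_length_path_arcs)
      also have "\<dots> \<le> ereal (path_cost n l 0 q')" unfolding mu using that by (intro INF_lower) simp
      finally show ?thesis by simp
    qed
    with q show "\<exists>q. ascending n 0 q \<and> p = path_arcs n 0 q \<and>
       (\<forall>q'. ascending n 0 q' \<longrightarrow> path_cost n l 0 q \<le> path_cost n l 0 q')" by blast
  next
    assume "\<exists>q. ascending n 0 q \<and> p = path_arcs n 0 q \<and>
       (\<forall>q'. ascending n 0 q' \<longrightarrow> path_cost n l 0 q \<le> path_cost n l 0 q')"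
    then obtain q where q: "ascending n 0 q" "p = path_arcs n 0 q"
      "\<And>q'. ascending n 0 q' \<Longrightarrow> path_cost n l 0 q \<le> path_cost n l 0 q'" by blast
    have "\<mu> l 0 (n + 1) = ereal (path_cost n l 0 q)"
      unfolding mu by (rule INF_eqI) (use q in auto)
    then show "shortest_path n l p"
      using apath_path_arcs[of 0 n q] q by (simp add: shortest_path_def path_length_path_arcs)
  qed
qed

lemma ascending_sorted_list_of_set:
  assumes "S \<subseteq> {1..n}"
  shows "ascending n 0 (sorted_list_of_set S)" "set (sorted_list_of_set S) = S"
proof -
  have fin: "finite S" using assms by (rule finite_subset) simp
  then show "set (sorted_list_of_set S) = S" by simp
  then show "ascending n 0 (sorted_list_of_set S)"
    using assms by (auto simp: ascending_def)
qed

section \<open>The linear objective on the convex hull\<close>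

lemma quadratic_form_sum:
  fixes a :: "real vec"
  assumes a: "a \<in> carrier_vec N" and P: "\<And>S. S \<in> I \<Longrightarrow> P S \<in> carrier_mat N N"
  shows "a \<bullet> (mat N N (\<lambda>rs. \<Sum>S\<in>I. w S * P S $$ rs) *\<^sub>v a) = (\<Sum>S\<in>I. w S * (a \<bullet> (P S *\<^sub>v a)))"
proof -
  have "a \<bullet> (X *\<^sub>v a) = (\<Sum>r<N. \<Sum>s<N. a $ r * (X $$ (r, s) * a $ s))" if "X \<in> carrier_mat N N" for X
    using that a by (auto simp: scalar_prod_def atLeast0LessThan sum_distrib_left intro!: sum.cong)
  note q = this
  have "a \<bullet> (mat N N (\<lambda>rs. \<Sum>S\<in>I. w S * P S $$ rs) *\<^sub>v a)
     = (\<Sum>r<N. \<Sum>s<N. \<Sum>S\<in>I. w S * (a $ r * (P S $$ (r, s) * a $ s)))"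
    by (subst q) (auto simp: sum_distrib_left sum_distrib_right algebra_simps intro!: sum.cong)
  also have "\<dots> = (\<Sum>S\<in>I. w S * (\<Sum>r<N. \<Sum>s<N. a $ r * (P S $$ (r, s) * a $ s)))"
    by (simp add: sum_distrib_left sum.swap[of _ I])
  also have "\<dots> = (\<Sum>S\<in>I. w S * (a \<bullet> (P S *\<^sub>v a)))" using q[OF P] by simp
  finally show ?thesis .
qed

lemma padded_inverse_carrier: "padded_inverse d n Q S \<in> carrier_mat (d * n) (d * n)"
  by (simp add: padded_inverse_def Let_def)

lemma objective_convex_combination:
  assumes a: "a \<in> carrier_vec (d * n)" and c: "c \<in> carrier_vec n"
  shows "objective a c (vec n (\<lambda>k. \<Sum>S\<in>Pow {1..n}. w S * indicator_vec n S $ k),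
      mat (d * n) (d * n) (\<lambda>rs. \<Sum>S\<in>Pow {1..n}. w S * padded_inverse d n Q S $$ rs))
    = (\<Sum>S\<in>Pow {1..n}. w S * objective a c (indicator_vec n S, padded_inverse d n Q S))"
proof -
  let ?I = "Pow {1..n}"
  have "c \<bullet> vec n (\<lambda>k. \<Sum>S\<in>?I. w S * indicator_vec n S $ k)
      = (\<Sum>k<n. \<Sum>S\<in>?I. w S * (c $ k * indicator_vec n S $ k))"
    by (auto simp: scalar_prod_def atLeast0LessThan sum_distrib_left algebra_simps intro!: sum.cong)
  also have "\<dots> = (\<Sum>S\<in>?I. w S * (\<Sum>k<n. c $ k * indicator_vec n S $ k))"
    unfolding sum_distrib_left by (rule sum.swap)
  also have "\<dots> = (\<Sum>S\<in>?I. w S * (c \<bullet> indicator_vec n S))"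
    by (auto simp: scalar_prod_def atLeast0LessThan indicator_vec_def intro!: sum.cong)
  finally show ?thesis
    using quadratic_form_sum[OF a, of ?I "padded_inverse d n Q" w, OF padded_inverse_carrier]
    by (simp add: objective_def distrib_left sum.distrib right_diff_distrib sum_subtractf
        sum_divide_distrib sum_negf)
qed

lemma vertex_in_P_B:
  assumes "S \<subseteq> {1..n}"
  shows "(indicator_vec n S, padded_inverse d n Q S) \<in> P_B d n Q"
proof -
  let ?w = "\<lambda>T. if T = S then 1 else 0 :: real"
  have delta: "(\<Sum>T\<in>Pow {1..n}. ?w T * f T) = f S" for f :: "nat set \<Rightarrow> real"
    using assms by (subst sum.cong[OF refl, of _ _ "\<lambda>T. if T = S then f T else 0"]) auto
  show ?thesis unfolding P_B_def mem_Collect_eq case_prod_conv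
  proof (intro exI[of _ ?w] conjI ballI)
    show "(\<Sum>T\<in>Pow {1..n}. ?w T) = 1" using delta[of "\<lambda>_. 1"] by simp
    show "indicator_vec n S = vec n (\<lambda>k. \<Sum>T\<in>Pow {1..n}. ?w T * indicator_vec n T $ k)"
      unfolding delta by (rule eq_vecI) (simp_all add: indicator_vec_def)
    show "padded_inverse d n Q S =
        mat (d * n) (d * n) (\<lambda>rs. \<Sum>T\<in>Pow {1..n}. ?w T * padded_inverse d n Q T $$ rs)"
      unfolding delta using padded_inverse_carrier[of d n Q S] by (intro eq_matI) auto
  qed simp
qed

lemma is_arg_min_vertex:
  assumes a: "a \<in> carrier_vec (d * n)" and c: "c \<in> carrier_vec n" and S: "S \<subseteq> {1..n}"
    and min: "\<And>T. T \<subseteq> {1..n} \<Longrightarrow> objective a c (indicator_vec n S, padded_inverse d n Q S)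
      \<le> objective a c (indicator_vec n T, padded_inverse d n Q T)"
  shows "is_arg_min (objective a c) (\<lambda>x. x \<in> P_B d n Q) (indicator_vec n S, padded_inverse d n Q S)"
proof -
  let ?m = "objective a c (indicator_vec n S, padded_inverse d n Q S)"
  have "?m \<le> objective a c x" if "x \<in> P_B d n Q" for x
  proof -
    from that obtain w where w: "\<forall>S \<in> Pow {1..n}. w S \<ge> 0" "(\<Sum>S \<in> Pow {1..n}. w S) = 1"
      and x: "x = (vec n (\<lambda>k. \<Sum>S\<in>Pow {1..n}. w S * indicator_vec n S $ k),
        mat (d * n) (d * n) (\<lambda>rs. \<Sum>S\<in>Pow {1..n}. w S * padded_inverse d n Q S $$ rs))"
      by (cases x) (auto simp: P_B_def)
    have "?m = (\<Sum>T\<in>Pow {1..n}. w T * ?m)" using w(2) by (simp add: sum_distrib_right[symmetric])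
    also have "\<dots> \<le> (\<Sum>T\<in>Pow {1..n}. w T * objective a c (indicator_vec n T, padded_inverse d n Q T))"
      using w(1) min by (intro sum_mono mult_left_mono) auto
    finally show ?thesis unfolding x objective_convex_combination[OF a c] .
  qed
  then show ?thesis using vertex_in_P_B[OF S, of d Q] by (auto simp: is_arg_min_def not_less)
qed

lemma indicator_vec_insert:
  assumes "c \<in> carrier_vec n" "j \<in> {1..n}" "j \<notin> S"
  shows "c \<bullet> indicator_vec n (insert j S) = c $ (j - 1) + c \<bullet> indicator_vec n S"
proof -
  have "c \<bullet> indicator_vec n (insert j S) =
      (\<Sum>k<n. c $ k * (if k = j - 1 then 1 else 0) + c $ k * (if k + 1 \<in> S then 1 else 0))"
    using assms by (auto simp: indicator_vec_def scalar_prod_def atLeast0LessThan intro!: sum.cong)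
  also have "\<dots> = (\<Sum>k<n. c $ k * (if k = j - 1 then 1 else 0)) + c \<bullet> indicator_vec n S"
    using assms(1) by (auto simp: sum.distrib indicator_vec_def scalar_prod_def atLeast0LessThan)
  also have "(\<Sum>k<n. c $ k * (if k = j - 1 then 1 else 0)) = (\<Sum>k<n. if k = j - 1 then c $ k else 0)"
    by (intro sum.cong) auto
  also have "\<dots> = c $ (j - 1)" using assms(2) by (simp add: less_eq_Suc_le)
  finally show ?thesis .
qed

context pd_factorizable
begin

lemma path_cost_eq_objective:
  assumes a: "a \<in> carrier_vec (d * n)" and c: "c \<in> carrier_vec n"
    and q: "ascending n 0 q"
  shows "path_cost n (arc_cost d n U V a c) 0 q =
    objective a c (indicator_vec n (set q), padded_inverse d n Q (set q))"
proof -
  \<comment> \<open>The first arc is split off because only its cost depends on \<open>i\<close>.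
    For \<open>i = 0\<close> that cost is 0, and the rest is the objective value.\<close>
  have "path_cost n (arc_cost d n U V a c) i q = arc_cost d n U V a c (i, next_vertex n q) +
      (c \<bullet> indicator_vec n (set q) - 1/4 * (a \<bullet> (Lambda_sum q *\<^sub>v a)))"
    if "ascending n i q" for i
    using that
  proof (induction q arbitrary: i)
    case Nil
    have "c \<bullet> indicator_vec n {} = 0"
      by (auto simp: scalar_prod_def indicator_vec_def)
    moreover have "a \<bullet> (0\<^sub>m (d * n) (d * n) *\<^sub>v a) = 0" using a by (auto simp: scalar_prod_def)
    ultimately show ?case by (simp add: next_vertex_def)
  next
    case (Cons j q)
    then have q: "ascending n j q" and j: "j \<in> {1..n}" "0 < j" by (auto simp: ascending_Cons)
    have "j \<notin> set q" using q by (auto simp: ascending_def)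
    moreover have "a \<bullet> ((Lambda d n U V j (next_vertex n q) + Lambda_sum q) *\<^sub>v a) =
        a \<bullet> (Lambda d n U V j (next_vertex n q) *\<^sub>v a) + a \<bullet> (Lambda_sum q *\<^sub>v a)"
    proof -
      have s: "Lambda_sum q \<in> carrier_mat (d * n) (d * n)" by (intro carrier_matI) auto
      show ?thesis
        unfolding add_mult_distrib_mat_vec[OF Lambda_carrier s a]
        by (rule scalar_prod_add_distrib[OF a])
           (use mult_mat_vec_carrier[OF Lambda_carrier a] mult_mat_vec_carrier[OF s a] in auto)
    qed
    ultimately show ?case
      using Cons.IH[OF q] indicator_vec_insert[OF c j(1), of "set q"] j(2)
      by (simp add: next_vertex_def[of n "j # q"] arc_cost_def algebra_simps)
  qed
  from this[OF q] show ?thesis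
    by (simp add: padded_inverse_eq_Lambda_sum[OF q] objective_def arc_cost_def)
qed

theorem shortest_path_optimal:
  assumes a: "a \<in> carrier_vec (d * n)" and c: "c \<in> carrier_vec n"
    and p: "shortest_path n (arc_cost d n U V a c) p"
  defines "sol \<equiv> (indicator_vec n (inner_verts n p), padded_inverse d n Q (inner_verts n p))"
  shows "is_arg_min (objective a c) (\<lambda>x. x \<in> P_B d n Q) sol"
    and "objective a c sol = path_length (arc_cost d n U V a c) p"
proof -
  let ?l = "arc_cost d n U V a c"
  from p obtain q where q: "ascending n 0 q" "p = path_arcs n 0 q"
    and min: "\<And>q'. ascending n 0 q' \<Longrightarrow> path_cost n ?l 0 q \<le> path_cost n ?l 0 q'"
    unfolding shortest_path_iff by blast
  have sol: "sol = (indicator_vec n (set q), padded_inverse d n Q (set q))"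
    unfolding sol_def q(2) inner_verts_path_arcs[OF q(1)] ..
  show "objective a c sol = path_length ?l p"
    unfolding sol q(2) path_length_path_arcs path_cost_eq_objective[OF a c q(1)] ..
  show "is_arg_min (objective a c) (\<lambda>x. x \<in> P_B d n Q) sol"
    unfolding sol
  proof (rule is_arg_min_vertex[OF a c])
    show "set q \<subseteq> {1..n}" using q(1) by (auto simp: ascending_def Suc_le_eq)
    show "objective a c (indicator_vec n (set q), padded_inverse d n Q (set q))
      \<le> objective a c (indicator_vec n T, padded_inverse d n Q T)" if "T \<subseteq> {1..n}" for T
      \<comment> \<open>Every \<open>T\<close> is the set of an ascending list, so each vertex of
        the hull competes as a path.\<close>
      using min[OF ascending_sorted_list_of_set(1)[OF that]] ascending_sorted_list_of_set[OF that]
      by (simp add: path_cost_eq_objective[OF a c] q(1))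
  qed
qed

section \<open>The objective in terms of d x d matrices\<close>

definition vec_block :: "real vec \<Rightarrow> nat \<Rightarrow> real mat" where
  "vec_block a i = (if i = n + 1 then 0\<^sub>m d d
     else mat d d (\<lambda>(r, s). if s = 0 then a $ ((i - 1) * d + r) else 0))"

lemma transpose_block_column_Suc_n: "transpose_mat (E (n + 1)) = 0\<^sub>m d (d * n)"
  unfolding block_column_Suc_n by (rule eq_matI) auto

text \<open>\<open>a\<close> becomes the first column of a matrix with \<open>d\<close> columns,
  zero elsewhere. Then its blocks are square, every product can be charged by
  \<open>mult_complexity\<close>, and the quadratic form is the entry at (0, 0).\<close>

lemma quadratic_form_Lambda:
  assumes a: "a \<in> carrier_vec (d * n)" and d: "1 \<le> d"
    and i: "i \<in> {1..n}" and j: "j \<in> {1..n + 1}" and ij: "i < j"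
  defines "v \<equiv> vec_block a i - G i j * vec_block a j"
  shows "a \<bullet> (Lambda d n U V i j *\<^sub>v a) = (transpose_mat v * inv_mat (M i j) * v) $$ (0, 0)"
proof -
  define \<alpha> where "\<alpha> = mat (d * n) d (\<lambda>(r, s). if s = 0 then a $ r else 0)"
  have \<alpha>: "\<alpha> \<in> carrier_mat (d * n) d" by (simp add: \<alpha>_def)
  have [simp]: "dim_row \<alpha> = d * n" "dim_col \<alpha> = d" using \<alpha> by auto
  have [simp]: "dim_row (inv_mat (M i j)) = d" "dim_col (inv_mat (M i j)) = d"
    using inv_M(1)[OF i j ij] by auto
  have E\<alpha>: "transpose_mat (E k) * \<alpha> = vec_block a k" if "k \<in> {1..n + 1}" for k
  proof (cases "k = n + 1")
    case True
    have "transpose_mat (E (n + 1)) * \<alpha> = 0\<^sub>m d d"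
      unfolding transpose_block_column_Suc_n by (rule left_mult_zero_mat[OF \<alpha>])
    with True show ?thesis by (simp add: vec_block_def)
  next
    case False
    then have k: "k \<in> {1..n}" using that by auto
    show ?thesis unfolding transpose_block_column_mult[OF \<alpha> k]
      using False block_index_less[OF k] by (auto simp: vec_block_def \<alpha>_def intro!: eq_matI)
  qed
  have i': "i \<in> {1..n + 1}" using i by auto
  have F\<alpha>: "transpose_mat (F i j) * \<alpha> = v"
    unfolding v_def E\<alpha>[OF i', symmetric] E\<alpha>[OF j, symmetric] F_def using i j by (simp add: mat_simps)
  have "transpose_mat \<alpha> * (Lambda d n U V i j * \<alpha>) = transpose_mat v * inv_mat (M i j) * v"
    unfolding Lambda_eq[OF i j ij] F\<alpha>[symmetric] using i j by (simp add: mat_simps)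
  moreover have "(transpose_mat \<alpha> * (Lambda d n U V i j * \<alpha>)) $$ (0, 0) = a \<bullet> (Lambda d n U V i j *\<^sub>v a)"
  proof -
    have "col \<alpha> 0 = a" using a d by (intro eq_vecI) (auto simp: \<alpha>_def)
    then show ?thesis using d by (simp add: col_mult2[OF Lambda_carrier \<alpha>])
  qed
  ultimately show ?thesis by simp
qed

lemma block_row_of_F_extended:
  assumes b: "b \<in> {1..n + 1}" and i: "i \<in> {1..n}" and j: "j \<in> {1..n + 1}" and ij: "i < j"
  shows "transpose_mat (E b) * F i j =
    (if b = i then 1\<^sub>m d else if b = j then 0\<^sub>m d d - transpose_mat (G i j) else 0\<^sub>m d d)"
proof (cases "b = n + 1")
  case True
  have "F i j \<in> carrier_mat (d * n) d" using i by (intro carrier_matI) auto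
  then have "transpose_mat (E b) * F i j = 0\<^sub>m d d"
    unfolding True transpose_block_column_Suc_n by (rule left_mult_zero_mat)
  moreover have "0\<^sub>m d d - transpose_mat (G i (n + 1)) = (0\<^sub>m d d :: real mat)"
  proof -
    have "G i (n + 1) = 0\<^sub>m d d" using UV(1)[OF i] by (simp add: G_def Uinv_def)
    then show ?thesis by (intro eq_matI) auto
  qed
  ultimately show ?thesis using True i by auto
next
  case False
  then show ?thesis using block_row_of_F[OF _ i j ij, of b] b by auto
qed

lemma Lambda_block:
  assumes b: "b \<in> {1..n + 1}" "b' \<in> {1..n + 1}" and i: "i \<in> {1..n}" and j: "j \<in> {1..n + 1}" and ij: "i < j"
  shows "transpose_mat (E b) * (Lambda d n U V i j * E b') =
    transpose_mat (E b) * F i j * inv_mat (M i j) * transpose_mat (transpose_mat (E b') * F i j)"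
proof -
  have [simp]: "dim_row (inv_mat (M i j)) = d" "dim_col (inv_mat (M i j)) = d"
    using inv_M(1)[OF i j ij] by auto
  show ?thesis unfolding Lambda_eq[OF i j ij] using i by (simp add: mat_simps)
qed

end

section \<open>The algorithm\<close>

definition knows :: "nat \<Rightarrow> real list \<Rightarrow> (nat mat \<times> real mat) set \<Rightarrow> (nat \<times> real) set \<Rightarrow> bool" where
  "knows d m K L \<longleftrightarrow> (\<forall>(A, X) \<in> K. X \<in> carrier_mat d d \<and> mat_stored m A X) \<and> (\<forall>(i, x) \<in> L. stored m i x)"

text \<open>A stored matrix provides its transpose for free.\<close>

definition known :: "(nat mat \<times> real mat) set \<Rightarrow> nat mat \<Rightarrow> real mat \<Rightarrow> bool" where
  "known K A X \<longleftrightarrow> (A, X) \<in> K \<or> (transpose_mat A, transpose_mat X) \<in> K"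

lemma known_here: "known (insert (A, X) K) A X"
  by (simp add: known_def)

lemma known_transpose: "known (insert (A, X) K) (transpose_mat A) (transpose_mat X)"
  by (simp add: known_def)

lemma known_there: "known K A X \<Longrightarrow> known (insert p K) A X"
  by (auto simp: known_def)

lemmas known_intros = known_here known_transpose known_there

lemma knows_known:
  assumes K: "knows d m K L" and A: "known K A X"
  shows "X \<in> carrier_mat d d" "mat_stored m A X"
proof -
  have "X \<in> carrier_mat d d \<and> mat_stored m A X"
    using A unfolding known_def
  proof
    assume "(A, X) \<in> K"
    then show ?thesis using K by (auto simp: knows_def)
  next
    assume "(transpose_mat A, transpose_mat X) \<in> K"
    then have "transpose_mat X \<in> carrier_mat d d" "mat_stored m (transpose_mat A) (transpose_mat X)"
      using K by (auto simp: knows_def)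
    then show ?thesis using mat_stored_transpose[of m "transpose_mat A" "transpose_mat X"] by auto
  qed
  then show "X \<in> carrier_mat d d" "mat_stored m A X" by auto
qed

lemma knows_prefix: "knows d m K L \<Longrightarrow> prefix m m' \<Longrightarrow> knows d m' K L"
  unfolding knows_def by (auto intro: mat_stored_prefix stored_prefix)

lemma knows_entry:
  "knows d m K L \<Longrightarrow> known K A X \<Longrightarrow> i < d \<Longrightarrow> j < d \<Longrightarrow> knows d m K (insert (A $$ (i, j), X $$ (i, j)) L)"
  using knows_known[of d m K L A X] by (auto simp: knows_def mat_stored_def)

definition mat_arith :: "nat \<Rightarrow> arith \<Rightarrow> nat mat \<Rightarrow> nat mat \<Rightarrow> nat mat comp" where
  "mat_arith d f A B = bind (tab (\<lambda>p. arith f (A $$ p) (B $$ p)) (List.product [0..<d] [0..<d]))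
     (\<lambda>g. ret (mat d d g))"

lemma runs_mat_arith:
  assumes A: "mat_stored m A X" and B: "mat_stored m B Y"
    and X: "X \<in> carrier_mat d d" and Y: "Y \<in> carrier_mat d d" and Z: "Z \<in> carrier_mat d d"
    and f: "\<And>i j. i < d \<Longrightarrow> j < d \<Longrightarrow> arith_val f (X $$ (i, j)) (Y $$ (i, j)) = Some (Z $$ (i, j))"
  shows "runs (mat_arith d f A B) m (d * d) (\<lambda>m' C. mat_stored m' C Z)"
  unfolding mat_arith_def
proof (rule runs_bind)
  show "runs (tab (\<lambda>p. arith f (A $$ p) (B $$ p)) (List.product [0..<d] [0..<d])) m (d * d)
    (\<lambda>m' g. \<forall>p \<in> set (List.product [0..<d] [0..<d]). stored m' (g p) (Z $$ p))"
  proof (rule runs_tab[where t = 1])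
    fix m' p assume m: "prefix m m'" and "p \<in> set (List.product [0..<d] [0..<d])"
    then obtain i j where p: "p = (i, j)" "i < d" "j < d" by auto
    have "stored m' (A $$ p) (X $$ p)" "stored m' (B $$ p) (Y $$ p)"
      using mat_stored_prefix[OF A m] mat_stored_prefix[OF B m] p X Y by (auto simp: mat_stored_def)
    then show "runs (arith f (A $$ p) (B $$ p)) m' 1 (\<lambda>m'' k. stored m'' k (Z $$ p))"
      using f[OF p(2,3)] p(1) by (intro runs_arith) auto
  qed (auto intro: stored_prefix simp: length_product)
  show "runs (ret (mat d d g)) m' 0 (\<lambda>m' C. mat_stored m' C Z)"
    if "\<forall>p \<in> set (List.product [0..<d] [0..<d]). stored m' (g p) (Z $$ p)" for m' g
    using that Z by (intro runs_ret) (auto simp: mat_stored_def)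
qed simp

text \<open>Programs attaining the two complexities are fixed apart from the problem data, because
  the final program must not depend on the data.\<close>

locale block_programs =
  fixes d :: nat and Pm Pi :: program
  assumes d_pos: "1 \<le> d"
    and Pm: "\<And>A B. A \<in> carrier_mat d d \<Longrightarrow> B \<in> carrier_mat d d \<Longrightarrow>
      computes_within (mult_complexity d) Pm (entries A @ entries B) (entries (A * B))"
    and Pi: "\<And>A. A \<in> carrier_mat d d \<Longrightarrow> det A \<noteq> 0 \<Longrightarrow>
      computes_within (inv_complexity d) Pi (entries A) (entries (inv_mat A))"
begin

abbreviation \<kappa> :: nat where
  "\<kappa> \<equiv> mat_complexity d"

lemma square_le_\<kappa>: "d * d \<le> \<kappa>"
  using square_le_mult_complexity[of d] by (simp add: mat_complexity_def)

text \<open>Lets a scalar operation of cost 1 be charged like a matrix operation.\<close>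

lemma \<kappa>_pos: "1 \<le> \<kappa>"
  using order_trans[OF mult_le_mono[OF d_pos d_pos] square_le_\<kappa>] by simp

definition mmul :: "nat mat \<Rightarrow> nat mat \<Rightarrow> nat mat comp" where
  "mmul A B = bind (embed Pm (concat (mat_to_list A) @ concat (mat_to_list B))) (\<lambda>as. ret (of_entries d as))"

definition minv :: "nat mat \<Rightarrow> nat mat comp" where
  "minv A = bind (embed Pi (concat (mat_to_list A))) (\<lambda>as. ret (of_entries d as))"

lemma runs_mult:
  assumes "X \<in> carrier_mat d d" "Y \<in> carrier_mat d d" "mat_stored m A X" "mat_stored m B Y"
  shows "runs (mmul A B) m \<kappa> (\<lambda>m' C. mat_stored m' C (X * Y))"
  unfolding mmul_def
proof (rule runs_bind)
  obtain s where s: "s \<le> mult_complexity d" "exec Pm (entries X @ entries Y) = Some (entries (X * Y), s)"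
    using Pm[OF assms(1,2)] by (auto simp: computes_within_def)
  show "runs (embed Pm (concat (mat_to_list A) @ concat (mat_to_list B))) m (mult_complexity d)
      (\<lambda>m' as. list_all2 (stored m') as (entries (X * Y)))"
    by (rule runs_embed[OF s(2) _ s(1)]) (use assms in \<open>auto intro: list_all2_appendI mat_stored_entries\<close>)
  show "runs (ret (of_entries d as)) m' 0 (\<lambda>m' C. mat_stored m' C (X * Y))"
    if "list_all2 (stored m') as (entries (X * Y))" for m' as
    using that assms by (intro runs_ret mat_stored_of_entries) auto
qed (simp add: mat_complexity_def)

lemma runs_inv:
  assumes "X \<in> carrier_mat d d" "det X \<noteq> 0" "mat_stored m A X"
  shows "runs (minv A) m \<kappa> (\<lambda>m' C. mat_stored m' C (inv_mat X))"
  unfolding minv_def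
proof (rule runs_bind)
  obtain s where s: "s \<le> inv_complexity d" "exec Pi (entries X) = Some (entries (inv_mat X), s)"
    using Pi[OF assms(1,2)] by (auto simp: computes_within_def)
  show "runs (embed Pi (concat (mat_to_list A))) m (inv_complexity d)
      (\<lambda>m' as. list_all2 (stored m') as (entries (inv_mat X)))"
    by (rule runs_embed[OF s(2) _ s(1)]) (use assms in \<open>auto intro: mat_stored_entries\<close>)
  show "runs (ret (of_entries d as)) m' 0 (\<lambda>m' C. mat_stored m' C (inv_mat X))"
    if "list_all2 (stored m') as (entries (inv_mat X))" for m' as
    using that inv_mat(1)[OF assms(1,2)] by (intro runs_ret mat_stored_of_entries) auto
qed (simp add: mat_complexity_def)

text \<open>Each step rule executes one operation: it adds the result to the known facts, which stay
  valid as the memory grows, and takes one \<open>\<kappa>\<close> from the budget.\<close>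

lemma step_mat:
  assumes K: "knows d m K L" and c: "runs c m \<kappa> (\<lambda>m' C. mat_stored m' C Z)" and Z: "Z \<in> carrier_mat d d"
    and f: "\<And>m' C. knows d m' (insert (C, Z) K) L \<Longrightarrow> runs (f C) m' t \<Psi>"
  shows "runs (bind c f) m (\<kappa> + t) \<Psi>"
proof (rule runs_bind[OF c _ order_refl])
  fix m' C assume "prefix m m'" "mat_stored m' C Z"
  then show "runs (f C) m' t \<Psi>"
    using knows_prefix[OF K] Z by (intro f) (auto simp: knows_def)
qed

lemma step_mult:
  assumes "knows d m K L" "known K A X" "known K B Y"
    and f: "\<And>m' C. knows d m' (insert (C, X * Y) K) L \<Longrightarrow> runs (f C) m' t \<Psi>"
  shows "runs (bind (mmul A B) f) m (\<kappa> + t) \<Psi>"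
  using knows_known[OF assms(1,2)] knows_known[OF assms(1,3)]
  by (intro step_mat[OF assms(1) runs_mult _ f]) auto

lemma step_inv:
  assumes "knows d m K L" "known K A X" "det X \<noteq> 0"
    and f: "\<And>m' C. knows d m' (insert (C, inv_mat X) K) L \<Longrightarrow> runs (f C) m' t \<Psi>"
  shows "runs (bind (minv A) f) m (\<kappa> + t) \<Psi>"
  using knows_known[OF assms(1,2)] assms(3)
  by (intro step_mat[OF assms(1) runs_inv _ f]) (auto intro: inv_mat(1))

lemma step_plus:
  assumes "knows d m K L" "known K A X" "known K B Y"
    and f: "\<And>m' C. knows d m' (insert (C, X + Y) K) L \<Longrightarrow> runs (f C) m' t \<Psi>"
  shows "runs (bind (mat_arith d Plus A B) f) m (\<kappa> + t) \<Psi>"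
proof (rule step_mat[OF assms(1) _ _ f])
  have *: "X \<in> carrier_mat d d" "mat_stored m A X" "Y \<in> carrier_mat d d" "mat_stored m B Y"
    using knows_known[OF assms(1,2)] knows_known[OF assms(1,3)] by auto
  then show "X + Y \<in> carrier_mat d d" by auto
  then show "runs (mat_arith d Plus A B) m \<kappa> (\<lambda>m' C. mat_stored m' C (X + Y))"
    using * by (intro runs_mono[OF runs_mat_arith square_le_\<kappa>]) auto
qed

lemma step_minus:
  assumes "knows d m K L" "known K A X" "known K B Y"
    and f: "\<And>m' C. knows d m' (insert (C, X - Y) K) L \<Longrightarrow> runs (f C) m' t \<Psi>"
  shows "runs (bind (mat_arith d Minus A B) f) m (\<kappa> + t) \<Psi>"
proof (rule step_mat[OF assms(1) _ _ f])
  have *: "X \<in> carrier_mat d d" "mat_stored m A X" "Y \<in> carrier_mat d d" "mat_stored m B Y"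
    using knows_known[OF assms(1,2)] knows_known[OF assms(1,3)] by auto
  then show "X - Y \<in> carrier_mat d d" by auto
  then show "runs (mat_arith d Minus A B) m \<kappa> (\<lambda>m' C. mat_stored m' C (X - Y))"
    using * by (intro runs_mono[OF runs_mat_arith square_le_\<kappa>]) auto
qed

lemma step_arith:
  assumes K: "knows d m K L" and ij: "(i, x) \<in> L" "(j, y) \<in> L" "arith_val op x y = Some z"
    and f: "\<And>m' k. knows d m' K (insert (k, z) L) \<Longrightarrow> runs (f k) m' t \<Psi>"
  shows "runs (bind (arith op i j) f) m (\<kappa> + t) \<Psi>"
proof (rule runs_bind[OF _ _ order_refl])
  show "runs (arith op i j) m \<kappa> (\<lambda>m' k. stored m' k z)"
    using K ij \<kappa>_pos by (intro runs_arith[of m i x j y]) (auto simp: knows_def)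
  show "runs (f k) m' t \<Psi>" if "prefix m m'" "stored m' k z" for m' k
    using that knows_prefix[OF K] by (intro f) (auto simp: knows_def)
qed

text \<open>\<open>F\<^sup>T a\<close> and \<open>(F\<^sup>T a)\<^sup>T M\<^sup>-\<^sup>1 (F\<^sup>T a)\<close> are computed by multiplying \<open>d \<times> d\<close>
  matrices: a vector is the first column of a matrix which is zero elsewhere.\<close>

definition arc_prog ::
    "nat \<Rightarrow> nat \<Rightarrow> nat mat \<Rightarrow> nat mat \<Rightarrow> nat mat \<Rightarrow> nat mat \<Rightarrow> nat mat \<Rightarrow> nat mat \<Rightarrow>
     (nat mat \<times> nat mat \<times> nat) comp" where
  "arc_prog q c U V W V' A A' =
     bind (mmul U W) (\<lambda>G. bind (mmul U (transpose_mat V)) (\<lambda>X. bind (mmul G V') (\<lambda>Y.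
     bind (mmul Y (transpose_mat U)) (\<lambda>Y'. bind (mat_arith d Minus X Y') (\<lambda>M. bind (minv M) (\<lambda>N.
     bind (mmul G A') (\<lambda>b. bind (mat_arith d Minus A b) (\<lambda>v. bind (mmul (transpose_mat v) N) (\<lambda>x.
     bind (mmul x v) (\<lambda>y. bind (arith Times q (y $$ (0, 0))) (\<lambda>s. bind (arith Minus c s) (\<lambda>r.
     ret (G, N, r)))))))))))))"

lemma runs_arc_prog:
  assumes K: "knows d m {(U, u), (V, v), (W, w), (V', v'), (A, \<alpha>), (A', \<alpha>')} {(q, 1/4), (c, \<gamma>)}"
    and N: "N = inv_mat (u * transpose_mat v - u * w * v' * transpose_mat u)"
    and det: "det (u * transpose_mat v - u * w * v' * transpose_mat u) \<noteq> 0"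
  shows "runs (arc_prog q c U V W V' A A') m (12 * \<kappa>) (\<lambda>m' (G, N', r).
    mat_stored m' G (u * w) \<and> mat_stored m' N' N \<and>
    stored m' r (\<gamma> - 1/4 * (transpose_mat (\<alpha> - u * w * \<alpha>') * N * (\<alpha> - u * w * \<alpha>')) $$ (0, 0)))"
proof -
  have d0: "0 < d" using d_pos by simp
  \<comment> \<open>Twelve operations, in the nested shape that the step rules consume.\<close>
  have "12 * \<kappa> = \<kappa> + (\<kappa> + (\<kappa> + (\<kappa> + (\<kappa> + (\<kappa> + (\<kappa> + (\<kappa> + (\<kappa> + (\<kappa> + (\<kappa> + (\<kappa> + 0)))))))))))" by simp
  then show ?thesis
    unfolding arc_prog_def N
    apply (elim ssubst)
    apply (rule step_mult, rule K, (rule known_intros)+)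
    apply (rule step_mult, assumption, (rule known_intros)+)
    apply (rule step_mult, assumption, (rule known_intros)+)
    apply (rule step_mult, assumption, (rule known_intros)+)
    apply (rule step_minus, assumption, (rule known_intros)+)
    apply (rule step_inv, assumption, (rule known_intros)+, rule det)
    apply (rule step_mult, assumption, (rule known_intros)+)
    apply (rule step_minus, assumption, (rule known_intros)+)
    apply (rule step_mult, assumption, (rule known_intros)+)
    apply (rule step_mult, assumption, (rule known_intros)+)
    apply (rule step_arith, rule knows_entry[OF _ _ d0 d0], assumption, rule known_here, (rule insertI1 insertI2)+, rule arith_val.simps)
    \<comment> \<open>\<open>c\<close> is the fourth known scalar, after the new product, the entry
      of \<open>y\<close> and \<open>q\<close>.\<close>
    apply (rule step_arith, assumption, rule insertI2, rule insertI2, rule insertI2, rule insertI1, rule insertI1, rule arith_val.simps)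
    apply (rule runs_ret)
    apply (simp add: knows_def)
    done
qed

section \<open>Dynamic programming over the vertices\<close>

definition best_path :: "nat \<Rightarrow> (nat \<times> nat \<Rightarrow> real) \<Rightarrow> nat \<Rightarrow> real list \<Rightarrow> nat \<times> nat list \<Rightarrow> bool" where
  "best_path n l i m = (\<lambda>(k, q). ascending n i q \<and> stored m k (path_cost n l i q) \<and>
     (\<forall>q'. ascending n i q' \<longrightarrow> path_cost n l i q \<le> path_cost n l i q'))"

lemma best_path_prefix: "best_path n l i m x \<Longrightarrow> prefix m m' \<Longrightarrow> best_path n l i m' x"
  by (auto simp: best_path_def intro: stored_prefix)

text \<open>\<open>x\<close> and \<open>D j\<close> pair the address of a cost with the path itself,
  which exists only in the logic: the Boolean \<open>b\<close> differs between the two branches of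
  the tree, so each branch knows its own path.\<close>

fun improve :: "(nat \<times> nat \<Rightarrow> nat) \<Rightarrow> (nat \<Rightarrow> nat \<times> nat list) \<Rightarrow> nat \<Rightarrow> nat list \<Rightarrow>
    nat \<times> nat list \<Rightarrow> (nat \<times> nat list) comp" where
  "improve la D i [] x = ret x"
| "improve la D i (j # js) x = bind (arith Plus (la (i, j)) (fst (D j))) (\<lambda>k.
     bind (if_le k (fst x)) (\<lambda>b. improve la D i js (if b then (k, j # snd (D j)) else x)))"

text \<open>One addition and one comparison per successor. From \<open>j\<close> only the best
  continuation is tried; since it dominates all others, the bound holds for every \<open>q\<close>
  from \<open>j\<close>.\<close>

lemma runs_improve:
  assumes "\<And>j. j \<in> set js \<Longrightarrow> i < j \<and> j \<le> n \<and> best_path n l j m (D j) \<and> stored m (la (i, j)) (l (i, j))"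
    and "ascending n i (snd x)" "stored m (fst x) (path_cost n l i (snd x))"
  shows "runs (improve la D i js x) m (2 * length js) (\<lambda>m' y.
    ascending n i (snd y) \<and> stored m' (fst y) (path_cost n l i (snd y)) \<and>
    path_cost n l i (snd y) \<le> path_cost n l i (snd x) \<and>
    (\<forall>j \<in> set js. \<forall>q. ascending n j q \<longrightarrow> path_cost n l i (snd y) \<le> l (i, j) + path_cost n l j q))"
  using assms
proof (induction js arbitrary: x m)
  case Nil
  then show ?case by (auto intro: runs_ret)
next
  case (Cons j js)
  have j: "i < j" "j \<le> n" and D: "best_path n l j m (D j)" and la: "stored m (la (i, j)) (l (i, j))"
    using Cons.prems(1)[of j] by auto
  let ?q = "snd (D j)"
  have Dj: "ascending n j ?q" "stored m (fst (D j)) (path_cost n l j ?q)"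
    "\<And>q. ascending n j q \<Longrightarrow> path_cost n l j ?q \<le> path_cost n l j q"
    using D by (auto simp: best_path_def split: prod.splits)
  have jq: "ascending n i (j # ?q)" using j Dj(1) by (simp add: ascending_Cons)
  show ?case unfolding improve.simps
  proof (rule runs_bind[where ?t1.0 = 1 and ?t2.0 = "1 + 2 * length js"])
    show "runs (arith Plus (la (i, j)) (fst (D j))) m 1
        (\<lambda>m' k. stored m' k (path_cost n l i (j # ?q)))"
      by (rule runs_arith[OF la Dj(2)]) auto
    fix m1 k assume 1: "prefix m m1" "stored m1 k (path_cost n l i (j # ?q))"
    have x1: "stored m1 (fst x) (path_cost n l i (snd x))"
      using stored_prefix[OF Cons.prems(3) 1(1)] .
    show "runs (bind (if_le k (fst x)) (\<lambda>b. improve la D i js (if b then (k, j # ?q) else x)))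
      m1 (1 + 2 * length js) (\<lambda>m' y.
        ascending n i (snd y) \<and> stored m' (fst y) (path_cost n l i (snd y)) \<and>
        path_cost n l i (snd y) \<le> path_cost n l i (snd x) \<and>
        (\<forall>j \<in> set (j # js). \<forall>q. ascending n j q \<longrightarrow> path_cost n l i (snd y) \<le> l (i, j) + path_cost n l j q))"
    proof (rule runs_bind[OF runs_if_le[OF 1(2) x1 order_refl] _ order_refl])
      fix m2 b assume 2: "prefix m1 m2" and b: "b = (path_cost n l i (j # ?q) \<le> path_cost n l i (snd x))"
      let ?x = "if b then (k, j # ?q) else x"
      have m2: "prefix m m2" using 1(1) 2 by (rule prefix_order.trans)
      have "runs (improve la D i js ?x) m2 (2 * length js) (\<lambda>m' y.
        ascending n i (snd y) \<and> stored m' (fst y) (path_cost n l i (snd y)) \<and>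
        path_cost n l i (snd y) \<le> path_cost n l i (snd ?x) \<and>
        (\<forall>j \<in> set js. \<forall>q. ascending n j q \<longrightarrow> path_cost n l i (snd y) \<le> l (i, j) + path_cost n l j q))"
      proof (rule Cons.IH)
        show "i < j' \<and> j' \<le> n \<and> best_path n l j' m2 (D j') \<and> stored m2 (la (i, j')) (l (i, j'))"
          if "j' \<in> set js" for j'
          using Cons.prems(1)[of j'] that m2 by (auto intro: best_path_prefix stored_prefix)
        show "ascending n i (snd ?x)" using jq Cons.prems(2) by simp
        show "stored m2 (fst ?x) (path_cost n l i (snd ?x))"
          using stored_prefix[OF 1(2) 2] stored_prefix[OF x1 2] by simp
      qed
      then show "runs (improve la D i js ?x) m2 (2 * length js) (\<lambda>m' y.
        ascending n i (snd y) \<and> stored m' (fst y) (path_cost n l i (snd y)) \<and>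
        path_cost n l i (snd y) \<le> path_cost n l i (snd x) \<and>
        (\<forall>j \<in> set (j # js). \<forall>q. ascending n j q \<longrightarrow> path_cost n l i (snd y) \<le> l (i, j) + path_cost n l j q))"
      proof (rule runs_mono[OF _ order_refl])
        fix m' y
        assume y: "ascending n i (snd y) \<and> stored m' (fst y) (path_cost n l i (snd y)) \<and>
          path_cost n l i (snd y) \<le> path_cost n l i (snd ?x) \<and>
          (\<forall>j \<in> set js. \<forall>q. ascending n j q \<longrightarrow> path_cost n l i (snd y) \<le> l (i, j) + path_cost n l j q)"
        have le: "path_cost n l i (snd ?x) \<le> path_cost n l i (snd x)"
          "path_cost n l i (snd ?x) \<le> path_cost n l i (j # ?q)"
          unfolding b by auto
        have "path_cost n l i (snd y) \<le> l (i, j) + path_cost n l j q" if "ascending n j q" for q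
          using y le(2) Dj(3)[OF that] by simp
        then show "ascending n i (snd y) \<and> stored m' (fst y) (path_cost n l i (snd y)) \<and>
          path_cost n l i (snd y) \<le> path_cost n l i (snd x) \<and>
          (\<forall>j \<in> set (j # js). \<forall>q. ascending n j q \<longrightarrow> path_cost n l i (snd y) \<le> l (i, j) + path_cost n l j q)"
          using y le(1) by auto
      qed
    qed
  qed simp
qed

fun best_paths :: "nat \<Rightarrow> (nat \<times> nat \<Rightarrow> nat) \<Rightarrow> nat \<Rightarrow> (nat \<Rightarrow> nat \<times> nat list) comp" where
  "best_paths n la 0 = ret (\<lambda>_. undefined)"
| "best_paths n la (Suc k) = bind (best_paths n la k) (\<lambda>D.
     bind (improve la D (n - k) [n - k + 1..<n + 1] (la (n - k, n + 1), []))
       (\<lambda>x. ret (D(n - k := x))))"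

text \<open>Vertices are settled in the order n, n - 1, ..., 0. The condition
  \<open>n < i + k\<close> is i > n - k without truncated subtraction, so \<open>k = n + 1\<close>
  includes vertex 0.\<close>

lemma runs_best_paths:
  assumes la: "\<And>i j. i < j \<Longrightarrow> j \<le> n + 1 \<Longrightarrow> stored m (la (i, j)) (l (i, j))" and k: "k \<le> n + 1"
  shows "runs (best_paths n la k) m (k * (2 * n)) (\<lambda>m' D. \<forall>i \<le> n. n < i + k \<longrightarrow> best_path n l i m' (D i))"
  using k
proof (induction k)
  case 0
  then show ?case by (auto intro: runs_ret)
next
  case (Suc k)
  let ?i = "n - k"
  show ?case unfolding best_paths.simps
  proof (rule runs_bind[OF Suc.IH])
    fix m1 D assume 1: "prefix m m1" "\<forall>i \<le> n. n < i + k \<longrightarrow> best_path n l i m1 (D i)"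
    have la1: "stored m1 (la (i, j)) (l (i, j))" if "i < j" "j \<le> n + 1" for i j
      using stored_prefix[OF la[OF that] 1(1)] .
    show "runs (bind (improve la D ?i [?i + 1..<n + 1] (la (?i, n + 1), [])) (\<lambda>x. ret (D(?i := x))))
       m1 (2 * n) (\<lambda>m' D. \<forall>i \<le> n. n < i + Suc k \<longrightarrow> best_path n l i m' (D i))"
    proof (rule runs_bind[OF runs_improve])
      show "?i < j \<and> j \<le> n \<and> best_path n l j m1 (D j) \<and> stored m1 (la (?i, j)) (l (?i, j))"
        if "j \<in> set [?i + 1..<n + 1]" for j
        using that 1(2) la1[of ?i j] by auto
      show "ascending n ?i (snd (la (?i, n + 1), []))" by (simp add: ascending_Nil)
      show "stored m1 (fst (la (?i, n + 1), [])) (path_cost n l ?i (snd (la (?i, n + 1), [])))"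
        using la1[of ?i "n + 1"] by simp
      fix m2 y
      assume 2: "prefix m1 m2" and y: "ascending n ?i (snd y) \<and> stored m2 (fst y) (path_cost n l ?i (snd y)) \<and>
        path_cost n l ?i (snd y) \<le> path_cost n l ?i (snd (la (?i, n + 1), [])) \<and>
        (\<forall>j \<in> set [?i + 1..<n + 1]. \<forall>q. ascending n j q \<longrightarrow> path_cost n l ?i (snd y) \<le> l (?i, j) + path_cost n l j q)"
      \<comment> \<open>The direct arc to the sink was the initial candidate; any other path is
        covered through its first inner vertex.\<close>
      have "path_cost n l ?i (snd y) \<le> path_cost n l ?i q" if q: "ascending n ?i q" for q
      proof (cases q)
        case Nil
        then show ?thesis using y by simp
      next
        case (Cons j q')
        then have "j \<in> set [?i + 1..<n + 1]" "ascending n j q'" using q by (auto simp: ascending_Cons)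
        then have "path_cost n l ?i (snd y) \<le> l (?i, j) + path_cost n l j q'" using y by blast
        then show ?thesis using Cons by simp
      qed
      then have "best_path n l ?i m2 y" using y by (auto simp: best_path_def split: prod.splits)
      moreover have "best_path n l i m2 (D i)" if "i \<le> n" "n < i + k" for i
        using 1(2) that 2 by (auto intro: best_path_prefix)
      ultimately have upd: "\<forall>i \<le> n. n < i + Suc k \<longrightarrow> best_path n l i m2 ((D(?i := y)) i)"
        by (auto simp: less_Suc_eq)
      show "runs (ret (D(?i := y))) m2 0 (\<lambda>m' D. \<forall>i \<le> n. n < i + Suc k \<longrightarrow> best_path n l i m' (D i))"
        by (rule runs_ret) (rule upd)
    qed (use Suc.prems in simp)
  qed (use Suc.prems in simp_all)
qed

section \<open>Memory layout and assembly of the program\<close>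

definition const_mat :: "nat \<Rightarrow> nat mat" where
  "const_mat z = mat d d (\<lambda>_. z)"

definition unit_mat :: "nat \<Rightarrow> nat \<Rightarrow> nat mat" where
  "unit_mat z e = mat d d (\<lambda>(r, s). if r = s then e else z)"

text \<open>The product \<open>F M\<^sup>-\<^sup>1 F\<^sup>T\<close> is nonzero only in the block positions \<open>{i, j} \<times> {i, j}\<close>, so four
  blocks are updated for each arc \<open>(i, j)\<close> of the path.\<close>

fun inverse_blocks :: "nat \<Rightarrow> nat \<Rightarrow> nat \<Rightarrow> (nat \<times> nat \<Rightarrow> nat mat \<times> nat mat \<times> nat) \<Rightarrow> nat list \<Rightarrow>
    (nat \<Rightarrow> nat \<Rightarrow> nat mat) comp" where
  "inverse_blocks n z e T [] = ret (\<lambda>_ _. const_mat z)"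
| "inverse_blocks n z e T (i # q) = bind (inverse_blocks n z e T q) (\<lambda>B.
     let j = next_vertex n q; G = fst (T (i, j)); N = fst (snd (T (i, j))) in
     bind (mat_arith d Minus (const_mat z) (transpose_mat G)) (\<lambda>H.
     let F = (\<lambda>b. if b = i then unit_mat z e else H) in
     bind (tab (\<lambda>(b, b'). bind (mmul (F b) N) (\<lambda>X. bind (mmul X (transpose_mat (F b'))) (\<lambda>Y.
         bind (mat_arith d Plus Y (B b b')) ret))) [(i, i), (i, j), (j, i), (j, j)]) (\<lambda>B'.
     ret (\<lambda>b b'. if b \<in> {i, j} \<and> b' \<in> {i, j} then B' (b, b') else B b b'))))"

text \<open>The offsets here and below mirror \<open>problem_input\<close>: all matrices U, all
  matrices V, then \<open>a\<close> and \<open>c\<close>.\<close>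

definition U_addr :: "nat \<Rightarrow> nat mat" where
  "U_addr i = mat d d (\<lambda>(r, s). (i - 1) * (d * d) + (r * d + s))"

definition V_addr :: "nat \<Rightarrow> nat \<Rightarrow> nat mat" where
  "V_addr n i = mat d d (\<lambda>(r, s). n * (d * d) + ((i - 1) * (d * d) + (r * d + s)))"

definition a_addr :: "nat \<Rightarrow> nat \<Rightarrow> nat \<Rightarrow> nat mat" where
  "a_addr n z i = mat d d (\<lambda>(r, s). if s = 0 then n * (d * d) + (n * (d * d) + ((i - 1) * d + r)) else z)"

definition c_addr :: "nat \<Rightarrow> nat \<Rightarrow> nat" where
  "c_addr n i = n * (d * d) + (n * (d * d) + (d * n + (i - 1)))"

text \<open>Each U_j is inverted once, not once per arc. For arcs into the sink, zero matrices stand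
  for U_j^-1, V_j and block \<open>j\<close> of \<open>a\<close>, so \<open>arc_prog\<close> covers
  both cases.\<close>

definition arc_table :: "nat \<Rightarrow> nat \<Rightarrow> nat \<Rightarrow> (nat \<times> nat \<Rightarrow> nat mat \<times> nat mat \<times> nat) comp" where
  "arc_table n z q = bind (tab (\<lambda>j. minv (U_addr j)) [1..<n + 1]) (\<lambda>W.
     tab (\<lambda>(i, j). if j = n + 1
         then arc_prog q (c_addr n i) (U_addr i) (V_addr n i) (const_mat z) (const_mat z)
           (a_addr n z i) (const_mat z)
         else arc_prog q (c_addr n i) (U_addr i) (V_addr n i) (W j) (V_addr n j)
           (a_addr n z i) (a_addr n z j))
       (filter (\<lambda>(i, j). i < j) (List.product [1..<n + 1] [2..<n + 2])))"

text \<open>Blocks of W are computed only for the optimal path, once it is known. The entries of the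
  indicator vector and of the untouched blocks are addresses of the constants 0 and 1.\<close>

definition solve :: "nat \<Rightarrow> nat list comp" where
  "solve n = bind (load 0) (\<lambda>z. bind (load 1) (\<lambda>e. bind (load (1/4)) (\<lambda>q.
     bind (arc_table n z q) (\<lambda>T.
     bind (best_paths n (\<lambda>(i, j). if i = 0 then z else snd (snd (T (i, j)))) (n + 1)) (\<lambda>D.
     bind (inverse_blocks n z e T (snd (D 0))) (\<lambda>B.
     ret (fst (D 0) # map (\<lambda>k. if k + 1 \<in> set (snd (D 0)) then e else z) [0..<n] @
       concat (mat_to_list (mat (d * n) (d * n) (\<lambda>(r, s).
         B (r div d + 1) (s div d + 1) $$ (r mod d, s mod d)))))))))))"

lemma mat_stored_const: "stored m z 0 \<Longrightarrow> mat_stored m (const_mat z) (0\<^sub>m d d)"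
  by (simp add: mat_stored_def const_mat_def)

lemma mat_stored_unit: "stored m z 0 \<Longrightarrow> stored m e 1 \<Longrightarrow> mat_stored m (unit_mat z e) (1\<^sub>m d)"
  by (simp add: mat_stored_def unit_mat_def)

end

section \<open>Correctness and cost of the algorithm\<close>

lemma length_problem_input:
  assumes "block_factorizable d n U V Q" "a \<in> carrier_vec (d * n)" "c \<in> carrier_vec n"
  shows "length (problem_input n U V a c) = n * (d * d) + (n * (d * d) + (d * n + n))"
proof -
  have "length (concat (map (\<lambda>i. entries (X i)) [1..<n + 1])) = n * (d * d)"
    if "\<forall>i \<in> {1..n}. X i \<in> carrier_mat d d" for X :: "nat \<Rightarrow> real mat"
  proof (subst length_concat_uniform[of _ "d * d"])
    show "\<forall>xs \<in> set (map (\<lambda>i. entries (X i)) [1..<n + 1]). length xs = d * d"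
      using that by (auto intro: length_entries)
  qed simp
  then show ?thesis using assms by (simp add: problem_input_def block_factorizable_def)
qed

lemma nth_concat_entries:
  assumes "\<forall>i \<in> {1..n}. X i \<in> carrier_mat d d" "i \<in> {1..n}" "r < d" "s < d"
  shows "concat (map (\<lambda>i. entries (X i)) [1..<n + 1]) ! ((i - 1) * (d * d) + (r * d + s)) = X i $$ (r, s)"
    and "(i - 1) * (d * d) + (r * d + s) < length (concat (map (\<lambda>i. entries (X i)) [1..<n + 1]))"
proof -
  have len: "\<forall>xs \<in> set (map (\<lambda>i. entries (X i)) [1..<n + 1]). length xs = d * d"
    using assms(1) by (auto intro: length_entries)
  have rs: "r * d + s < d * d" using index_less_mult[OF assms(3,4)] .
  have "concat (map (\<lambda>i. entries (X i)) [1..<n + 1]) ! ((i - 1) * (d * d) + (r * d + s))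
      = map (\<lambda>i. entries (X i)) [1..<n + 1] ! (i - 1) ! (r * d + s)"
    by (rule nth_concat_uniform[OF len _ rs]) (use assms(2) in auto)
  also have "\<dots> = entries (X i) ! (r * d + s)" 
    using assms(2) nth_upt[of 1 "i - 1" "n + 1"] by (subst nth_map) (auto simp del: upt_Suc)
  also have "\<dots> = X i $$ (r, s)" using assms by (intro nth_entries) auto
  finally show "concat (map (\<lambda>i. entries (X i)) [1..<n + 1]) ! ((i - 1) * (d * d) + (r * d + s)) = X i $$ (r, s)" .
  show "(i - 1) * (d * d) + (r * d + s) < length (concat (map (\<lambda>i. entries (X i)) [1..<n + 1]))"
    unfolding length_concat_uniform[OF len]
    using index_less_mult[OF _ rs, of "i - 1" n] assms(2) by auto
qed

lemma stored_append:
  "stored (xs @ ys) (length xs + k) x \<longleftrightarrow> stored ys k x"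
  "k < length xs \<Longrightarrow> stored (xs @ ys) k x \<longleftrightarrow> stored xs k x"
  by (auto simp: stored_def nth_append)

locale algorithm = block_programs d Pm Pi + pd_factorizable d n U V Q
  for d n :: nat and Pm Pi :: program and U V :: "nat \<Rightarrow> real mat" and Q :: "real mat" +
  fixes a c :: "real vec"
  assumes a: "a \<in> carrier_vec (d * n)" and c: "c \<in> carrier_vec n"
begin

abbreviation cost :: "nat \<times> nat \<Rightarrow> real" where
  "cost \<equiv> arc_cost d n U V a c"

lemma input_stored:
  assumes m: "prefix (problem_input n U V a c) m" and i: "i \<in> {1..n}"
  shows "mat_stored m (U_addr i) (U i)" "mat_stored m (V_addr n i) (V i)"
    "stored m (c_addr n i) (c $ (i - 1))"
    "stored m z 0 \<Longrightarrow> mat_stored m (a_addr n z i) (vec_block a i)"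
proof -
  let ?Us = "concat (map (\<lambda>i. entries (U i)) [1..<n + 1])"
  let ?Vs = "concat (map (\<lambda>i. entries (V i)) [1..<n + 1])"
  have Us: "\<forall>i \<in> {1..n}. U i \<in> carrier_mat d d" and Vs: "\<forall>i \<in> {1..n}. V i \<in> carrier_mat d d"
    using UV by auto
  have lenU: "length ?Us = n * (d * d)" and lenV: "length ?Vs = n * (d * d)"
    by (subst length_concat_uniform[of _ "d * d"]; use UV in \<open>auto intro: length_entries\<close>)+
  obtain ys where "m = problem_input n U V a c @ ys" using m by (auto simp: prefix_def)
  then have meq: "m = ?Us @ ?Vs @ list_of_vec a @ list_of_vec c @ ys" by (simp add: problem_input_def)
  have st: "stored m k x" if "stored ?Us k x" for k x
    using that unfolding meq by (auto simp: stored_def nth_append)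
  have st2: "stored m (n * (d * d) + k) x" if "stored ?Vs k x" for k x
    using that unfolding meq lenU[symmetric] stored_append by (auto simp: stored_def nth_append)
  have "stored m ((i - 1) * (d * d) + (r * d + s)) (U i $$ (r, s))" if "r < d" "s < d" for r s
    using nth_concat_entries[OF Us i that] by (intro st) (simp add: stored_def)
  then show "mat_stored m (U_addr i) (U i)"
    using i by (simp add: mat_stored_def U_addr_def)
  have "stored m (n * (d * d) + ((i - 1) * (d * d) + (r * d + s))) (V i $$ (r, s))" if "r < d" "s < d" for r s
    using nth_concat_entries[OF Vs i that] by (intro st2) (simp add: stored_def)
  then show "mat_stored m (V_addr n i) (V i)"
    using i by (simp add: mat_stored_def V_addr_def)
  have st3: "stored m (n * (d * d) + (n * (d * d) + k)) x" if "stored (list_of_vec a @ list_of_vec c @ ys) k x" for k x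
    using that unfolding meq by (simp only: stored_append(1)[of ?Us, unfolded lenU] stored_append(1)[of ?Vs, unfolded lenV])
  have "stored (list_of_vec a @ list_of_vec c @ ys) (length (list_of_vec a) + (i - 1)) (c $ (i - 1))"
    unfolding stored_append using c i by (auto simp: stored_def nth_append)
  then show "stored m (c_addr n i) (c $ (i - 1))"
    unfolding c_addr_def using a by (intro st3) simp
  have "stored m (n * (d * d) + (n * (d * d) + ((i - 1) * d + r))) (a $ ((i - 1) * d + r))" if "r < d" for r
    using block_index_less[OF i that] a by (intro st3) (simp add: stored_def nth_append)
  then show "mat_stored m (a_addr n z i) (vec_block a i)" if "stored m z 0"
    using that i by (auto simp: mat_stored_def a_addr_def vec_block_def)
qed

lemma vec_block_carrier: "vec_block a i \<in> carrier_mat d d"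
  by (simp add: vec_block_def)

lemma arc_cost_eq:
  assumes i: "i \<in> {1..n}" and j: "j \<in> {1..n + 1}" and ij: "i < j"
  shows "c $ (i - 1) - 1/4 * (transpose_mat (vec_block a i - U i * Uinv j * vec_block a j) *
    inv_mat (M i j) * (vec_block a i - U i * Uinv j * vec_block a j)) $$ (0, 0) = cost (i, j)"
  using quadratic_form_Lambda[OF a d_pos i j ij] i by (simp add: arc_cost_def G_def)

lemma runs_arc_table:
  assumes m: "prefix (problem_input n U V a c) m" and z: "stored m z 0" and q: "stored m q (1/4)"
  shows "runs (arc_table n z q) m (n * \<kappa> + 12 * \<kappa> * (n * n)) (\<lambda>m' T.
    \<forall>i j. 1 \<le> i \<longrightarrow> i < j \<longrightarrow> j \<le> n + 1 \<longrightarrow> mat_stored m' (fst (T (i, j))) (G i j) \<and>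
      mat_stored m' (fst (snd (T (i, j)))) (inv_mat (M i j)) \<and>
      stored m' (snd (snd (T (i, j)))) (cost (i, j)))"
  unfolding arc_table_def
proof (rule runs_bind[OF _ _ order_refl])
  show "runs (tab (\<lambda>j. minv (U_addr j)) [1..<n + 1]) m (n * \<kappa>)
    (\<lambda>m' W. \<forall>j \<in> set [1..<n + 1]. mat_stored m' (W j) (Uinv j))"
  proof (rule runs_tab[where t = \<kappa>])
    fix m' j assume m': "prefix m m'" and "j \<in> set [1..<n + 1]"
    then have j: "j \<in> {1..n}" by auto
    have "runs (minv (U_addr j)) m' \<kappa> (\<lambda>m'' C. mat_stored m'' C (inv_mat (U j)))"
      using UV(1)[OF j] det_U_nonzero[OF j] mat_stored_prefix[OF input_stored(1)[OF m j] m']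
      by (rule runs_inv)
    then show "runs (minv (U_addr j)) m' \<kappa> (\<lambda>m'' C. mat_stored m'' C (Uinv j))"
      using j by (simp add: Uinv_def)
  qed (auto intro: mat_stored_prefix)
next
  fix m1 W assume m1: "prefix m m1" and W: "\<forall>j \<in> set [1..<n + 1]. mat_stored m1 (W j) (Uinv j)"
  let ?prog = "\<lambda>(i, j). if j = n + 1
         then arc_prog q (c_addr n i) (U_addr i) (V_addr n i) (const_mat z) (const_mat z)
           (a_addr n z i) (const_mat z)
         else arc_prog q (c_addr n i) (U_addr i) (V_addr n i) (W j) (V_addr n j)
           (a_addr n z i) (a_addr n z j)"
  let ?arcs = "filter (\<lambda>(i, j). i < j) (List.product [1..<n + 1] [2..<n + 2])"
  let ?R = "\<lambda>(i, j) m' (g, N, r). mat_stored m' g (G i j) \<and> mat_stored m' N (inv_mat (M i j)) \<and>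
      stored m' r (cost (i, j))"
  have "runs (tab ?prog ?arcs) m1 (12 * \<kappa> * (n * n)) (\<lambda>m' T. \<forall>p \<in> set ?arcs. ?R p m' (T p))"
  proof (rule runs_tab[where t = "12 * \<kappa>"])
    fix m' p assume m': "prefix m1 m'" and "p \<in> set ?arcs"
    then obtain i j where p: "p = (i, j)" and i: "i \<in> {1..n}" and j: "j \<in> {1..n + 1}" and ij: "i < j"
      by auto
    have mm': "prefix m m'" using m1 m' by (rule prefix_order.trans)
    then have pm': "prefix (problem_input n U V a c) m'" using m prefix_order.trans by blast
    have z': "stored m' z 0" and q': "stored m' q (1/4)"
      using stored_prefix[OF z mm'] stored_prefix[OF q mm'] .
    note in_i = input_stored[OF pm' i]
    \<comment> \<open>Gathers the three arguments that differ between arcs into the sink and all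
      others, so both branches are verified at once.\<close>
    define A where "A = (if j = n + 1 then (const_mat z, const_mat z, const_mat z)
      else (W j, V_addr n j, a_addr n z j))"
    have A: "mat_stored m' (fst A) (Uinv j)" "mat_stored m' (fst (snd A)) (V0 j)"
      "mat_stored m' (snd (snd A)) (vec_block a j)"
    proof -
      have "mat_stored m' (fst A) (Uinv j) \<and> mat_stored m' (fst (snd A)) (V0 j) \<and>
        mat_stored m' (snd (snd A)) (vec_block a j)"
      proof (cases "j = n + 1")
        case True
        then show ?thesis using mat_stored_const[OF z'] by (simp add: A_def Uinv_def V0_def vec_block_def)
      next
        case False
        then have j: "j \<in> {1..n}" using j by auto
        then have "j \<in> set [1..<n + 1]" by auto
        with W have "mat_stored m1 (W j) (Uinv j)" by blast
        then have "mat_stored m' (W j) (Uinv j)" by (rule mat_stored_prefix[OF _ m'])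
        then show ?thesis using False input_stored[OF pm' j] z' by (simp add: A_def V0_def)
      qed
      then show "mat_stored m' (fst A) (Uinv j)" "mat_stored m' (fst (snd A)) (V0 j)"
        "mat_stored m' (snd (snd A)) (vec_block a j)" by auto
    qed
    have V0: "V0 j \<in> carrier_mat d d" using j by (intro carrier_matI) auto
    have K: "knows d m' {(U_addr i, U i), (V_addr n i, V i), (fst A, Uinv j), (fst (snd A), V0 j),
        (a_addr n z i, vec_block a i), (snd (snd A), vec_block a j)} {(q, 1/4), (c_addr n i, c $ (i - 1))}"
      using in_i(1,2,3) in_i(4)[OF z'] A q' UV[OF i] Uinv_carrier[OF j] V0 vec_block_carrier
      by (simp add: knows_def)
    have "runs (arc_prog q (c_addr n i) (U_addr i) (V_addr n i) (fst A) (fst (snd A)) (a_addr n z i) (snd (snd A)))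
       m' (12 * \<kappa>) (?R (i, j))"
      using runs_arc_prog[OF K refl] det_M_nonzero[OF i j ij] arc_cost_eq[OF i j ij]
      by (simp add: G_def M_def)
    then show "runs (?prog p) m' (12 * \<kappa>) (?R p)"
      by (simp add: p A_def split: if_splits)
  next
    have "length ?arcs \<le> n * n"
      using length_filter_le[of "\<lambda>(i, j). i < j" "List.product [1..<n + 1] [2..<n + 2]"]
      by (simp add: length_product del: upt_Suc)
    then show "12 * \<kappa> * length ?arcs \<le> 12 * \<kappa> * (n * n)" by (rule mult_le_mono2)
  qed (auto intro: mat_stored_prefix stored_prefix)
  then show "runs (tab ?prog ?arcs) m1 (12 * \<kappa> * (n * n)) (\<lambda>m' T.
    \<forall>i j. 1 \<le> i \<longrightarrow> i < j \<longrightarrow> j \<le> n + 1 \<longrightarrow> mat_stored m' (fst (T (i, j))) (G i j) \<and>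
      mat_stored m' (fst (snd (T (i, j)))) (inv_mat (M i j)) \<and>
      stored m' (snd (snd (T (i, j)))) (cost (i, j)))"
  proof (rule runs_mono[OF _ order_refl], intro allI impI)
    fix m' T i j assume T: "\<forall>p \<in> set ?arcs. ?R p m' (T p)" and ij: "1 \<le> i" "i < j" "j \<le> n + 1"
    then have "(i, j) \<in> set ?arcs" by auto
    with T have "?R (i, j) m' (T (i, j))" by blast
    then show "mat_stored m' (fst (T (i, j))) (G i j) \<and>
      mat_stored m' (fst (snd (T (i, j)))) (inv_mat (M i j)) \<and>
      stored m' (snd (snd (T (i, j)))) (cost (i, j))" by (simp split: prod.splits)
  qed
qed

abbreviation inv_block :: "nat list \<Rightarrow> nat \<Rightarrow> nat \<Rightarrow> real mat" where
  "inv_block q b b' \<equiv> transpose_mat (E b) * (Lambda_sum q * E b')"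

lemma inv_block_carrier: "inv_block q b b' \<in> carrier_mat d d"
  by (intro carrier_matI) auto

lemma inv_block_Cons:
  assumes b: "b \<in> {1..n + 1}" "b' \<in> {1..n + 1}" and i: "i \<in> {1..n}"
    and j: "next_vertex n q \<in> {1..n + 1}" and ij: "i < next_vertex n q"
  shows "inv_block (i # q) b b' = transpose_mat (E b) * F i (next_vertex n q) * inv_mat (M i (next_vertex n q)) *
      transpose_mat (transpose_mat (E b') * F i (next_vertex n q)) + inv_block q b b'"
  unfolding Lambda_block[OF b i j ij, symmetric]
  by (simp add: mat_simps add_mult_distrib_mat_dim)

text \<open>One of the two block rows of \<open>F\<close> is zero and kills the product, either from
  the left or, transposed, from the right.\<close>

lemma inv_block_Cons_other:
  assumes b: "b \<in> {1..n + 1}" "b' \<in> {1..n + 1}" and i: "i \<in> {1..n}"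
    and j: "next_vertex n q \<in> {1..n + 1}" and ij: "i < next_vertex n q"
    and other: "\<not> (b \<in> {i, next_vertex n q} \<and> b' \<in> {i, next_vertex n q})"
  shows "inv_block (i # q) b b' = inv_block q b b'"
proof -
  let ?j = "next_vertex n q"
  note N = inv_M(1)[OF i j ij]
  have F: "transpose_mat (E b) * F i ?j \<in> carrier_mat d d" for b using i by (intro carrier_matI) auto
  have "transpose_mat (E b) * F i ?j * inv_mat (M i ?j) * transpose_mat (transpose_mat (E b') * F i ?j) = 0\<^sub>m d d"
  proof (cases "b \<in> {i, ?j}")
    case True
    then have "transpose_mat (E b') * F i ?j = 0\<^sub>m d d"
      using other block_row_of_F_extended[OF b(2) i j ij] by auto
    moreover have "transpose_mat (0\<^sub>m d d) = (0\<^sub>m d d :: real mat)" by (rule eq_matI) auto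
    ultimately show ?thesis using F[of b] N by (simp add: right_mult_zero_mat[of _ d d])
  next
    case False
    then have "transpose_mat (E b) * F i ?j = 0\<^sub>m d d"
      using block_row_of_F_extended[OF b(1) i j ij] by auto
    moreover have "0\<^sub>m d d * inv_mat (M i ?j) = 0\<^sub>m d d" using N by (rule left_mult_zero_mat)
    moreover have "0\<^sub>m d d * transpose_mat (transpose_mat (E b') * F i ?j) = 0\<^sub>m d d"
      using F[of b'] by (intro left_mult_zero_mat) auto
    ultimately show ?thesis by simp
  qed
  then show ?thesis
    unfolding inv_block_Cons[OF b i j ij] using inv_block_carrier by (simp only: left_add_zero_mat)
qed

text \<open>Per vertex of the path there is one subtraction to negate the transposed multiplier, and
  for each of four blocks two multiplications and one addition: 13 operations. Block indices run to
  \<open>n + 1\<close> so that the last arc is no special case; \<open>mat_stored_assemble\<close>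
  drops the extra blocks.\<close>

lemma runs_inverse_blocks:
  assumes T: "\<And>i j. 1 \<le> i \<Longrightarrow> i < j \<Longrightarrow> j \<le> n + 1 \<Longrightarrow> mat_stored m (fst (T (i, j))) (G i j) \<and>
      mat_stored m (fst (snd (T (i, j)))) (inv_mat (M i j))"
    and z: "stored m z 0" and e: "stored m e 1" and q: "ascending n i0 q"
  shows "runs (inverse_blocks n z e T q) m (13 * \<kappa> * length q)
    (\<lambda>m' B. \<forall>b \<in> {1..n + 1}. \<forall>b' \<in> {1..n + 1}. mat_stored m' (B b b') (inv_block q b b'))"
  using q
proof (induction q arbitrary: i0)
  case Nil
  have "inv_block [] b b' = 0\<^sub>m d d" for b b'
  proof -
    have "0\<^sub>m (d * n) (d * n) * E b' = 0\<^sub>m (d * n) d" by (rule left_mult_zero_mat[OF block_column_carrier])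
    moreover have "transpose_mat (E b) * 0\<^sub>m (d * n) d = 0\<^sub>m d d"
      by (rule right_mult_zero_mat) (simp add: carrier_matI)
    ultimately show ?thesis by simp
  qed
  then show ?case using mat_stored_const[OF z] by (auto intro: runs_ret)
next
  case (Cons i q)
  have q: "ascending n i q" and i: "i \<in> {1..n}" using Cons.prems by (auto simp: ascending_Cons)
  define j where "j = next_vertex n q"
  have j: "j \<in> {1..n + 1}" and ij: "i < j" using ascending_next_vertex_mem[OF q i] by (auto simp: j_def)
  define g N where "g = fst (T (i, j))" and "N = fst (snd (T (i, j)))"
  let ?N = "inv_mat (M i j)"
  let ?F = "\<lambda>b. transpose_mat (E b) * F i j"
  have Gc: "G i j \<in> carrier_mat d d" using i j by (intro carrier_matI) auto
  then have Hc: "0\<^sub>m d d - transpose_mat (G i j) \<in> carrier_mat d d" by (intro minus_carrier_mat) auto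
  show ?case unfolding inverse_blocks.simps Let_def j_def[symmetric] g_def[symmetric] N_def[symmetric]
  proof (rule runs_bind[OF Cons.IH[OF q]])
    fix m1 B assume m1: "prefix m m1"
      and B: "\<forall>b \<in> {1..n + 1}. \<forall>b' \<in> {1..n + 1}. mat_stored m1 (B b b') (inv_block q b b')"
    have "mat_stored m1 g (G i j)" "mat_stored m1 N ?N"
      using T[of i j] i j ij by (auto simp: g_def N_def intro: mat_stored_prefix[OF _ m1])
    then have K1: "knows d m1 {(const_mat z, 0\<^sub>m d d), (g, G i j), (unit_mat z e, 1\<^sub>m d), (N, ?N)} {}"
      using mat_stored_const[OF stored_prefix[OF z m1]] Gc inv_M(1)[OF i j ij]
        mat_stored_unit[OF stored_prefix[OF z m1] stored_prefix[OF e m1]]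
      by (simp add: knows_def)
    let ?upd = "\<lambda>H. tab (\<lambda>(b, b'). bind (mmul (if b = i then unit_mat z e else H) N) (\<lambda>X.
         bind (mmul X (transpose_mat (if b' = i then unit_mat z e else H))) (\<lambda>Y.
         bind (mat_arith d Plus Y (B b b')) ret))) [(i, i), (i, j), (j, i), (j, j)]"
    let ?R = "\<lambda>(b, b') m' X. mat_stored m' X (inv_block (i # q) b b')"
    show "runs (bind (mat_arith d Minus (const_mat z) (transpose_mat g)) (\<lambda>H. bind (?upd H) (\<lambda>B'.
        ret (\<lambda>b b'. if b \<in> {i, j} \<and> b' \<in> {i, j} then B' (b, b') else B b b'))))
      m1 (\<kappa> + 12 * \<kappa>) (\<lambda>m' B. \<forall>b \<in> {1..n + 1}. \<forall>b' \<in> {1..n + 1}.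
        mat_stored m' (B b b') (inv_block (i # q) b b'))"
    proof (rule runs_bind[OF _ _ order_refl])
      show "runs (mat_arith d Minus (const_mat z) (transpose_mat g)) m1 \<kappa>
          (\<lambda>m' H. mat_stored m' H (0\<^sub>m d d - transpose_mat (G i j)))"
      proof (rule runs_mono[OF runs_mat_arith square_le_\<kappa>])
        show "mat_stored m1 (const_mat z) (0\<^sub>m d d)" "mat_stored m1 (transpose_mat g) (transpose_mat (G i j))"
          using K1 by (auto simp: knows_def intro: mat_stored_transpose)
      qed (use Gc in auto)
      fix m2 H assume m2: "prefix m1 m2" and H: "mat_stored m2 H (0\<^sub>m d d - transpose_mat (G i j))"
      let ?K = "insert (H, 0\<^sub>m d d - transpose_mat (G i j))
        {(const_mat z, 0\<^sub>m d d), (g, G i j), (unit_mat z e, 1\<^sub>m d), (N, ?N)}"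
      have K2: "knows d m2 ?K {}"
        using knows_prefix[OF K1 m2] H Hc by (simp add: knows_def)
      \<comment> \<open>The block rows of \<open>F\<close> at \<open>i\<close> and \<open>j\<close>
        are the identity and the negated transposed multiplier, both already in memory.\<close>
      have knownF: "known ?K (if b = i then unit_mat z e else H) (?F b)" if "b \<in> {i, j}" for b
      proof (cases "b = i")
        case True
        have "?F b = 1\<^sub>m d" using block_row_of_F_extended[OF _ i j ij, of i] i True by simp
        then show ?thesis by (simp only: known_def True if_True) simp
      next
        case False
        then have "?F b = 0\<^sub>m d d - transpose_mat (G i j)"
          using block_row_of_F_extended[OF j i j ij] that ij by simp
        then show ?thesis by (simp only: False if_False known_here)
      qed
      have "runs (?upd H) m2 (12 * \<kappa>) (\<lambda>m' B'. \<forall>p \<in> set [(i, i), (i, j), (j, i), (j, j)]. ?R p m' (B' p))"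
      proof (rule runs_tab[where t = "\<kappa> + (\<kappa> + (\<kappa> + 0))"])
        fix m3 p assume m3: "prefix m2 m3" and "p \<in> set [(i, i), (i, j), (j, i), (j, j)]"
        then obtain b b' where p: "p = (b, b')" and bij: "b \<in> {i, j}" "b' \<in> {i, j}" by auto
        have b: "b \<in> {1..n + 1}" "b' \<in> {1..n + 1}" using bij i j by auto
        have "mat_stored m3 (B b b') (inv_block q b b')"
          using B b mat_stored_prefix prefix_order.trans[OF m2 m3] by blast
        then have K3: "knows d m3 (insert (B b b', inv_block q b b') ?K) {}"
          using knows_prefix[OF K2 m3] inv_block_carrier by (simp add: knows_def)
        have kF: "known ?K (transpose_mat (if b' = i then unit_mat z e else H)) (transpose_mat (?F b'))"
          using knownF[OF bij(2)] by (simp only: known_def transpose_transpose disj_commute)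
        have kN: "known ?K N ?N" by (simp add: known_def)
        show "runs ((\<lambda>(b, b'). bind (mmul (if b = i then unit_mat z e else H) N) (\<lambda>X.
            bind (mmul X (transpose_mat (if b' = i then unit_mat z e else H))) (\<lambda>Y.
            bind (mat_arith d Plus Y (B b b')) ret))) p) m3 (\<kappa> + (\<kappa> + (\<kappa> + 0))) (?R p)"
          unfolding p prod.case inv_block_Cons[OF b i j[unfolded j_def] ij[unfolded j_def], folded j_def]
        proof (rule step_mult[OF K3 known_there[OF knownF[OF bij(1)]] known_there[OF kN]],
            rule step_mult, assumption, rule known_here,
            rule known_there, rule known_there, rule kF,
            rule step_plus, assumption, rule known_here,
            rule known_there, rule known_there, rule known_here)
        qed (auto intro!: runs_ret simp: knows_def)
      qed (auto intro: mat_stored_prefix)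
      then show "runs (bind (?upd H) (\<lambda>B'. ret (\<lambda>b b'. if b \<in> {i, j} \<and> b' \<in> {i, j} then B' (b, b') else B b b')))
          m2 (12 * \<kappa>) (\<lambda>m' B. \<forall>b \<in> {1..n + 1}. \<forall>b' \<in> {1..n + 1}.
            mat_stored m' (B b b') (inv_block (i # q) b b'))"
      proof (rule runs_bind[where ?t2.0 = 0])
        fix m3 B' assume m3: "prefix m2 m3"
          and B': "\<forall>p \<in> set [(i, i), (i, j), (j, i), (j, j)]. ?R p m3 (B' p)"
        have "mat_stored m3 (if b \<in> {i, j} \<and> b' \<in> {i, j} then B' (b, b') else B b b') (inv_block (i # q) b b')"
          if b: "b \<in> {1..n + 1}" "b' \<in> {1..n + 1}" for b b'
        proof (cases "b \<in> {i, j} \<and> b' \<in> {i, j}")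
          case True
          then have "(b, b') \<in> set [(i, i), (i, j), (j, i), (j, j)]" by auto
          with B' have "?R (b, b') m3 (B' (b, b'))" by blast
          with True show ?thesis by simp
        next
          case False
          have "mat_stored m3 (B b b') (inv_block q b b')"
            using B b mat_stored_prefix prefix_order.trans[OF m2 m3] by blast
          then show ?thesis
            unfolding inv_block_Cons_other[OF b i j[unfolded j_def] ij[unfolded j_def] False[unfolded j_def]]
              if_not_P[OF False] .
        qed
        then show "runs (ret (\<lambda>b b'. if b \<in> {i, j} \<and> b' \<in> {i, j} then B' (b, b') else B b b')) m3 0
          (\<lambda>m' B. \<forall>b \<in> {1..n + 1}. \<forall>b' \<in> {1..n + 1}. mat_stored m' (B b b') (inv_block (i # q) b b'))"
          by (intro runs_ret ballI)
      qed simp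
    qed
  qed simp
qed

lemma inv_block_index:
  assumes "r < d * n" "s < d * n"
  shows "inv_block q (r div d + 1) (s div d + 1) $$ (r mod d, s mod d) = Lambda_sum q $$ (r, s)"
proof -
  have "r div d + 1 \<in> {1..n}" "s div d + 1 \<in> {1..n}"
    using assms by (auto simp: less_mult_imp_div_less mult.commute Suc_leI)
  then have "inv_block q (r div d + 1) (s div d + 1) = block d (Lambda_sum q) (r div d + 1) (s div d + 1)"
    by (subst block_eq[of _ _ n]) (auto intro: carrier_matI simp: mat_simps)
  then show ?thesis using d_pos by (simp add: block_def)
qed

lemma ascending_length: "ascending n i q \<Longrightarrow> length q \<le> n"
proof -
  assume "ascending n i q"
  then have "set q \<subseteq> {1..n}" "distinct q" by (auto simp: ascending_def strict_sorted_iff Suc_le_eq)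
  then show "length q \<le> n" using card_mono[of "{1..n}" "set q"] distinct_card[of q] by simp
qed

lemma mat_stored_assemble:
  assumes B: "\<forall>b \<in> {1..n + 1}. \<forall>b' \<in> {1..n + 1}. mat_stored m (B b b') (inv_block q b b')"
    and q: "ascending n 0 q"
  shows "mat_stored m (mat (d * n) (d * n) (\<lambda>(r, s). B (r div d + 1) (s div d + 1) $$ (r mod d, s mod d)))
    (padded_inverse d n Q (set q))"
proof -
  have "stored m (B (r div d + 1) (s div d + 1) $$ (r mod d, s mod d)) (Lambda_sum q $$ (r, s))"
    if rs: "r < d * n" "s < d * n" for r s
  proof -
    have "r div d + 1 \<in> {1..n + 1}" "s div d + 1 \<in> {1..n + 1}"
      using rs by (auto simp: less_mult_imp_div_less mult.commute less_imp_le)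
    with B have "mat_stored m (B (r div d + 1) (s div d + 1)) (inv_block q (r div d + 1) (s div d + 1))"
      by blast
    then have "stored m (B (r div d + 1) (s div d + 1) $$ (r mod d, s mod d))
       (inv_block q (r div d + 1) (s div d + 1) $$ (r mod d, s mod d))"
      using d_pos by (simp add: mat_stored_def)
    then show ?thesis unfolding inv_block_index[OF rs] .
  qed
  then show ?thesis by (simp add: padded_inverse_eq_Lambda_sum[OF q] mat_stored_def)
qed

lemma runs_solve:
  assumes n: "1 \<le> n"
  shows "runs (solve n) (problem_input n U V a c) (30 * (n\<^sup>2 * \<kappa>)) (\<lambda>m as. \<exists>q. ascending n 0 q \<and>
    (\<forall>q'. ascending n 0 q' \<longrightarrow> path_cost n cost 0 q \<le> path_cost n cost 0 q') \<and>
    list_all2 (stored m) as (problem_output (path_cost n cost 0 q)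
      (indicator_vec n (set q), padded_inverse d n Q (set q))))"
    (is "runs _ ?m _ ?\<Phi>")
  unfolding solve_def
\<comment> \<open>Loading constants is free, so the whole budget is passed on.\<close>
proof (rule runs_bind[OF runs_load, where ?t1.0 = 0, OF _ add_0[THEN eq_refl]])
  fix m1 z assume m1: "prefix ?m m1" "stored m1 z (of_rat 0)"
  show "runs (bind (load 1) (\<lambda>e. bind (load (1/4)) (\<lambda>q.
     bind (arc_table n z q) (\<lambda>T.
     bind (best_paths n (\<lambda>(i, j). if i = 0 then z else snd (snd (T (i, j)))) (n + 1)) (\<lambda>D.
     bind (inverse_blocks n z e T (snd (D 0))) (\<lambda>B.
     ret (fst (D 0) # map (\<lambda>k. if k + 1 \<in> set (snd (D 0)) then e else z) [0..<n] @
       concat (mat_to_list (mat (d * n) (d * n) (\<lambda>(r, s).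
         B (r div d + 1) (s div d + 1) $$ (r mod d, s mod d))))))))))) m1 (30 * (n\<^sup>2 * \<kappa>)) ?\<Phi>"
  proof (rule runs_bind[OF runs_load, where ?t1.0 = 0, OF _ add_0[THEN eq_refl]],
      rule runs_bind[OF runs_load, where ?t1.0 = 0, OF _ add_0[THEN eq_refl]])
    fix m2 e m3 q
    assume m2: "prefix m1 m2" "stored m2 e (of_rat 1)" and m3: "prefix m2 m3" "stored m3 q (of_rat (1/4))"
    have pm3: "prefix ?m m3" using m1(1) m2(1) m3(1) by (meson prefix_order.trans)
    have z3: "stored m3 z 0" and e3: "stored m3 e 1" and q3: "stored m3 q (1/4)"
      using m1(2) m2 m3 by (auto intro: stored_prefix simp: of_rat_divide)
    \<comment> \<open>The arc table, the dynamic program and the blocks of W together cost 14 n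
      \<open>\<kappa>\<close> + 12 n^2 \<open>\<kappa>\<close> + 2 n^2 + 2 n. With n <= n^2 and 1 <=
      \<open>\<kappa>\<close> this gives the constant 14 + 12 + 2 + 2 = 30.\<close>
    have bound: "n * \<kappa> + 12 * \<kappa> * (n * n) + ((n + 1) * (2 * n) + 13 * \<kappa> * n) \<le> 30 * (n\<^sup>2 * \<kappa>)"
    proof -
      have "n \<le> n\<^sup>2" using n by (simp add: power2_eq_square)
      moreover from this have "n * \<kappa> \<le> n\<^sup>2 * \<kappa>" by (rule mult_le_mono1)
      moreover have "n\<^sup>2 \<le> n\<^sup>2 * \<kappa>" using \<kappa>_pos by simp
      moreover have "n * \<kappa> + 12 * \<kappa> * (n * n) + ((n + 1) * (2 * n) + 13 * \<kappa> * n)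
          = 14 * (n * \<kappa>) + 12 * (n\<^sup>2 * \<kappa>) + 2 * n\<^sup>2 + 2 * n"
        by (simp add: power2_eq_square algebra_simps)
      ultimately show ?thesis by linarith
    qed
    show "runs (bind (arc_table n z q) (\<lambda>T.
     bind (best_paths n (\<lambda>(i, j). if i = 0 then z else snd (snd (T (i, j)))) (n + 1)) (\<lambda>D.
     bind (inverse_blocks n z e T (snd (D 0))) (\<lambda>B.
     ret (fst (D 0) # map (\<lambda>k. if k + 1 \<in> set (snd (D 0)) then e else z) [0..<n] @
       concat (mat_to_list (mat (d * n) (d * n) (\<lambda>(r, s).
         B (r div d + 1) (s div d + 1) $$ (r mod d, s mod d))))))))) m3 (30 * (n\<^sup>2 * \<kappa>)) ?\<Phi>"
    proof (rule runs_bind[OF runs_arc_table[OF pm3 z3 q3] _ bound])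
      fix m4 T assume m4: "prefix m3 m4" and T: "\<forall>i j. 1 \<le> i \<longrightarrow> i < j \<longrightarrow> j \<le> n + 1 \<longrightarrow>
        mat_stored m4 (fst (T (i, j))) (G i j) \<and> mat_stored m4 (fst (snd (T (i, j)))) (inv_mat (M i j)) \<and>
        stored m4 (snd (snd (T (i, j)))) (cost (i, j))"
      let ?la = "\<lambda>(i, j). if i = 0 then z else snd (snd (T (i, j)))"
      have z4: "stored m4 z 0" using stored_prefix[OF z3 m4] .
      \<comment> \<open>Arcs out of 0 cost 0, so the address of the constant 0 serves for all of
        them.\<close>
      have la: "stored m4 (?la (i, j)) (cost (i, j))" if "i < j" "j \<le> n + 1" for i j
        using T that z4 by (cases "i = 0") (auto simp: arc_cost_def)
      show "runs (bind (best_paths n ?la (n + 1)) (\<lambda>D.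
         bind (inverse_blocks n z e T (snd (D 0))) (\<lambda>B.
         ret (fst (D 0) # map (\<lambda>k. if k + 1 \<in> set (snd (D 0)) then e else z) [0..<n] @
           concat (mat_to_list (mat (d * n) (d * n) (\<lambda>(r, s).
             B (r div d + 1) (s div d + 1) $$ (r mod d, s mod d)))))))) m4
         ((n + 1) * (2 * n) + 13 * \<kappa> * n) ?\<Phi>"
      proof (rule runs_bind[OF runs_best_paths[where la = ?la and l = cost, OF la order_refl] _ order_refl])
        fix m5 D assume m5: "prefix m4 m5" and "\<forall>i \<le> n. n < i + (n + 1) \<longrightarrow> best_path n cost i m5 (D i)"
        then have "best_path n cost 0 m5 (D 0)" by simp
        then have q: "ascending n 0 (snd (D 0))" "stored m5 (fst (D 0)) (path_cost n cost 0 (snd (D 0)))"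
          "\<forall>q'. ascending n 0 q' \<longrightarrow> path_cost n cost 0 (snd (D 0)) \<le> path_cost n cost 0 q'"
          by (auto simp: best_path_def split: prod.splits)
        let ?q = "snd (D 0)"
        have z5: "stored m5 z 0" and e5: "stored m5 e 1"
          using z4 e3 m4 m5 by (auto intro: stored_prefix)
        have T5: "mat_stored m5 (fst (T (i, j))) (G i j) \<and> mat_stored m5 (fst (snd (T (i, j)))) (inv_mat (M i j))"
          if "1 \<le> i" "i < j" "j \<le> n + 1" for i j
          using T that mat_stored_prefix[OF _ m5] by blast
        have le: "13 * \<kappa> * length ?q + 0 \<le> 13 * \<kappa> * n" using ascending_length[OF q(1)] by simp
        show "runs (bind (inverse_blocks n z e T ?q) (\<lambda>B.
           ret (fst (D 0) # map (\<lambda>k. if k + 1 \<in> set ?q then e else z) [0..<n] @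
             concat (mat_to_list (mat (d * n) (d * n) (\<lambda>(r, s).
               B (r div d + 1) (s div d + 1) $$ (r mod d, s mod d))))))) m5 (13 * \<kappa> * n) ?\<Phi>"
        proof (rule runs_bind[OF runs_inverse_blocks[where T = T, OF T5 z5 e5 q(1)] _ le])
          fix m6 B assume m6: "prefix m5 m6"
            and B: "\<forall>b \<in> {1..n + 1}. \<forall>b' \<in> {1..n + 1}. mat_stored m6 (B b b') (inv_block ?q b b')"
          have "list_all2 (stored m6) (map (\<lambda>k. if k + 1 \<in> set ?q then e else z) [0..<n])
              (list_of_vec (indicator_vec n (set ?q)))"
            using stored_prefix[OF z5 m6] stored_prefix[OF e5 m6]
            by (auto simp: indicator_vec_def list_all2_conv_all_nth)
          moreover have "list_all2 (stored m6) (concat (mat_to_list (mat (d * n) (d * n) (\<lambda>(r, s).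
               B (r div d + 1) (s div d + 1) $$ (r mod d, s mod d))))) (entries (padded_inverse d n Q (set ?q)))"
            by (rule mat_stored_entries[OF mat_stored_assemble[OF B q(1)]])
          ultimately show "runs (ret (fst (D 0) # map (\<lambda>k. if k + 1 \<in> set ?q then e else z) [0..<n] @
             concat (mat_to_list (mat (d * n) (d * n) (\<lambda>(r, s).
               B (r div d + 1) (s div d + 1) $$ (r mod d, s mod d)))))) m6 0 ?\<Phi>"
            using q stored_prefix[OF q(2) m6]
            by (intro runs_ret exI[of _ ?q]) (auto simp: problem_output_def intro: list_all2_appendI)
        qed
      qed
    qed
  qed
qed

lemma solve_correct:
  assumes n: "1 \<le> n"
  shows "\<exists>p. shortest_path n cost p \<and>
    computes_within (30 * (n\<^sup>2 * \<kappa>))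
      (solve n (n * (d * d) + (n * (d * d) + (d * n + n))) (\<lambda>as l. Output as))
      (problem_input n U V a c)
      (problem_output (path_length cost p)
        (indicator_vec n (inner_verts n p), padded_inverse d n Q (inner_verts n p)))"
proof -
  from runs_solve[OF n] obtain q where q: "ascending n 0 q"
    "\<forall>q'. ascending n 0 q' \<longrightarrow> path_cost n cost 0 q \<le> path_cost n cost 0 q'"
    and r: "runs (solve n) (problem_input n U V a c) (30 * (n\<^sup>2 * \<kappa>)) (\<lambda>m as.
      list_all2 (stored m) as (problem_output (path_cost n cost 0 q)
        (indicator_vec n (set q), padded_inverse d n Q (set q))))"
    unfolding runs_def by blast
  from q have "shortest_path n cost (path_arcs n 0 q)" unfolding shortest_path_iff by blast
  then show ?thesis
    using runs_imp_computes_within[OF r] length_problem_input[OF factorizable a c]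
    by (intro exI[of _ "path_arcs n 0 q"])
       (simp add: path_length_path_arcs inner_verts_path_arcs[OF q(1)])
qed

end

theorem proposition9:
  shows "\<exists>K :: nat. \<forall>n d :: nat. 1 \<le> n \<longrightarrow> 1 \<le> d \<longrightarrow>
    (\<exists>P :: program. \<forall>U V :: nat \<Rightarrow> real mat. \<forall>Q :: real mat. \<forall>a c :: real vec.
      block_factorizable d n U V Q \<longrightarrow> pos_def Q \<longrightarrow>
      a \<in> carrier_vec (d * n) \<longrightarrow> c \<in> carrier_vec n \<longrightarrow>
      (let l = arc_cost d n U V a c;
           sol = (\<lambda>p. (indicator_vec n (inner_verts n p), padded_inverse d n Q (inner_verts n p)))
       in (\<forall>p. shortest_path n l p \<longrightarrow>
             is_arg_min (objective a c) (\<lambda>x. x \<in> P_B d n Q) (sol p) \<and>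
             objective a c (sol p) = path_length l p) \<and>
          (\<exists>p. shortest_path n l p \<and>
             computes_within (K * (n\<^sup>2 * mat_complexity d)) P
               (problem_input n U V a c) (problem_output (path_length l p) (sol p)))))"
proof (intro exI[of _ 30] allI impI)
  fix n d :: nat assume n: "1 \<le> n" and d: "1 \<le> d"
  obtain Pm where Pm: "\<And>A B. A \<in> carrier_mat d d \<Longrightarrow> B \<in> carrier_mat d d \<Longrightarrow>
      computes_within (mult_complexity d) Pm (entries A @ entries B) (entries (A * B))"
    by (rule mult_program[of d]) (rule that)
  obtain Pi where Pi: "\<And>A. A \<in> carrier_mat d d \<Longrightarrow> det A \<noteq> 0 \<Longrightarrow>
      computes_within (inv_complexity d) Pi (entries A) (entries (inv_mat A))"
    by (rule inv_program[of d]) (rule that)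
  interpret block_programs d Pm Pi using d Pm Pi by unfold_locales
  \<comment> \<open>The number is the input length, which by \<open>length_problem_input\<close>
    depends on \<open>n\<close> and \<open>d\<close> only; hence the program is fixed before the
    data.\<close>
  let ?P = "solve n (n * (d * d) + (n * (d * d) + (d * n + n))) (\<lambda>as l. Output as)"
  show "\<exists>P :: program. \<forall>U V :: nat \<Rightarrow> real mat. \<forall>Q :: real mat. \<forall>a c :: real vec.
      block_factorizable d n U V Q \<longrightarrow> pos_def Q \<longrightarrow>
      a \<in> carrier_vec (d * n) \<longrightarrow> c \<in> carrier_vec n \<longrightarrow>
      (let l = arc_cost d n U V a c;
           sol = (\<lambda>p. (indicator_vec n (inner_verts n p), padded_inverse d n Q (inner_verts n p)))
       in (\<forall>p. shortest_path n l p \<longrightarrow>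
             is_arg_min (objective a c) (\<lambda>x. x \<in> P_B d n Q) (sol p) \<and>
             objective a c (sol p) = path_length l p) \<and>
          (\<exists>p. shortest_path n l p \<and>
             computes_within (30 * (n\<^sup>2 * mat_complexity d)) P
               (problem_input n U V a c) (problem_output (path_length l p) (sol p))))"
  proof (intro exI[of _ ?P] allI impI)
    fix U V :: "nat \<Rightarrow> real mat" and Q :: "real mat" and a c :: "real vec"
    assume "block_factorizable d n U V Q" "pos_def Q" and a: "a \<in> carrier_vec (d * n)" and c: "c \<in> carrier_vec n"
    then interpret algorithm d n Pm Pi U V Q a c by unfold_locales
    show "let l = arc_cost d n U V a c;
           sol = (\<lambda>p. (indicator_vec n (inner_verts n p), padded_inverse d n Q (inner_verts n p)))
       in (\<forall>p. shortest_path n l p \<longrightarrow>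
             is_arg_min (objective a c) (\<lambda>x. x \<in> P_B d n Q) (sol p) \<and>
             objective a c (sol p) = path_length l p) \<and>
          (\<exists>p. shortest_path n l p \<and>
             computes_within (30 * (n\<^sup>2 * mat_complexity d)) ?P
               (problem_input n U V a c) (problem_output (path_length l p) (sol p)))"
      unfolding Let_def
      by (intro conjI allI impI shortest_path_optimal[OF a c] solve_correct[OF n])
  qed
qed

end
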